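(* Let $(\Sigma,\varepsilon)$ be an oriented signed graph and let $f$ be an integral flow of $(\Sigma,\varepsilon)$. (a) $f$ is indecomposable if and only if there exists an Eulerian cycle-tree $T$ of $\Sigma$ such that \[ f=[\varepsilon,\varepsilon_f]\cdot I_T . \] (b) If $T$ is an Eulerian cycle-tree of $\Sigma$ which is not a circuit, then for each closed walk $W$ of minimum length that uses all edges of $T$, there is a decomposition \[ W=C_0P_1C_1\cdots P_kC_kP_{k+1},\qquad k\ge 1, \] where the $C_i$ are entire end-block cycles of $T$ and each $C_iP_{i+1}C_{i+1}$ ($0\le i\le k$, with $C_{k+1}=C_0$) is a circuit of Type III, such that \[ I_T=\frac12\sum_{i=0}^{k} I_{\Sigma(C_iP_{i+1}C_{i+1})}. \]
   Context: A signed graph $\Sigma=(V,E,\sigma)$ is a finite graph (loops and multiple edges allowed) with a sign function $\sigma:E\to\{-1,1\}$; for $S\subseteq E$, $\Sigma(S)$ is the signed subgraph with edge set $S$ and the restricted signs. A cycle is a simple closed path (a loop is a cycle of length $1$); its sign is the product of the signs of its edges, and it is balanced if this sign is $+1$ and unbalanced otherwise. An orientation of $\Sigma$ (or of a signed subgraph) is a function $\varepsilon$ assigning to each vertex–edge pair $(v,e)$ a value in $\{-1,0,1\}$, with $\varepsilon(v,e)=0$ if $v$ is not an end-vertex of $e$, $\varepsilon(v,e)\in\{\pm1\}$ otherwise, and $\varepsilon(u,e)\varepsilon(v,e)=-\sigma(e)$ for $e=uv$ (for a positive loop at $v$, $\varepsilon(v,e)$ takes both values $+1$ and $-1$). The value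 $+1$ means the arrow points away from $v$, $-1$ toward $v$. A vertex is a sink (source) of an oriented signed subgraph if all its arrows point toward (away from) it. An integral flow of $(\Sigma,\varepsilon)$ is $f:E\to\mathbb Z$ with $\sum_{e}m_{v,e}f(e)=0$ for every $v\in V$, where $m_{v,e}=\varepsilon(v,e)$ if $e$ is a non-loop, $m_{v,e}=2\varepsilon(v,e)$ if $e$ is a negative loop at $v$, and $m_{v,e}=0$ otherwise. Its support is $\operatorname{supp}f=\{e:f(e)\ne0\}$; $f$ is nontrivial if its support is nonempty. A nontrivial integral flow $f$ is decomposable if $f=f_1+f_2$ with $f_1,f_2$ nontrivial integral flows satisfying $f_1(e)f_2(e)\ge0$ for all $e$; nontrivial integral flows that are not decomposable are indecomposable. For orientations $\varepsilon_1,\varepsilon_2$ of signed subgraphs $\Sigma_1,\Sigma_2$, the coupling $[\varepsilon_1,\varepsilon_2]:E\to\mathbb Z$ is $[\varepsilon_1,\varepsilon_2](e)=\varepsilon_1(v,e)\varepsilon_2(v,e)$ if $e\in\Sigma_1\cap\Sigma_2$ with end-vertex $v$, and $0$ otherwise. For $f:E\to\mathbb R$, $\varepsilon_f$ is the orientation with $\varepsilon_f(u,x)=-\varepsilon(u,x)$ if $f(x)<0$ and $\varepsilon_f(u,x)=\varepsilon(u,x)$ otherwise. A cycle-tree of $\Sigma$ is a connected signed subgraph $T$ decomposed into edge-disjoint cycles $C_i$ (block cycles) and vertex-disjoint simple paths $P_j$ (block paths, possibly of length zero) such that: (i) $\{C_i\}$ is the set of all cycles of $T$; (ii) two block cycles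 meet in at most a single vertex (an intersection vertex); (iii) each $P_j$ meets exactly two block cycles, exactly at its initial and terminal vertices (also intersection vertices); (iv) every intersection vertex is a cut-point of $T$. It is Eulerian if moreover each balanced block cycle has an even number of intersection vertices and each unbalanced block cycle an odd number. An end-block cycle is a block cycle with exactly one intersection vertex. The indicator $I_T:E\to\mathbb Z$ is $1$ on edges of block cycles, $2$ on edges of block paths, $0$ elsewhere. A circuit is an Eulerian cycle-tree that does not properly contain any Eulerian cycle-tree. A circuit of Type III consists of two vertex-disjoint unbalanced cycles $C_1,C_2$ and a simple path $P$ of positive length with $C_1\cap P$ its initial vertex and $C_2\cap P$ its terminal vertex, written $C_1PC_2$. *)

theory Defs
  imports Complex_Main
begin

section \<open>Signed graphs\<close>

text \<open>Undirected multigraphs: an edge with one end is a loop, and distinct edges may have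
  the same ends.\<close>

record ('v, 'e) signed_graph =
  verts :: "'v set"
  edges :: "'e set"
  ends :: "'e \<Rightarrow> 'v set"
  sgn_of :: "'e \<Rightarrow> int"

definition wf_signed_graph :: "('v, 'e) signed_graph \<Rightarrow> bool" where
  "wf_signed_graph G \<longleftrightarrow> finite (verts G) \<and> finite (edges G) \<and>
     (\<forall>e\<in>edges G. ends G e \<subseteq> verts G \<and> card (ends G e) \<in> {1, 2} \<and> sgn_of G e \<in> {-1, 1})"

definition is_loop :: "('v, 'e) signed_graph \<Rightarrow> 'e \<Rightarrow> bool" where
  "is_loop G e \<longleftrightarrow> card (ends G e) = 1"

text \<open>A signed subgraph is given by its edge set; its vertices are the ends of these edges.\<close>

definition vset :: "('v, 'e) signed_graph \<Rightarrow> 'e set \<Rightarrow> 'v set" where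
  "vset G S = (\<Union>e\<in>S. ends G e)"


section \<open>Walks, paths and cycles\<close>

text \<open>A walk is the list of its steps (vertex, edge, next vertex).\<close>

type_synonym ('v, 'e) steps = "('v \<times> 'e \<times> 'v) list"

fun walk :: "('v, 'e) signed_graph \<Rightarrow> 'v \<Rightarrow> ('v, 'e) steps \<Rightarrow> 'v \<Rightarrow> bool" where
  "walk G u [] v \<longleftrightarrow> u \<in> verts G \<and> u = v"
| "walk G u ((a, e, b) # p) v \<longleftrightarrow> a = u \<and> e \<in> edges G \<and> ends G e = {a, b} \<and> walk G b p v"

definition walk_edges :: "('v, 'e) steps \<Rightarrow> 'e set" where
  "walk_edges p = (\<lambda>(a, e, b). e) ` set p"

definition walk_verts :: "'v \<Rightarrow> ('v, 'e) steps \<Rightarrow> 'v list" where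
  "walk_verts u p = u # map (\<lambda>(a, e, b). b) p"

definition simple_path :: "('v, 'e) signed_graph \<Rightarrow> 'v \<Rightarrow> ('v, 'e) steps \<Rightarrow> 'v \<Rightarrow> bool" where
  "simple_path G u p v \<longleftrightarrow> walk G u p v \<and> distinct (walk_verts u p)"

text \<open>Distinctness of the edges only matters for closed walks of length two, where it excludes
  going back and forth along one edge.\<close>

definition cycle_walk :: "('v, 'e) signed_graph \<Rightarrow> 'v \<Rightarrow> ('v, 'e) steps \<Rightarrow> bool" where
  "cycle_walk G u p \<longleftrightarrow> p \<noteq> [] \<and> walk G u p u \<and>
     distinct (map (\<lambda>(a, e, b). a) p) \<and> distinct (map (\<lambda>(a, e, b). e) p)"

definition is_cycle :: "('v, 'e) signed_graph \<Rightarrow> 'e set \<Rightarrow> bool" where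
  "is_cycle G C \<longleftrightarrow> (\<exists>u p. cycle_walk G u p \<and> C = walk_edges p)"

definition cycle_sign :: "('v, 'e) signed_graph \<Rightarrow> 'e set \<Rightarrow> int" where
  "cycle_sign G C = (\<Prod>e\<in>C. sgn_of G e)"

definition balanced :: "('v, 'e) signed_graph \<Rightarrow> 'e set \<Rightarrow> bool" where
  "balanced G C \<longleftrightarrow> cycle_sign G C = 1"

definition unbalanced :: "('v, 'e) signed_graph \<Rightarrow> 'e set \<Rightarrow> bool" where
  "unbalanced G C \<longleftrightarrow> cycle_sign G C = -1"

definition connected_sub :: "('v, 'e) signed_graph \<Rightarrow> 'e set \<Rightarrow> bool" where
  "connected_sub G T \<longleftrightarrow> T \<noteq> {} \<and>
     (\<forall>u\<in>vset G T. \<forall>v\<in>vset G T. \<exists>p. walk G u p v \<and> walk_edges p \<subseteq> T)"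

text \<open>A cut-point of a connected subgraph separates its edges into two parts that have only this
  vertex in common. Counting components after deleting the vertex together with its incident
  edges would be wrong for loops: the common vertex of two loops is a cut-point.\<close>

definition cut_point :: "('v, 'e) signed_graph \<Rightarrow> 'e set \<Rightarrow> 'v \<Rightarrow> bool" where
  "cut_point G T v \<longleftrightarrow> (\<exists>A B. A \<noteq> {} \<and> B \<noteq> {} \<and> A \<union> B = T \<and> A \<inter> B = {} \<and>
     vset G A \<inter> vset G B = {v})"


section \<open>Orientations and integral flows\<close>

text \<open>An orientation of the subgraph with edge set \<open>S\<close>. A positive loop has two ends
  carrying opposite values at its vertex; the value recorded by \<open>\<epsilon> v e\<close> is the one at a fixed
  first end of the loop, the second end carrying \<open>- \<epsilon> v e\<close>. So a positive loop has exactly two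
  orientations, exchanged by negation.\<close>

definition orientation ::
    "('v, 'e) signed_graph \<Rightarrow> 'e set \<Rightarrow> ('v \<Rightarrow> 'e \<Rightarrow> int) \<Rightarrow> bool" where
  "orientation G S \<epsilon> \<longleftrightarrow>
     (\<forall>e\<in>S. \<forall>v. (v \<notin> ends G e \<longrightarrow> \<epsilon> v e = 0) \<and> (v \<in> ends G e \<longrightarrow> \<epsilon> v e \<in> {-1, 1})) \<and>
     (\<forall>e\<in>S. \<forall>u v. ends G e = {u, v} \<and> \<not> (is_loop G e \<and> sgn_of G e = 1) \<longrightarrow>
        \<epsilon> u e * \<epsilon> v e = - sgn_of G e)"

definition incidence ::
    "('v, 'e) signed_graph \<Rightarrow> ('v \<Rightarrow> 'e \<Rightarrow> int) \<Rightarrow> 'v \<Rightarrow> 'e \<Rightarrow> int" where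
  "incidence G \<epsilon> v e =
     (if \<not> is_loop G e then \<epsilon> v e
      else if ends G e = {v} \<and> sgn_of G e = -1 then 2 * \<epsilon> v e
      else 0)"

text \<open>Functions on the edge set are represented by functions vanishing outside of it.\<close>

definition integral_flow ::
    "('v, 'e) signed_graph \<Rightarrow> ('v \<Rightarrow> 'e \<Rightarrow> int) \<Rightarrow> ('e \<Rightarrow> int) \<Rightarrow> bool" where
  "integral_flow G \<epsilon> f \<longleftrightarrow> (\<forall>e. e \<notin> edges G \<longrightarrow> f e = 0) \<and>
     (\<forall>v\<in>verts G. (\<Sum>e\<in>edges G. incidence G \<epsilon> v e * f e) = 0)"

definition supp :: "('e \<Rightarrow> int) \<Rightarrow> 'e set" where
  "supp f = {e. f e \<noteq> 0}"

definition nontrivial_flow ::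
    "('v, 'e) signed_graph \<Rightarrow> ('v \<Rightarrow> 'e \<Rightarrow> int) \<Rightarrow> ('e \<Rightarrow> int) \<Rightarrow> bool" where
  "nontrivial_flow G \<epsilon> f \<longleftrightarrow> integral_flow G \<epsilon> f \<and> supp f \<noteq> {}"

definition decomposable ::
    "('v, 'e) signed_graph \<Rightarrow> ('v \<Rightarrow> 'e \<Rightarrow> int) \<Rightarrow> ('e \<Rightarrow> int) \<Rightarrow> bool" where
  "decomposable G \<epsilon> f \<longleftrightarrow> nontrivial_flow G \<epsilon> f \<and>
     (\<exists>f1 f2. nontrivial_flow G \<epsilon> f1 \<and> nontrivial_flow G \<epsilon> f2 \<and>
        (\<forall>e. f e = f1 e + f2 e) \<and> (\<forall>e. f1 e * f2 e \<ge> 0))"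

definition indecomposable ::
    "('v, 'e) signed_graph \<Rightarrow> ('v \<Rightarrow> 'e \<Rightarrow> int) \<Rightarrow> ('e \<Rightarrow> int) \<Rightarrow> bool" where
  "indecomposable G \<epsilon> f \<longleftrightarrow> nontrivial_flow G \<epsilon> f \<and> \<not> decomposable G \<epsilon> f"

text \<open>The coupling of orientations of the subgraphs with edge sets \<open>S1\<close> and \<open>S2\<close>; the product
  does not depend on the chosen end of the edge.\<close>

definition coupling ::
    "('v, 'e) signed_graph \<Rightarrow> 'e set \<Rightarrow> ('v \<Rightarrow> 'e \<Rightarrow> int) \<Rightarrow> 'e set \<Rightarrow> ('v \<Rightarrow> 'e \<Rightarrow> int) \<Rightarrow> 'e \<Rightarrow> int" where
  "coupling G S1 \<epsilon>1 S2 \<epsilon>2 e =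
     (if e \<in> S1 \<inter> S2 then let v = (SOME v. v \<in> ends G e) in \<epsilon>1 v e * \<epsilon>2 v e else 0)"

definition reorient ::
    "('v \<Rightarrow> 'e \<Rightarrow> int) \<Rightarrow> ('e \<Rightarrow> 'a::{zero, linorder}) \<Rightarrow> 'v \<Rightarrow> 'e \<Rightarrow> int" where
  "reorient \<epsilon> f u x = (if f x < 0 then - \<epsilon> u x else \<epsilon> u x)"


section \<open>Cycle-trees\<close>

text \<open>Block paths are triples of initial vertex, steps and terminal vertex, so that paths of
  length zero keep track of their vertex.\<close>

type_synonym ('v, 'e) path = "'v \<times> ('v, 'e) steps \<times> 'v"

definition path_verts :: "('v, 'e) path \<Rightarrow> 'v set" where
  "path_verts P = (case P of (u, p, v) \<Rightarrow> set (walk_verts u p))"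

definition path_edges :: "('v, 'e) path \<Rightarrow> 'e set" where
  "path_edges P = (case P of (u, p, v) \<Rightarrow> walk_edges p)"

definition intersection_verts ::
    "('v, 'e) signed_graph \<Rightarrow> 'e set set \<Rightarrow> ('v, 'e) path set \<Rightarrow> 'v set" where
  "intersection_verts G Cs Ps =
     {w. \<exists>C\<in>Cs. \<exists>D\<in>Cs. C \<noteq> D \<and> w \<in> vset G C \<inter> vset G D} \<union>
     {w. \<exists>(u, p, v)\<in>Ps. w = u \<or> w = v}"

text \<open>The subgraph with edge set \<open>T\<close> is a cycle-tree with block cycles \<open>Cs\<close> and block paths
  \<open>Ps\<close>. The block paths of length zero are the vertices where two block cycles meet. As a block
  path meets exactly two block cycles, no three block cycles have a common vertex.\<close>

definition cycle_tree_decomp ::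
    "('v, 'e) signed_graph \<Rightarrow> 'e set \<Rightarrow> 'e set set \<Rightarrow> ('v, 'e) path set \<Rightarrow> bool" where
  "cycle_tree_decomp G T Cs Ps \<longleftrightarrow>
     T \<subseteq> edges G \<and> connected_sub G T \<and>
     T = \<Union>Cs \<union> (\<Union>P\<in>Ps. path_edges P) \<and>
     (\<forall>C\<in>Cs. \<forall>D\<in>Cs. C \<noteq> D \<longrightarrow> C \<inter> D = {}) \<and>
     (\<forall>C\<in>Cs. \<forall>P\<in>Ps. C \<inter> path_edges P = {}) \<and>
     (\<forall>(u, p, v)\<in>Ps. simple_path G u p v) \<and>
     (\<forall>P\<in>Ps. \<forall>Q\<in>Ps. P \<noteq> Q \<longrightarrow> path_verts P \<inter> path_verts Q = {}) \<and>
     Cs = {C. C \<subseteq> T \<and> is_cycle G C} \<and>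
     (\<forall>C\<in>Cs. \<forall>D\<in>Cs. C \<noteq> D \<longrightarrow>
        vset G C \<inter> vset G D = {} \<or> (\<exists>w. vset G C \<inter> vset G D = {w} \<and> (w, [], w) \<in> Ps)) \<and>
     (\<forall>P\<in>Ps. case P of (u, p, v) \<Rightarrow>
        \<exists>C D. C \<noteq> D \<and> {B\<in>Cs. vset G B \<inter> path_verts P \<noteq> {}} = {C, D} \<and>
          vset G C \<inter> path_verts P = {u} \<and> vset G D \<inter> path_verts P = {v}) \<and>
     (\<forall>w\<in>intersection_verts G Cs Ps. cut_point G T w)"

definition cycle_tree :: "('v, 'e) signed_graph \<Rightarrow> 'e set \<Rightarrow> bool" where
  "cycle_tree G T \<longleftrightarrow> (\<exists>Cs Ps. cycle_tree_decomp G T Cs Ps)"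

definition eulerian_cycle_tree :: "('v, 'e) signed_graph \<Rightarrow> 'e set \<Rightarrow> bool" where
  "eulerian_cycle_tree G T \<longleftrightarrow> (\<exists>Cs Ps. cycle_tree_decomp G T Cs Ps \<and>
     (\<forall>C\<in>Cs. (balanced G C \<longrightarrow> even (card (vset G C \<inter> intersection_verts G Cs Ps))) \<and>
             (unbalanced G C \<longrightarrow> odd (card (vset G C \<inter> intersection_verts G Cs Ps)))))"

definition end_block_cycle :: "('v, 'e) signed_graph \<Rightarrow> 'e set \<Rightarrow> 'e set \<Rightarrow> bool" where
  "end_block_cycle G T C \<longleftrightarrow> (\<exists>Cs Ps. cycle_tree_decomp G T Cs Ps \<and> C \<in> Cs \<and>
     card (vset G C \<inter> intersection_verts G Cs Ps) = 1)"

text \<open>The cycle-tree \<open>T\<close> determines its block cycles, and its block paths up to reversal.\<close>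

definition tree_indicator :: "('v, 'e) signed_graph \<Rightarrow> 'e set \<Rightarrow> 'e \<Rightarrow> int" where
  "tree_indicator G T e =
     (if \<exists>Cs Ps. cycle_tree_decomp G T Cs Ps \<and> (\<exists>C\<in>Cs. e \<in> C) then 1
      else if \<exists>Cs Ps. cycle_tree_decomp G T Cs Ps \<and> (\<exists>P\<in>Ps. e \<in> path_edges P) then 2
      else 0)"

definition circuit :: "('v, 'e) signed_graph \<Rightarrow> 'e set \<Rightarrow> bool" where
  "circuit G T \<longleftrightarrow> eulerian_cycle_tree G T \<and> (\<forall>S. S \<subset> T \<longrightarrow> \<not> eulerian_cycle_tree G S)"

text \<open>A circuit of Type III, written as the concatenation of a cycle traversed from the initial
  vertex of the path, the path, and a cycle traversed from the terminal vertex of the path.\<close>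

definition type_III_circuit ::
    "('v, 'e) signed_graph \<Rightarrow> ('v, 'e) steps \<Rightarrow> ('v, 'e) steps \<Rightarrow> ('v, 'e) steps \<Rightarrow> bool" where
  "type_III_circuit G C P D \<longleftrightarrow> circuit G (walk_edges (C @ P @ D)) \<and>
     unbalanced G (walk_edges C) \<and> unbalanced G (walk_edges D) \<and>
     vset G (walk_edges C) \<inter> vset G (walk_edges D) = {} \<and>
     (\<exists>u v. cycle_walk G u C \<and> simple_path G u P v \<and> P \<noteq> [] \<and> cycle_walk G v D \<and>
        vset G (walk_edges C) \<inter> set (walk_verts u P) = {u} \<and>
        vset G (walk_edges D) \<inter> set (walk_verts u P) = {v})"


section \<open>Minimum covering closed walks\<close>

definition covering_closed_walk ::
    "('v, 'e) signed_graph \<Rightarrow> 'e set \<Rightarrow> ('v, 'e) steps \<Rightarrow> bool" where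
  "covering_closed_walk G T W \<longleftrightarrow> (\<exists>u. walk G u W u) \<and> walk_edges W = T"

definition min_covering_closed_walk ::
    "('v, 'e) signed_graph \<Rightarrow> 'e set \<Rightarrow> ('v, 'e) steps \<Rightarrow> bool" where
  "min_covering_closed_walk G T W \<longleftrightarrow> covering_closed_walk G T W \<and>
     (\<forall>W'. covering_closed_walk G T W' \<longrightarrow> length W \<le> length W')"

text \<open>The decomposition \<open>W = C\<^sub>0 P\<^sub>1 C\<^sub>1 \<cdots> P\<^sub>k C\<^sub>k P\<^sub>k\<^sub>+\<^sub>1\<close>. A closed walk has no
  distinguished starting point, so the list of its steps may have to be rotated first.\<close>

definition end_block_decomposition ::
    "('v, 'e) signed_graph \<Rightarrow> 'e set \<Rightarrow> ('v, 'e) steps \<Rightarrow> nat \<Rightarrow>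
      (nat \<Rightarrow> ('v, 'e) steps) \<Rightarrow> (nat \<Rightarrow> ('v, 'e) steps) \<Rightarrow> bool" where
  "end_block_decomposition G T W k C P \<longleftrightarrow>
     (\<exists>n. rotate n W = concat (map (\<lambda>i. C i @ P (i + 1)) [0..<k + 1])) \<and>
     C (k + 1) = C 0 \<and>
     (\<forall>i\<le>k. end_block_cycle G T (walk_edges (C i)) \<and>
             type_III_circuit G (C i) (P (i + 1)) (C (i + 1)))"

end

theory Submission
  imports Defs
begin

text \<open>Give every edge of \<open>T\<close> the weight 1 if it lies on a cycle of \<open>T\<close> and the weight 2 otherwise.
  Then \<open>T\<close> is a cycle-tree iff it is connected and every vertex either has degree 2, with all its
  edges of weight 1, or is a cut vertex with weighted degree 2 on both sides of a cut.

  Part (a). A flow \<open>f\<close> contains a coherent closed walk, one that leaves every vertex consistently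
  with the arrow by which it came. If \<open>f\<close> is indecomposable, each such walk inside \<open>f\<close> exhausts \<open>f\<close>.
  Hence it passes a vertex at most twice, and then in opposite directions; and if the two closed
  parts into which a vertex visited twice divides the walk met at a further vertex, reversing a
  segment would give a shorter coherent closed walk. So such a vertex is a cut vertex through which
  the flow passes from one side to the other, and the local description applies. The Eulerian
  condition follows because an unbalanced cycle has an odd number of sinks and sources. Conversely,
  the net flow through a cut vertex is even for every integral flow, so a summand of \<open>\<plusminus>I\<^sub>T\<close> is
  at each vertex either zero or everything.

  Part (b). A minimum covering closed walk uses each edge exactly as often as its weight. At a
  vertex visited twice it covers one side of the cut before the other, and each side contains an
  end-block cycle. So between two consecutive end-block cycles the walk repeats no vertex.\<close>

section \<open>Degrees and connectivity\<close>

text \<open>Cycle-trees are defined globally, by cycles, paths and cut-points, whereas a flow or a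
  closed walk gives information vertex by vertex. The weights mediate: the magnitude of an
  indecomposable flow and the edge counts of a minimum covering walk are both tight, and a tight
  weight is determined by its edge set. The value 2 on a bridge is forced by parity: the handshake
  lemma on one side of the bridge makes its weight even, and the local condition bounds it by 2. All
  parity facts about flows have one source: the incidences of an edge sum to 0 if it is positive and
  to 2 or -2 if it is negative. Modulo 2 this makes the net flow out of one side of a cut even;
  modulo 4 it ties the sign of a cycle to its number of sources and sinks. The obstacle in the
  converse of (a) is that the Eulerian condition does not mention orientations. That a flow of
  magnitude \<open>tree_indicator G T\<close> really changes sides at every cut vertex has to be
  deduced from the flow equations, by descending from a hypothetical bad cut to a smaller side.
  Positive loops have incidence 0 and are invisible to the flow equations, so they are separated
  before coherent walks are used.\<close>

locale sgraph =
  fixes G :: "('v, 'e) signed_graph"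
  assumes wf: "wf_signed_graph G"
begin

abbreviation V :: "'e set \<Rightarrow> 'v set" where
  "V \<equiv> vset G"

lemma finite_edges: "finite (edges G)" and finite_verts: "finite (verts G)"
  using wf by (auto simp: wf_signed_graph_def)

lemma ends_subset: "e \<in> edges G \<Longrightarrow> ends G e \<subseteq> verts G"
  using wf by (auto simp: wf_signed_graph_def)

lemma sgn_cases: "e \<in> edges G \<Longrightarrow> sgn_of G e = 1 \<or> sgn_of G e = -1"
  using wf by (auto simp: wf_signed_graph_def)

lemma finite_sub: "T \<subseteq> edges G \<Longrightarrow> finite T"
  by (rule finite_subset[OF _ finite_edges])

lemma ends_pair:
  assumes "e \<in> edges G"
  obtains a b where "ends G e = {a, b}" "a \<in> verts G" "b \<in> verts G"
proof -
  have "card (ends G e) = 1 \<or> card (ends G e) = 2"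
    using assms wf by (auto simp: wf_signed_graph_def)
  then obtain a b where "ends G e = {a, b}"
    by (metis card_1_singletonE card_2_iff insert_absorb2)
  then show ?thesis using that ends_subset[OF assms] by auto
qed

lemma ends_other:
  assumes "e \<in> edges G" "a \<in> ends G e"
  obtains b where "ends G e = {a, b}"
proof -
  obtain x y where "ends G e = {x, y}" using ends_pair[OF assms(1)] .
  with assms(2) that show ?thesis by (metis insert_commute insert_iff singletonD)
qed

lemma ends_nonempty: "e \<in> edges G \<Longrightarrow> ends G e \<noteq> {}"
  by (metis ends_pair insert_not_empty)

lemma vset_Un [simp]: "V (A \<union> B) = V A \<union> V B"
  and vset_empty [simp]: "V {} = {}"
  and vset_insert [simp]: "V (insert e A) = ends G e \<union> V A"
  by (auto simp: vset_def)

lemma vset_mono: "A \<subseteq> B \<Longrightarrow> V A \<subseteq> V B"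
  by (auto simp: vset_def)

lemma in_vset: "v \<in> V A \<longleftrightarrow> (\<exists>e\<in>A. v \<in> ends G e)"
  by (auto simp: vset_def)

lemma vset_subset_verts: "A \<subseteq> edges G \<Longrightarrow> V A \<subseteq> verts G"
  unfolding vset_def by (intro UN_least ends_subset) (rule subsetD)

lemma finite_vset: "A \<subseteq> edges G \<Longrightarrow> finite (V A)"
  by (rule finite_subset[OF vset_subset_verts finite_verts])

lemma vset_nonempty: "A \<subseteq> edges G \<Longrightarrow> A \<noteq> {} \<Longrightarrow> V A \<noteq> {}"
  by (metis Sup_bot_conv(2) all_not_in_conv ends_nonempty image_eqI subsetD vset_def)

text \<open>The number of half-edges of \<open>e\<close> at \<open>v\<close>; counting a loop twice
  gives every edge the total 2.\<close>

definition hdeg :: "'v \<Rightarrow> 'e \<Rightarrow> nat" where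
  "hdeg v e = (if v \<in> ends G e then if is_loop G e then 2 else 1 else 0)"

lemma hdeg_pair: "ends G e = {a, b} \<Longrightarrow> hdeg v e = of_bool (v = a) + of_bool (v = b)"
  by (auto simp: hdeg_def is_loop_def card_insert_if)

lemma hdeg_eq_0 [simp]: "hdeg v e = 0 \<longleftrightarrow> v \<notin> ends G e"
  by (simp add: hdeg_def)

lemma hdeg_pos: "v \<in> ends G e \<Longrightarrow> hdeg v e \<ge> 1"
  by (simp add: hdeg_def)

lemma sum_hdeg:
  assumes "e \<in> edges G" "finite X" "ends G e \<subseteq> X"
  shows "(\<Sum>v\<in>X. hdeg v e) = 2"
proof -
  obtain a b where ab: "ends G e = {a, b}" using ends_pair[OF assms(1)] .
  then have "(\<Sum>v\<in>X. hdeg v e) = (\<Sum>v\<in>X. of_bool (v = a)) + (\<Sum>v\<in>X. of_bool (v = b))"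
    by (simp add: hdeg_pair sum.distrib)
  also have "\<dots> = 2" using assms ab by (simp add: of_bool_def)
  finally show ?thesis .
qed

text \<open>One notion of degree for all purposes: \<open>m\<close> will be the magnitude of a flow,
  the edge counts of a walk, the indicator of a cycle-tree, or constantly 1.\<close>

definition wdeg :: "('e \<Rightarrow> nat) \<Rightarrow> 'e set \<Rightarrow> 'v \<Rightarrow> nat" where
  "wdeg m A v = (\<Sum>e\<in>A. m e * hdeg v e)"

lemma wdeg_Un:
  "A \<subseteq> edges G \<Longrightarrow> B \<subseteq> edges G \<Longrightarrow> A \<inter> B = {} \<Longrightarrow> wdeg m (A \<union> B) v = wdeg m A v + wdeg m B v"
  unfolding wdeg_def by (intro sum.union_disjoint finite_sub)

lemma wdeg_split:
  "T \<subseteq> edges G \<Longrightarrow> A \<subseteq> T \<Longrightarrow> wdeg m T v = wdeg m A v + wdeg m (T - A) v"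
  by (metis Diff_disjoint Diff_partition Diff_subset order_trans wdeg_Un)

lemma wdeg_empty [simp]: "wdeg m {} v = 0"
  by (simp add: wdeg_def)

lemma wdeg_insert:
  "e \<in> edges G \<Longrightarrow> A \<subseteq> edges G \<Longrightarrow> e \<notin> A \<Longrightarrow> wdeg m (insert e A) v = m e * hdeg v e + wdeg m A v"
  unfolding wdeg_def by (simp add: finite_sub)

lemma wdeg_outside: "v \<notin> V A \<Longrightarrow> wdeg m A v = 0"
  unfolding wdeg_def by (intro sum.neutral) (auto simp: in_vset)

lemma wdeg_mono: "A \<subseteq> B \<Longrightarrow> B \<subseteq> edges G \<Longrightarrow> wdeg m A v \<le> wdeg m B v"
  unfolding wdeg_def by (intro sum_mono2 finite_sub) auto

lemma wdeg_ge: "A \<subseteq> edges G \<Longrightarrow> e \<in> A \<Longrightarrow> m e * hdeg v e \<le> wdeg m A v"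
  unfolding wdeg_def by (intro member_le_sum finite_sub) auto

lemma wdeg_cong: "(\<And>e. e \<in> A \<Longrightarrow> v \<in> ends G e \<Longrightarrow> m e = m' e) \<Longrightarrow> wdeg m A v = wdeg m' A v"
  unfolding wdeg_def by (intro sum.cong) (auto simp: hdeg_def)

lemma sum_wdeg:
  assumes "A \<subseteq> edges G" "finite X" "V A \<subseteq> X"
  shows "(\<Sum>v\<in>X. wdeg m A v) = 2 * (\<Sum>e\<in>A. m e)"
proof -
  have "(\<Sum>v\<in>X. wdeg m A v) = (\<Sum>e\<in>A. m e * (\<Sum>v\<in>X. hdeg v e))"
    unfolding wdeg_def by (subst sum.swap) (simp add: sum_distrib_left)
  also have "\<dots> = (\<Sum>e\<in>A. m e * 2)"
    using assms by (intro sum.cong refl, subst sum_hdeg) (auto simp: vset_def)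
  finally show ?thesis by (simp add: sum_distrib_right[symmetric])
qed

text \<open>Connectivity phrased through edge sets instead of walks, so that it acts as an induction
  principle: a nonempty part of \<open>T\<close> that shares no vertex with the rest is all of
  \<open>T\<close>.\<close>

definition conn :: "'e set \<Rightarrow> bool" where
  "conn T \<longleftrightarrow> T \<noteq> {} \<and> (\<forall>X\<subseteq>T. X \<noteq> {} \<longrightarrow> V X \<inter> V (T - X) = {} \<longrightarrow> X = T)"

lemma connD: "conn T \<Longrightarrow> X \<subseteq> T \<Longrightarrow> X \<noteq> {} \<Longrightarrow> V X \<inter> V (T - X) = {} \<Longrightarrow> X = T"
  by (auto simp: conn_def)

lemma connD_edges:
  assumes "conn T" "X \<subseteq> T" "X \<noteq> {}"
    and "\<And>e e' v. e \<in> X \<Longrightarrow> e' \<in> T \<Longrightarrow> v \<in> ends G e \<Longrightarrow> v \<in> ends G e' \<Longrightarrow> e' \<in> X"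
  shows "X = T"
  by (rule connD[OF assms(1-3)]) (use assms(4) in \<open>auto simp: in_vset\<close>)

section \<open>Walks\<close>

definition starts :: "('v, 'e) steps \<Rightarrow> 'v list" where
  "starts p = map (\<lambda>(a, e, b). a) p"

definition elist :: "('v, 'e) steps \<Rightarrow> 'e list" where
  "elist p = map (\<lambda>(a, e, b). e) p"

abbreviation cnt :: "('v, 'e) steps \<Rightarrow> 'e \<Rightarrow> nat" where
  "cnt p \<equiv> count_list (elist p)"

definition reverse :: "('v, 'e) steps \<Rightarrow> ('v, 'e) steps" where
  "reverse p = rev (map (\<lambda>(a, e, b). (b, e, a)) p)"

lemma starts_simps [simp]:
  "starts [] = []" "starts (s # p) = fst s # starts p" "starts (p @ q) = starts p @ starts q"
  "length (starts p) = length p" "starts p = [] \<longleftrightarrow> p = []"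
  by (auto simp: starts_def split: prod.splits)

lemma elist_simps [simp]:
  "elist [] = []" "elist (s # p) = fst (snd s) # elist p" "elist (p @ q) = elist p @ elist q"
  "length (elist p) = length p" "elist p = [] \<longleftrightarrow> p = []"
  by (auto simp: elist_def split: prod.splits)

lemma walk_edges_simps [simp]:
  "walk_edges [] = {}" "walk_edges (s # p) = insert (fst (snd s)) (walk_edges p)"
  "walk_edges (p @ q) = walk_edges p \<union> walk_edges q"
  by (auto simp: walk_edges_def image_Un split: prod.splits)

lemma set_elist [simp]: "set (elist p) = walk_edges p"
  by (auto simp: elist_def walk_edges_def)

lemma walk_edges_finite [simp]: "finite (walk_edges p)"
  by (simp add: walk_edges_def)

lemma walk_edges_eq_empty [simp]: "walk_edges p = {} \<longleftrightarrow> p = []"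
  by (simp add: walk_edges_def)

lemma walk_verts_simps [simp]:
  "walk_verts u [] = [u]" "walk_verts u ((a, e, b) # p) = u # walk_verts b p"
  by (auto simp: walk_verts_def)

lemma walk_append: "walk G u (p @ q) v \<longleftrightarrow> (\<exists>w. walk G u p w \<and> walk G w q v)"
proof (induction p arbitrary: u)
  case Nil
  then show ?case
  proof (cases q)
    case (Cons s q')
    then show ?thesis using ends_subset by (cases s) fastforce
  qed auto
next
  case (Cons s p)
  then show ?case by (cases s) auto
qed

lemma walk_verts_in: "walk G u p v \<Longrightarrow> u \<in> verts G \<and> v \<in> verts G"
proof (induction p arbitrary: u)
  case (Cons s p)
  then show ?case using ends_subset by (cases s) fastforce
qed auto

lemma walk_Cons_fst: "walk G u (s # p) v \<Longrightarrow> fst s = u"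
  by (cases s) auto

lemma walk_start: "walk G u p v \<Longrightarrow> p \<noteq> [] \<Longrightarrow> hd (starts p) = u"
  using walk_Cons_fst by (cases p) auto

lemma walk_edges_sub: "walk G u p v \<Longrightarrow> walk_edges p \<subseteq> edges G"
proof (induction p arbitrary: u)
  case (Cons s p)
  then show ?case by (cases s) auto
qed auto

lemma walk_verts_append: "walk G u p w \<Longrightarrow> walk_verts u (p @ q) = starts p @ walk_verts w q"
proof (induction p arbitrary: u)
  case (Cons s p)
  then show ?case by (cases s) auto
qed auto

lemma walk_verts_eq: "walk G u p v \<Longrightarrow> walk_verts u p = starts p @ [v]"
  using walk_verts_append[of u p v "[]"] by simp

lemma set_walk_verts: "walk G u p v \<Longrightarrow> set (walk_verts u p) = insert u (V (walk_edges p))"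
proof (induction p arbitrary: u)
  case (Cons s p)
  then show ?case by (cases s) auto
qed auto

lemma walk_verts_closed: "walk G u p u \<Longrightarrow> p \<noteq> [] \<Longrightarrow> set (starts p) = V (walk_edges p)"
proof -
  assume a: "walk G u p u" "p \<noteq> []"
  have "u \<in> set (starts p)" using a walk_start[of u p u] by (metis hd_in_set starts_simps(5))
  moreover have "u \<in> V (walk_edges p)"
  proof (cases p)
    case (Cons s q)
    then show ?thesis using a by (cases s) auto
  qed (use a in auto)
  ultimately show ?thesis
    using set_walk_verts[OF a(1)] walk_verts_eq[OF a(1)] by auto
qed

lemma walk_start_in_vset: "walk G u p v \<Longrightarrow> p \<noteq> [] \<Longrightarrow> u \<in> V (walk_edges p) \<and> v \<in> V (walk_edges p)"
proof (induction p arbitrary: u)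
  case (Cons s p)
  then show ?case by (cases s; cases "p = []") auto
qed auto

lemma reverse_simps [simp]:
  "reverse [] = []" "reverse (p @ q) = reverse q @ reverse p" "walk_edges (reverse p) = walk_edges p"
  "length (reverse p) = length p" "cnt (reverse p) e = cnt p e"
  "reverse ((a, e', b) # p) = reverse p @ [(b, e', a)]"
proof -
  show "reverse [] = []" "reverse (p @ q) = reverse q @ reverse p"
    "length (reverse p) = length p" "reverse ((a, e', b) # p) = reverse p @ [(b, e', a)]"
    by (simp_all add: reverse_def)
  have "elist (reverse p) = rev (elist p)"
    by (simp add: reverse_def elist_def rev_map case_prod_unfold)
  then show "walk_edges (reverse p) = walk_edges p" "cnt (reverse p) e = cnt p e"
    by (simp_all flip: set_elist)
qed

lemma walk_reverse: "walk G u p v \<Longrightarrow> walk G v (reverse p) u"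
proof (induction p arbitrary: u)
  case (Cons s p)
  obtain a e b where s: "s = (a, e, b)" by (cases s)
  have "walk G b [(b, e, a)] a" using Cons.prems s ends_subset walk_verts_in[OF Cons.prems] by (auto simp: insert_commute)
  then show ?case using Cons s by (auto simp: walk_append)
qed simp

text \<open>\<open>starts p\<close> records departures. Every departure from \<open>x\<close>
  follows an arrival, except the first one at \<open>u\<close>, and every arrival is followed by a
  departure, except the last one at \<open>v\<close>; this explains the two correction
  terms.\<close>

lemma wdeg_walk:
  assumes "walk G u p v" "walk_edges p \<subseteq> E" "E \<subseteq> edges G"
  shows "wdeg (cnt p) E x + of_bool (x = u) = 2 * count_list (starts p) x + of_bool (x = v)"
  using assms
proof (induction p arbitrary: u)
  case Nil
  then show ?case by (simp add: wdeg_def)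
next
  case (Cons s p)
  obtain a e b where s: "s = (a, e, b)" by (cases s)
  have ab: "ends G e = {a, b}" "a = u" "e \<in> E" using Cons.prems s by auto
  have "wdeg (cnt (s # p)) E x = (\<Sum>f\<in>E. of_bool (f = e) * hdeg x f) + wdeg (cnt p) E x"
    unfolding wdeg_def sum.distrib[symmetric] using s
    by (intro sum.cong) auto
  also have "(\<Sum>f\<in>E. of_bool (f = e) * hdeg x f) = hdeg x e"
    using ab finite_sub[OF \<open>E \<subseteq> edges G\<close>] by (simp add: of_bool_def if_distrib[of "\<lambda>c. c * _"] cong: if_cong)
  finally have 1: "wdeg (cnt (s # p)) E x = of_bool (x = a) + of_bool (x = b) + wdeg (cnt p) E x"
    unfolding hdeg_pair[OF ab(1)] .
  have "wdeg (cnt p) E x + of_bool (x = b) = 2 * count_list (starts p) x + of_bool (x = v)"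
    using Cons s by auto
  moreover have "count_list (starts (s # p)) x = of_bool (x = u) + count_list (starts p) x"
    using s ab(2) by auto
  ultimately show ?case unfolding 1 ab(2) by linarith
qed

lemma wdeg_walk_closed:
  "walk G u p u \<Longrightarrow> walk_edges p \<subseteq> E \<Longrightarrow> E \<subseteq> edges G \<Longrightarrow> wdeg (cnt p) E x = 2 * count_list (starts p) x"
  using wdeg_walk[of u p u E x] by simp

text \<open>Consecutive steps share a vertex, so a part \<open>X\<close> without common vertices
  with the rest contains all steps or none.\<close>

lemma conn_walk:
  assumes "walk G u p v" "p \<noteq> []"
  shows "conn (walk_edges p)"
  unfolding conn_def
proof (intro conjI allI impI)
  fix X assume X: "X \<subseteq> walk_edges p" "X \<noteq> {}" "V X \<inter> V (walk_edges p - X) = {}"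
  have "walk G u q w \<Longrightarrow> walk_edges q \<subseteq> walk_edges p \<Longrightarrow> walk_edges q \<subseteq> X \<or> walk_edges q \<inter> X = {}" for u q w
  proof (induction q arbitrary: u)
    case (Cons s q)
    obtain a e b where s: "s = (a, e, b)" by (cases s)
    have IH: "walk_edges q \<subseteq> X \<or> walk_edges q \<inter> X = {}" using Cons s by auto
    show ?case
    proof (cases "q = []")
      case False
      then obtain t q' where q: "q = t # q'" by (cases q) auto
      obtain a' e' b' where t: "t = (a', e', b')" by (cases t)
      have "b \<in> ends G e" "b \<in> ends G e'" using Cons.prems s q t by auto
      moreover have "e \<in> walk_edges p" "e' \<in> walk_edges p" using Cons.prems s q t by auto
      ultimately have "e \<in> X \<longleftrightarrow> e' \<in> X" using X(3) by (auto simp: vset_def)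
      then show ?thesis using IH q t s by auto
    qed (use s in auto)
  qed auto
  from this[OF assms(1)] show "X = walk_edges p" using X by blast
qed (use assms in simp)

lemma walk_step:
  assumes "e \<in> edges G" "ends G e = {a, b}"
  shows "walk G a [(a, e, b)] b"
  using assms ends_subset[OF assms(1)] by simp

lemma walk_extend:
  assumes "walk G u p a" "e \<in> edges G" "a \<in> ends G e" "b \<in> ends G e"
  obtains q where "walk G u q b" "walk_edges q \<subseteq> insert e (walk_edges p)"
proof (cases "a = b")
  case False
  obtain c where "ends G e = {a, c}" using ends_other[OF assms(2,3)] .
  then have "ends G e = {a, b}" using assms(4) False by auto
  then have "walk G a [(a, e, b)] b" by (rule walk_step[OF assms(2)])
  then have "walk G u (p @ [(a, e, b)]) b" unfolding walk_append using assms(1) by blast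
  then show ?thesis by (rule that) auto
qed (use assms that in blast)

lemma connected_sub_iff:
  assumes "T \<subseteq> edges G"
  shows "connected_sub G T \<longleftrightarrow> conn T"
proof
  assume c: "connected_sub G T"
  show "conn T" unfolding conn_def
  proof (intro conjI allI impI)
    show "T \<noteq> {}" using c by (simp add: connected_sub_def)
    fix X assume X: "X \<subseteq> T" "X \<noteq> {}" "V X \<inter> V (T - X) = {}"
    show "X = T"
    proof (rule ccontr)
      assume "X \<noteq> T"
      then have "T - X \<noteq> {}" using X by auto
      then obtain u v where uv: "u \<in> V X" "v \<in> V (T - X)"
        using vset_nonempty[of X] vset_nonempty[of "T - X"] X assms by blast
      then obtain p where p: "walk G u p v" "walk_edges p \<subseteq> T"
        using c X vset_mono[of X T] vset_mono[of "T - X" T] unfolding connected_sub_def by blast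
      have "walk G u p v \<Longrightarrow> walk_edges p \<subseteq> T \<Longrightarrow> u \<in> V X \<Longrightarrow> v \<in> V X" for u
      proof (induction p arbitrary: u)
        case (Cons s p)
        obtain a e b where s: "s = (a, e, b)" by (cases s)
        have "e \<in> X"
        proof (rule ccontr)
          assume "e \<notin> X"
          then have "a \<in> V (T - X)" using Cons.prems s by (auto simp: in_vset)
          then show False using Cons.prems s X(3) by auto
        qed
        then have "b \<in> V X" using Cons.prems s by (auto simp: in_vset)
        then show ?case using Cons s by auto
      qed auto
      then show False using p uv X(3) by blast
    qed
  qed
next
  assume c: "conn T"
  show "connected_sub G T" unfolding connected_sub_def
  proof (intro conjI ballI)
    show "T \<noteq> {}" using c by (simp add: conn_def)
    fix u v assume u: "u \<in> V T" and v: "v \<in> V T"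
    define R where "R = {w. \<exists>p. walk G u p w \<and> walk_edges p \<subseteq> T}"
    have step: "b \<in> R" if aeb: "a \<in> R" "e \<in> T" "a \<in> ends G e" "b \<in> ends G e" for a b e
    proof -
      obtain p where p: "walk G u p a" "walk_edges p \<subseteq> T" using aeb(1) by (auto simp: R_def)
      have e: "e \<in> edges G" using aeb assms by blast
      obtain q where "walk G u q b" "walk_edges q \<subseteq> insert e (walk_edges p)"
        using walk_extend[OF p(1) e aeb(3,4)] .
      then show ?thesis using p(2) aeb(2) unfolding R_def by blast
    qed
    have "u \<in> R" using u vset_subset_verts[OF assms] unfolding R_def
      by (intro CollectI exI[of _ "[]"]) auto
    let ?X = "{e \<in> T. ends G e \<inter> R \<noteq> {}}"
    have "?X = T"
    proof (rule connD_edges[OF c])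
      show "?X \<noteq> {}" using u \<open>u \<in> R\<close> by (auto simp: in_vset)
      show "e' \<in> ?X" if "e \<in> ?X" "e' \<in> T" "w \<in> ends G e" "w \<in> ends G e'" for e e' w
        using that step by blast
    qed simp
    moreover obtain e where "e \<in> T" "v \<in> ends G e" using v by (auto simp: in_vset)
    ultimately have "v \<in> R" using step by blast
    then show "\<exists>p. walk G u p v \<and> walk_edges p \<subseteq> T" unfolding R_def by blast
  qed
qed

end

section \<open>Subwalks, simple paths, Euler walks, cycles and bridges\<close>

context sgraph
begin

declare One_nat_def [simp del]

lemma walk_take_drop:
  "walk G u p v \<Longrightarrow> i \<le> length p \<Longrightarrow>
     walk G u (take i p) (walk_verts u p ! i) \<and> walk G (walk_verts u p ! i) (drop i p) v"
proof (induction p arbitrary: u i)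
  case (Cons s p)
  obtain a e b where s: "s = (a, e, b)" by (cases s)
  show ?case
  proof (cases i)
    case 0
    then show ?thesis using Cons.prems s walk_verts_in[OF Cons.prems(1)] by simp
  next
    case (Suc j)
    then show ?thesis using Cons.prems s Cons.IH[of b j] by simp
  qed
qed simp

lemma walk_segment:
  assumes "walk G u p v" "i \<le> j" "j \<le> length p"
  shows "walk G (walk_verts u p ! i) (drop i (take j p)) (walk_verts u p ! j)"
proof -
  have "walk_verts u (take j p) ! i = walk_verts u p ! i"
    using assms by (cases i) (auto simp: walk_verts_def)
  moreover have "walk G u (take j p) (walk_verts u p ! j)"
    using walk_take_drop assms by blast
  ultimately show ?thesis using walk_take_drop[of u "take j p" _ i] assms by auto
qed

lemma walk_verts_length [simp]: "length (walk_verts u p) = Suc (length p)"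
  by (simp add: walk_verts_def)

lemma walk_repeat:
  assumes "walk G u p v" "\<not> distinct (walk_verts u p)"
  obtains p1 p2 p3 w where "p = p1 @ p2 @ p3" "p2 \<noteq> []" "walk G u p1 w" "walk G w p2 w" "walk G w p3 v"
proof -
  obtain i j where "i < length (walk_verts u p)" "j < length (walk_verts u p)" "i \<noteq> j"
    "walk_verts u p ! i = walk_verts u p ! j"
    using assms(2) unfolding distinct_conv_nth by blast
  then obtain i j where ij: "i < j" "j \<le> length p" "walk_verts u p ! i = walk_verts u p ! j"
    using nat_neq_iff[of i j] by (metis less_Suc_eq_le walk_verts_length)
  show ?thesis
  proof (rule that[of "take i p" "drop i (take j p)" "drop j p" "walk_verts u p ! i"])
    have "take j p = take i p @ drop i (take j p)" using ij
      by (metis append_take_drop_id less_imp_le_nat min.absorb1 take_take)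
    then show "p = take i p @ drop i (take j p) @ drop j p"
      by (metis append.assoc append_take_drop_id)
    show "drop i (take j p) \<noteq> []" using ij by simp
    show "walk G u (take i p) (walk_verts u p ! i)"
      using walk_take_drop[OF assms(1), of i] ij(1,2) by simp
    show "walk G (walk_verts u p ! i) (drop i (take j p)) (walk_verts u p ! i)"
      using walk_segment[OF assms(1)] ij by (metis less_imp_le_nat)
    show "walk G (walk_verts u p ! i) (drop j p) v"
      using walk_take_drop[OF assms(1) ij(2)] ij(3) by simp
  qed
qed

lemma walk_split_at:
  assumes "walk G u p v" "x \<in> set (walk_verts u p)"
  obtains p1 p2 where "p = p1 @ p2" "walk G u p1 x" "walk G x p2 v"
proof -
  obtain i where "i \<le> length p" "walk_verts u p ! i = x"
    using assms(2) by (metis in_set_conv_nth less_Suc_eq_le walk_verts_length)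
  then show ?thesis
    using walk_take_drop[OF assms(1)] that[of "take i p" "drop i p"] by auto
qed

lemma simple_path_exists:
  "walk G u p v \<Longrightarrow> \<exists>q. simple_path G u q v \<and> walk_edges q \<subseteq> walk_edges p"
proof (induction "length p" arbitrary: p rule: less_induct)
  case less
  show ?case
  proof (cases "distinct (walk_verts u p)")
    case True
    then show ?thesis using less.prems by (auto simp: simple_path_def)
  next
    case False
    obtain p1 p2 p3 w where p: "p = p1 @ p2 @ p3" "p2 \<noteq> []" "walk G u p1 w" "walk G w p3 v"
      using walk_repeat[OF less.prems False] by metis
    then have "walk G u (p1 @ p3) v" "length (p1 @ p3) < length p"
      by (auto simp: walk_append)
    then show ?thesis using less.hyps[of "p1 @ p3"] p(1) by auto
  qed
qed

lemma simple_path_Cons: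
  "simple_path G u ((a, e, b) # p) v \<Longrightarrow>
     a = u \<and> e \<in> edges G \<and> ends G e = {u, b} \<and> simple_path G b p v \<and> u \<notin> set (walk_verts b p)"
  by (auto simp: simple_path_def)

lemma simple_path_start_edge:
  assumes "simple_path G u ((a, e, b) # p) v"
  shows "u \<notin> V (walk_edges p)" "e \<notin> walk_edges p"
proof -
  have *: "ends G e = {u, b}" "walk G b p v" "u \<notin> set (walk_verts b p)"
    using simple_path_Cons[OF assms] by (auto simp: simple_path_def)
  then show "u \<notin> V (walk_edges p)" using set_walk_verts by auto
  then show "e \<notin> walk_edges p" using *(1) by (auto simp: in_vset)
qed

lemma simple_path_distinct_edges: "simple_path G u p v \<Longrightarrow> distinct (elist p)"
proof (induction p arbitrary: u)
  case (Cons s p)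
  obtain a e b where s: "s = (a, e, b)" by (cases s)
  show ?case
    using Cons.IH[of b] simple_path_Cons[OF Cons.prems[unfolded s]]
      simple_path_start_edge[OF Cons.prems[unfolded s]] by (simp add: s)
qed simp

abbreviation deg :: "'e set \<Rightarrow> 'v \<Rightarrow> nat" where
  "deg \<equiv> wdeg (\<lambda>_. 1)"

lemma count_list_distinct: "distinct xs \<Longrightarrow> count_list xs x = of_bool (x \<in> set xs)"
  by (induction xs) auto

lemma distinct_if_count_list: "(\<And>x. x \<in> set xs \<Longrightarrow> count_list xs x = 1) \<Longrightarrow> distinct xs"
proof (induction xs)
  case (Cons a xs)
  have "count_list xs a = 0" using Cons.prems[of a] by simp
  then have a: "a \<notin> set xs" by (simp add: count_list_0_iff)
  moreover have "count_list xs x = 1" if "x \<in> set xs" for x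
    using Cons.prems[of x] that a by (cases "x = a") auto
  ultimately show ?case using Cons.IH by simp
qed simp

lemma deg_distinct: "distinct (elist p) \<Longrightarrow> deg (walk_edges p) x = wdeg (cnt p) (walk_edges p) x"
  by (rule wdeg_cong) (simp add: count_list_distinct)

lemma simple_path_deg:
  assumes "simple_path G u p v" "p \<noteq> []"
  shows "deg (walk_edges p) x + of_bool (x = u) + of_bool (x = v) = 2 * of_bool (x \<in> V (walk_edges p))"
proof -
  have w: "walk G u p v" and d: "distinct (starts p @ [v])"
    using assms(1) walk_verts_eq by (auto simp: simple_path_def)
  have "deg (walk_edges p) x + of_bool (x = u) = 2 * count_list (starts p) x + of_bool (x = v)"
    using wdeg_walk[OF w order_refl walk_edges_sub[OF w]]
      deg_distinct[OF simple_path_distinct_edges[OF assms(1)]] by simp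
  moreover have "V (walk_edges p) = insert v (set (starts p))"
    using set_walk_verts[OF w] walk_verts_eq[OF w] walk_start_in_vset[OF w assms(2)] by auto
  moreover have "count_list (starts p) x = of_bool (x \<in> set (starts p))"
    using d by (simp add: count_list_distinct)
  ultimately show ?thesis using d by (cases "x = v") auto
qed

lemma cycle_walk_iff:
  "cycle_walk G u p \<longleftrightarrow> p \<noteq> [] \<and> walk G u p u \<and> distinct (starts p) \<and> distinct (elist p)"
  by (auto simp: cycle_walk_def starts_def elist_def)

lemma cycle_walk_deg:
  assumes "cycle_walk G u p" "x \<in> V (walk_edges p)"
  shows "deg (walk_edges p) x = 2"
proof -
  have w: "walk G u p u" "p \<noteq> []" and d: "distinct (starts p)" "distinct (elist p)"
    using assms by (auto simp: cycle_walk_iff)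
  have "x \<in> set (starts p)" using walk_verts_closed[OF w] assms(2) by simp
  then have "count_list (starts p) x = 1" using d by (simp add: count_list_distinct)
  then show ?thesis
    using wdeg_walk_closed[OF w(1) order_refl walk_edges_sub[OF w(1)], of x] deg_distinct[OF d(2)] by simp
qed

lemma conn_nonempty: "conn T \<Longrightarrow> T \<noteq> {}"
  by (simp add: conn_def)

text \<open>Handshake lemma: the weighted degrees sum to twice the total weight, so the parity at
  the last vertex is forced by the others. This is the source of parity at bridges and cut
  vertices.\<close>

lemma even_wdeg:
  assumes "A \<subseteq> edges G" "\<And>x. x \<in> V A \<Longrightarrow> x \<noteq> v \<Longrightarrow> even (wdeg m A x)"
  shows "even (wdeg m A v)"
proof -
  let ?X = "insert v (V A)"
  have X: "finite ?X" using finite_vset[OF assms(1)] by simp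
  have "(\<Sum>x\<in>?X. wdeg m A x) = 2 * (\<Sum>e\<in>A. m e)"
    by (rule sum_wdeg[OF assms(1) X]) auto
  moreover have "(\<Sum>x\<in>?X. wdeg m A x) = wdeg m A v + (\<Sum>x\<in>V A - {v}. wdeg m A x)"
    using finite_vset[OF assms(1)] by (simp add: sum.insert_remove)
  moreover have "even (\<Sum>x\<in>V A - {v}. wdeg m A x)"
    by (rule dvd_sum) (use assms(2) in auto)
  ultimately show ?thesis by (metis dvd_add_left_iff dvd_triv_left)
qed

lemma length_eq_sum_cnt: "walk_edges p \<subseteq> E \<Longrightarrow> finite E \<Longrightarrow> length p = (\<Sum>e\<in>E. cnt p e)"
proof -
  assume "walk_edges p \<subseteq> E" "finite E"
  then have "(\<Sum>e\<in>E. cnt p e) = (\<Sum>e\<in>set (elist p). cnt p e)"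
    by (intro sum.mono_neutral_right) (auto simp: count_list_0_iff simp flip: set_elist)
  then show ?thesis by (simp only: sum_count_set[OF order_refl finite_set] elist_simps(4))
qed

lemma trail_close:
  assumes T: "T \<subseteq> edges G" "\<And>x. even (wdeg m T x)"
  shows "walk G u p v \<Longrightarrow> walk_edges p \<subseteq> T \<Longrightarrow> (\<And>e. e \<in> T \<Longrightarrow> cnt p e \<le> m e) \<Longrightarrow>
    \<exists>q. walk G u (p @ q) u \<and> walk_edges (p @ q) \<subseteq> T \<and> (\<forall>e\<in>T. cnt (p @ q) e \<le> m e)"
proof (induction "sum m T - length p" arbitrary: p v rule: less_induct)
  case less
  show ?case
  proof (cases "u = v")
    case True
    then show ?thesis using less.prems by (intro exI[of _ "[]"]) simp
  next
    case False
    have fT: "finite T" using finite_sub[OF T(1)] .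
    have "wdeg (cnt p) T v = 2 * count_list (starts p) v + 1"
      using wdeg_walk[OF less.prems(1,2) T(1), of v] False by simp
    then have "odd (wdeg (cnt p) T v)" by simp
    then have "\<not> wdeg m T v \<le> wdeg (cnt p) T v"
      using T(2)[of v] sum_mono[of T "\<lambda>e. cnt p e * hdeg v e" "\<lambda>e. m e * hdeg v e"] less.prems(3)
      unfolding wdeg_def by (metis le_antisym mult_le_mono1)
    then obtain e where e: "e \<in> T" "v \<in> ends G e" "cnt p e < m e"
      unfolding wdeg_def using sum_mono[of T "\<lambda>e. m e * hdeg v e" "\<lambda>e. cnt p e * hdeg v e"]
      by (metis hdeg_eq_0 mult_0_right mult_le_mono1 not_less order_refl)
    have eG: "e \<in> edges G" using e T by auto
    obtain w where w: "ends G e = {v, w}" using ends_other[OF eG e(2)] .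
    let ?p = "p @ [(v, e, w)]"
    have p': "walk G u ?p w" "walk_edges ?p \<subseteq> T"
      using less.prems walk_step[OF eG w] e by (auto simp: walk_append simp del: walk.simps)
    have c: "cnt ?p e' \<le> m e'" if "e' \<in> T" for e'
      using less.prems(3)[OF that] e(3) by auto
    have "length ?p \<le> sum m T"
      using sum_mono[of T "cnt ?p" m] c length_eq_sum_cnt[OF p'(2) fT] by simp
    then have "sum m T - length ?p < sum m T - length p" by simp
    from less.hyps[OF this p' c] obtain q where
      "walk G u (?p @ q) u" "walk_edges (?p @ q) \<subseteq> T" "\<forall>e\<in>T. cnt (?p @ q) e \<le> m e" by blast
    then show ?thesis by (intro exI[of _ "(v, e, w) # q"]) simp
  qed
qed

text \<open>Hierholzer: a longest closed trail that leaves some edge unused could be prolonged at one of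
  its vertices.\<close>

lemma eulerian_walk:
  assumes T: "T \<subseteq> edges G" "conn T" "\<And>x. even (wdeg m T x)" "\<And>e. e \<in> T \<Longrightarrow> m e > 0"
  obtains u p where "walk G u p u" "walk_edges p = T" "\<And>e. e \<in> T \<Longrightarrow> cnt p e = m e"
proof -
  have fT: "finite T" using finite_sub[OF T(1)] .
  define Q where "Q = (\<lambda>p. p \<noteq> [] \<and> (\<exists>u. walk G u p u) \<and> walk_edges p \<subseteq> T \<and> (\<forall>e\<in>T. cnt p e \<le> m e))"
  have bound: "length p \<le> sum m T" if "Q p" for p
    using that sum_mono[of T "cnt p" m] length_eq_sum_cnt[of p T] fT by (auto simp: Q_def)
  obtain e0 where e0: "e0 \<in> T" using conn_nonempty[OF T(2)] by blast
  obtain a b where ab: "ends G e0 = {a, b}" using ends_pair[OF subsetD[OF T(1) e0]] .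
  have "\<exists>q. walk G a ([(a, e0, b)] @ q) a \<and> walk_edges ([(a, e0, b)] @ q) \<subseteq> T \<and> (\<forall>e\<in>T. cnt ([(a, e0, b)] @ q) e \<le> m e)"
  proof (rule trail_close[OF T(1,3) walk_step[OF _ ab]])
    show "e0 \<in> edges G" using T(1) e0 by blast
    show "cnt [(a, e0, b)] e \<le> m e" if "e \<in> T" for e
      using T(4)[OF that] by simp
  qed (simp add: e0)
  then have "\<exists>p. Q p" unfolding Q_def by blast
  then obtain p where p: "Q p" and mx: "\<And>q. Q q \<Longrightarrow> length q \<le> length p"
    using ex_has_greatest_nat[of Q _ length "Suc (sum m T)"] bound by (metis le_imp_less_Suc)
  obtain u where u: "walk G u p u" and pT: "p \<noteq> []" "walk_edges p \<subseteq> T" "\<And>e. e \<in> T \<Longrightarrow> cnt p e \<le> m e"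
    using p by (auto simp: Q_def)
  have full: "cnt p e = m e" if eT: "e \<in> T" for e
  proof (rule ccontr)
    assume "cnt p e \<noteq> m e"
    then have lt: "cnt p e < m e" using pT(3)[OF eT] by simp
    have "\<exists>x e. e \<in> T \<and> x \<in> ends G e \<and> x \<in> V (walk_edges p) \<and> cnt p e < m e"
    proof (cases "walk_edges p = T")
      case True
      then show ?thesis using eT lt ends_nonempty[of e] T(1) by (auto simp: in_vset)
    next
      case False
      then obtain x where "x \<in> V (walk_edges p)" "x \<in> V (T - walk_edges p)"
        using connD[OF T(2) pT(2)] pT(1) by auto
      then obtain e where "e \<in> T" "e \<notin> walk_edges p" "x \<in> ends G e" by (auto simp: in_vset)
      moreover have "cnt p e = 0" using \<open>e \<notin> walk_edges p\<close> by (simp flip: set_elist)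
      ultimately show ?thesis using T(4) \<open>x \<in> V (walk_edges p)\<close> by metis
    qed
    then obtain x e where e: "e \<in> T" "x \<in> ends G e" "x \<in> V (walk_edges p)" "cnt p e < m e" by blast
    obtain p1 p2 where p12: "p = p1 @ p2" "walk G u p1 x" "walk G x p2 u"
      using walk_split_at[OF u, of x] set_walk_verts[OF u] e(3) by auto
    obtain y where y: "ends G e = {x, y}" using ends_other[OF subsetD[OF T(1) e(1)] e(2)] .
    let ?p = "p2 @ p1 @ [(x, e, y)]"
    have "walk G x ?p y" "walk_edges ?p \<subseteq> T"
      using p12 walk_step[OF _ y] e T(1) pT(2) by (auto simp: walk_append simp del: walk.simps)
    moreover have "cnt ?p e' \<le> m e'" if "e' \<in> T" for e'
      using pT(3)[OF that] e(4) p12(1) by auto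
    ultimately obtain q where "walk G x (?p @ q) x" "walk_edges (?p @ q) \<subseteq> T" "\<forall>e\<in>T. cnt (?p @ q) e \<le> m e"
      using trail_close[OF T(1,3)] by blast
    then have "Q (?p @ q)" unfolding Q_def by blast
    from mx[OF this] show False using p12(1) by simp
  qed
  have "walk_edges p = T"
  proof
    show "T \<subseteq> walk_edges p"
    proof
      fix e assume "e \<in> T"
      then have "cnt p e \<noteq> 0" using full T(4) by fastforce
      then show "e \<in> walk_edges p" by (simp add: count_list_0_iff)
    qed
  qed (use pT in auto)
  then show ?thesis using that u full by blast
qed

text \<open>Cycles are the connected 2-regular edge sets. For the converse an Euler walk with all
  multiplicities 1 repeats no edge, and degree 2 means one departure per vertex, hence no repeated
  vertex.\<close>

lemma is_cycle_iff: "is_cycle G C \<longleftrightarrow> C \<subseteq> edges G \<and> conn C \<and> (\<forall>x\<in>V C. deg C x = 2)"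
proof
  assume "is_cycle G C"
  then obtain u p where p: "cycle_walk G u p" "C = walk_edges p" by (auto simp: is_cycle_def)
  then show "C \<subseteq> edges G \<and> conn C \<and> (\<forall>x\<in>V C. deg C x = 2)"
    using cycle_walk_deg[OF p(1)] conn_walk[of u p u] walk_edges_sub[of u p u] by (simp add: cycle_walk_iff)
next
  assume C: "C \<subseteq> edges G \<and> conn C \<and> (\<forall>x\<in>V C. deg C x = 2)"
  have "even (deg C x)" for x using C wdeg_outside[of x C] by (cases "x \<in> V C") auto
  then obtain u p where p: "walk G u p u" "walk_edges p = C" "\<And>e. e \<in> C \<Longrightarrow> cnt p e = 1"
    using eulerian_walk[of C "\<lambda>_. 1"] C by auto
  have pne: "p \<noteq> []" using p(2) C by (auto simp: conn_def)
  have "distinct (elist p)" by (rule distinct_if_count_list) (use p in auto)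
  moreover have "distinct (starts p)"
  proof (rule distinct_if_count_list)
    fix x assume "x \<in> set (starts p)"
    then have "x \<in> V C" using walk_verts_closed[OF p(1) pne] p(2) by simp
    then have "deg C x = 2" using C by blast
    moreover have "deg C x = 2 * count_list (starts p) x"
      using wdeg_walk_closed[OF p(1), of C x] p(2) C deg_distinct[OF \<open>distinct (elist p)\<close>] by auto
    ultimately show "count_list (starts p) x = 1" by simp
  qed
  ultimately show "is_cycle G C" unfolding is_cycle_def cycle_walk_iff using p pne by blast
qed

lemma cycleD:
  assumes "is_cycle G C"
  shows "C \<subseteq> edges G" "conn C" "C \<noteq> {}" "\<And>x. x \<in> V C \<Longrightarrow> deg C x = 2"
  using assms unfolding is_cycle_iff by (auto simp: conn_def)

text \<open>Otherwise each of the two parts would contribute a positive even number to the degree of the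
  walk at \<open>x\<close>, which is 2.\<close>

lemma closed_walk_one_side:
  assumes p: "walk G u p u" "p \<noteq> []" "count_list (starts p) x \<le> 1"
    and AB: "walk_edges p \<subseteq> A \<union> B" "A \<inter> B = {}" "V A \<inter> V B \<subseteq> {x}"
  shows "walk_edges p \<subseteq> A \<or> walk_edges p \<subseteq> B"
proof (rule ccontr)
  assume no: "\<not> ?thesis"
  let ?P = "walk_edges p"
  have PG: "?P \<subseteq> edges G" by (rule walk_edges_sub[OF p(1)])
  have wd: "wdeg (cnt p) ?P y = 2 * count_list (starts p) y" for y
    by (rule wdeg_walk_closed[OF p(1) order_refl PG])
  have side: "wdeg (cnt p) (?P \<inter> X) x \<ge> 2" if X: "X = A \<and> Y = B \<or> X = B \<and> Y = A" for X Y
  proof -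
    have PXY: "?P - (?P \<inter> X) = ?P \<inter> Y" using X AB(1,2) by auto
    have sub: "V (?P \<inter> X) \<inter> V (?P \<inter> Y) \<subseteq> {x}"
      using X AB(3) vset_mono[of "?P \<inter> X" X] vset_mono[of "?P \<inter> Y" Y] by auto
    have ne: "?P \<inter> X \<noteq> {}" "?P \<inter> X \<noteq> ?P" using X no AB(1) by auto
    have "V (?P \<inter> X) \<inter> V (?P - (?P \<inter> X)) \<noteq> {}" using connD[OF conn_walk[OF p(1,2)], of "?P \<inter> X"] ne by blast
    then have x: "x \<in> V (?P \<inter> X)" using sub PXY by auto
    have XG: "?P \<inter> X \<subseteq> edges G" using PG by auto
    have "even (wdeg (cnt p) (?P \<inter> X) x)"
    proof (rule even_wdeg[OF XG])
      fix y assume y: "y \<in> V (?P \<inter> X)" "y \<noteq> x"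
      then have "y \<notin> V (?P \<inter> Y)" using sub by auto
      then have "wdeg (cnt p) (?P \<inter> Y) y = 0" by (rule wdeg_outside)
      then have "wdeg (cnt p) ?P y = wdeg (cnt p) (?P \<inter> X) y" using wdeg_split[OF PG, of "?P \<inter> X"] PXY by simp
      then show "even (wdeg (cnt p) (?P \<inter> X) y)" using wd[of y] by (metis dvd_triv_left)
    qed
    moreover obtain e where e: "e \<in> ?P \<inter> X" "x \<in> ends G e" using x by (auto simp: in_vset)
    have "cnt p e \<noteq> 0" using e(1) by (simp add: count_list_0_iff)
    then have "cnt p e * hdeg x e > 0" using hdeg_pos[OF e(2)] by simp
    then have "wdeg (cnt p) (?P \<inter> X) x > 0" using wdeg_ge[OF XG e(1), of "cnt p" x] by (rule less_le_trans)
    ultimately show ?thesis by (rule dvd_imp_le)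
  qed
  have "?P - (?P \<inter> A) = ?P \<inter> B" using AB(1,2) by auto
  then have "wdeg (cnt p) ?P x \<ge> 4" using side[of A B] side[of B A] wdeg_split[OF PG, of "?P \<inter> A" "cnt p" x] by simp
  then show False using wd[of x] p(3) by simp
qed

lemma cycle_one_side:
  assumes C: "is_cycle G C" "C \<subseteq> A \<union> B" and AB: "A \<inter> B = {}" "V A \<inter> V B \<subseteq> {v}"
  shows "C \<subseteq> A \<or> C \<subseteq> B"
proof -
  obtain u p where p: "cycle_walk G u p" "C = walk_edges p" using C(1) by (auto simp: is_cycle_def)
  then have "count_list (starts p) v \<le> 1" by (simp add: cycle_walk_iff count_list_distinct)
  then show ?thesis using closed_walk_one_side[of u p v A B] p C(2) AB by (simp add: cycle_walk_iff)
qed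

lemma loop_cycle:
  assumes "e \<in> edges G" "ends G e = {v}"
  shows "is_cycle G {e}"
  unfolding is_cycle_def cycle_walk_iff
  by (rule exI[of _ v], rule exI[of _ "[(v, e, v)]"]) (use assms ends_subset in auto)

lemma path_cycle:
  assumes "simple_path G x q y" "e \<in> edges G" "ends G e = {x, y}" "e \<notin> walk_edges q" "x \<noteq> y"
  shows "is_cycle G (insert e (walk_edges q))"
  unfolding is_cycle_def cycle_walk_iff
proof (intro exI[of _ y] exI[of _ "(y, e, x) # q"] conjI)
  have w: "walk G x q y" "distinct (starts q @ [y])"
    using assms(1) walk_verts_eq by (auto simp: simple_path_def)
  show "walk G y ((y, e, x) # q) y" using w assms by (auto simp: insert_commute)
  show "distinct (starts ((y, e, x) # q))" using w by simp
  show "distinct (elist ((y, e, x) # q))" using assms simple_path_distinct_edges by simp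
qed simp_all

text \<open>\<open>A\<close> consists of the edges of \<open>T - {e}\<close> that touch the region
  reachable from \<open>x\<close> without \<open>e\<close>. The other end \<open>y\<close> is not
  reachable: a simple path to it would close up with \<open>e\<close> to a cycle.\<close>

lemma bridge:
  assumes T: "T \<subseteq> edges G" "e \<in> T" "x \<in> ends G e" and nc: "\<And>C. is_cycle G C \<Longrightarrow> C \<subseteq> T \<Longrightarrow> e \<notin> C"
  obtains y A B where "ends G e = {x, y}" "x \<noteq> y" "T = insert e (A \<union> B)" "e \<notin> A" "e \<notin> B" "A \<inter> B = {}"
    "V A \<inter> V B = {}" "y \<notin> V A" "x \<notin> V B"
proof -
  have eG: "e \<in> edges G" using T by auto
  obtain y where y: "ends G e = {x, y}" using ends_other[OF eG T(3)] .
  have xy: "x \<noteq> y" using nc[of "{e}"] loop_cycle[OF eG] y T by auto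
  define R where "R = {w. \<exists>p. walk G x p w \<and> walk_edges p \<subseteq> T - {e}}"
  have step: "b \<in> R" if "a \<in> R" "e' \<in> T - {e}" "a \<in> ends G e'" "b \<in> ends G e'" for a b e'
  proof -
    obtain p where p: "walk G x p a" "walk_edges p \<subseteq> T - {e}" using \<open>a \<in> R\<close> by (auto simp: R_def)
    have "e' \<in> edges G" using that T by auto
    from walk_extend[OF p(1) this that(3,4)] obtain q
      where "walk G x q b" "walk_edges q \<subseteq> insert e' (walk_edges p)" .
    then show ?thesis using p(2) that(2) unfolding R_def by blast
  qed
  have xR: "x \<in> R" unfolding R_def using ends_subset[OF eG] T(3)
    by (intro CollectI exI[of _ "[]"]) auto
  have yR: "y \<notin> R"
  proof
    assume "y \<in> R"
    then obtain p where "walk G x p y" "walk_edges p \<subseteq> T - {e}" by (auto simp: R_def)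
    then obtain q where q: "simple_path G x q y" "walk_edges q \<subseteq> T - {e}"
      using simple_path_exists by (meson order_trans)
    then show False using path_cycle[OF q(1) eG y _ xy] nc T(2) by blast
  qed
  let ?A = "{e' \<in> T - {e}. ends G e' \<inter> R \<noteq> {}}"
  let ?B = "T - {e} - ?A"
  have VA: "V ?A \<subseteq> R" using step by (auto simp: vset_def)
  have VB: "V ?B \<inter> R = {}" by (auto simp: vset_def)
  show ?thesis
    by (rule that[OF y xy, of ?A ?B]) (use T VA VB xR yR in auto)
qed

end

section \<open>Tight weights\<close>

context sgraph
begin

definition split :: "('e \<Rightarrow> nat) \<Rightarrow> 'e set \<Rightarrow> 'v \<Rightarrow> 'e set \<Rightarrow> 'e set \<Rightarrow> bool" where
  "split m T v A B \<longleftrightarrow> A \<union> B = T \<and> A \<inter> B = {} \<and> V A \<inter> V B = {v} \<and> wdeg m A v = 2 \<and> wdeg m B v = 2"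

text \<open>A weight \<open>m\<close> that is tight on \<open>T\<close> exists iff \<open>T\<close> is a cycle-tree, and it is then the indicator
  of \<open>T\<close>. This replaces block cycles and block paths by a local condition at each vertex.\<close>

definition tight :: "('e \<Rightarrow> nat) \<Rightarrow> 'e set \<Rightarrow> bool" where
  "tight m T \<longleftrightarrow> T \<subseteq> edges G \<and> conn T \<and> (\<forall>e\<in>T. m e > 0) \<and>
     (\<forall>v\<in>V T. (wdeg m T v = 2 \<and> (\<forall>e\<in>T. v \<in> ends G e \<longrightarrow> m e = 1)) \<or> (\<exists>A B. split m T v A B))"

lemma in_vsetI: "e \<in> A \<Longrightarrow> v \<in> ends G e \<Longrightarrow> v \<in> V A"
  by (auto simp: vset_def)

lemma vset_monoD: "v \<in> V A \<Longrightarrow> A \<subseteq> B \<Longrightarrow> v \<in> V B"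
  by (auto simp: vset_def)

lemma split_sym: "split m T v A B \<longleftrightarrow> split m T v B A"
  by (auto simp: split_def)

lemma splitD:
  assumes "split m T v A B"
  shows "A \<union> B = T" "A \<inter> B = {}" "V A \<inter> V B = {v}" "wdeg m A v = 2" "wdeg m B v = 2"
    "A \<subseteq> T" "B \<subseteq> T" "v \<in> V A" "v \<in> V B"
  using assms by (auto simp: split_def)

text \<open>The part \<open>A' \<inter> B\<close> shares no vertex with the rest of
  \<open>T\<close>: such a vertex would have to be a cut vertex of one of the two splits, and the
  position of \<open>x\<close> and \<open>y\<close> would then give \<open>x = y\<close>. By
  connectivity this part is empty. This is the descent step of the inductions over sides.\<close>

lemma sides_nested:
  assumes "conn T" and s: "split m T x A B" "split m T y A' B'"
    and xy: "x \<in> V B'" "y \<in> V A" "x \<noteq> y"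
  shows "A' \<subseteq> A"
proof -
  note a = splitD[OF s(1)] and b = splitD[OF s(2)]
  let ?X = "A' \<inter> B"
  have TX: "T - ?X \<subseteq> A \<union> B'" using a(1) b(1) by blast
  have "V ?X \<inter> V (T - ?X) = {}"
  proof (rule ccontr)
    assume "V ?X \<inter> V (T - ?X) \<noteq> {}"
    then obtain w where w: "w \<in> V ?X" "w \<in> V (T - ?X)" by blast
    have w1: "w \<in> V A'" using subsetD[OF vset_mono w(1)] by blast
    have w2: "w \<in> V B" using subsetD[OF vset_mono w(1)] by blast
    have "w \<in> V (A \<union> B')" using subsetD[OF vset_mono[OF TX] w(2)] .
    then have "w \<in> V A \<or> w \<in> V B'" by simp
    then show False
    proof
      assume "w \<in> V A"
      then have "w = x" using w2 a(3) by (metis IntI singletonD)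
      then have "x = y" using w1 xy(1) b(3) by (metis IntI singletonD)
      then show False using xy(3) by simp
    next
      assume "w \<in> V B'"
      then have "w = y" using w1 b(3) by (metis IntI singletonD)
      then have "y = x" using w2 xy(2) a(3) by (metis IntI singletonD)
      then show False using xy(3) by simp
    qed
  qed
  moreover have "?X \<noteq> T"
  proof
    assume "?X = T"
    then have "A = {}" using a(1,2) by blast
    then show False using a(8) by simp
  qed
  ultimately have "?X = {}" using connD[OF assms(1), of ?X] b(6) by blast
  then show ?thesis using a(1) b(6) by blast
qed

text \<open>All weights are at least 1, so the two half-edges of \<open>Z\<close> at
  \<open>v\<close> already exhaust the weighted degree 2; nothing is left for other edges or for
  weights above 1.\<close>

lemma saturated:
  assumes A: "A \<subseteq> edges G" "Z \<subseteq> A" "\<And>e. e \<in> A \<Longrightarrow> m e > 0"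
    and d: "deg Z v = 2" "wdeg m A v = 2" and e: "e \<in> A" "v \<in> ends G e"
  shows "e \<in> Z \<and> m e = 1"
proof -
  have ZG: "Z \<subseteq> edges G" using A by blast
  have "wdeg m Z v = (\<Sum>e\<in>Z. hdeg v e + (m e - 1) * hdeg v e)"
    unfolding wdeg_def
  proof (rule sum.cong)
    fix e assume "e \<in> Z"
    then have "m e = 1 + (m e - 1)" using A by (metis Suc_pred' plus_1_eq_Suc subsetD)
    then show "m e * hdeg v e = hdeg v e + (m e - 1) * hdeg v e"
      by (metis add_mult_distrib mult_1)
  qed simp
  also have "\<dots> = deg Z v + wdeg (\<lambda>e. m e - 1) Z v"
    by (simp add: wdeg_def sum.distrib)
  finally have 1: "wdeg m Z v = 2 + wdeg (\<lambda>e. m e - 1) Z v" using d by simp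
  then have 2: "wdeg m (A - Z) v = 0" "wdeg (\<lambda>e. m e - 1) Z v = 0"
    using wdeg_split[OF A(1,2), of m v] d(2) by auto
  have m: "m e \<ge> 1" using A(3)[OF e(1)] by simp
  have h: "hdeg v e \<ge> 1" using hdeg_pos[OF e(2)] .
  have "e \<in> Z"
  proof (rule ccontr)
    assume "e \<notin> Z"
    then have "m e * hdeg v e \<le> 0" using wdeg_ge[of "A - Z" e m v] A e 2 by auto
    then show False using m h e(2) by simp
  qed
  moreover have "(m e - 1) * hdeg v e \<le> 0" using wdeg_ge[OF ZG calculation, of "\<lambda>e. m e - 1" v] 2 by simp
  then have "m e = 1" using m e(2) by simp
  ultimately show ?thesis ..
qed

context
  fixes m T assumes t: "tight m T"
begin

lemma tightD: "T \<subseteq> edges G" "conn T" "\<And>e. e \<in> T \<Longrightarrow> m e > 0"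
  using t by (auto simp: tight_def)

lemma tight_vertex:
  assumes "v \<in> V T"
  obtains (simple) "wdeg m T v = 2" "\<And>e. e \<in> T \<Longrightarrow> v \<in> ends G e \<Longrightarrow> m e = 1"
  | (split) A B where "split m T v A B"
  using t assms unfolding tight_def by meson

lemma split_wdeg: "split m T v A B \<Longrightarrow> wdeg m T v = 4"
  using wdeg_Un[of A B m v] tightD(1) by (auto simp: split_def)

lemma even_wdeg_tight: "even (wdeg m T v)"
proof (cases "v \<in> V T")
  case True
  then show ?thesis by (rule tight_vertex) (auto dest: split_wdeg)
qed (simp add: wdeg_outside)

lemma simple_saturated:
  assumes "is_cycle G Z" "Z \<subseteq> T" "v \<in> V Z" "wdeg m T v = 2" "e \<in> T" "v \<in> ends G e"
  shows "e \<in> Z \<and> m e = 1"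
  using saturated[OF tightD(1) assms(2) tightD(3) cycleD(4)[OF assms(1,3)] assms(4-6)] .

lemma split_saturated:
  assumes "is_cycle G Z" "Z \<subseteq> A" "v \<in> V Z" "split m T v A B" "e \<in> A" "v \<in> ends G e"
  shows "e \<in> Z \<and> m e = 1"
proof -
  note s = splitD[OF assms(4)]
  have "A \<subseteq> edges G" "\<And>e. e \<in> A \<Longrightarrow> m e > 0" using s(6) tightD(1,3) by blast+
  from saturated[OF this(1) assms(2) this(2) cycleD(4)[OF assms(1,3)] s(4) assms(5,6)] show ?thesis .
qed

lemma cycle_side:
  assumes "is_cycle G Z" "Z \<subseteq> T" "split m T v A B"
  shows "Z \<subseteq> A \<or> Z \<subseteq> B"
  using cycle_one_side[OF assms(1), of A B v] splitD[OF assms(3)] assms(2) by simp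

lemma cycle_split_sides:
  assumes "is_cycle G Z" "Z \<subseteq> T" "split m T v A B"
  shows "\<exists>A' B'. split m T v A' B' \<and> Z \<subseteq> A' \<and> Z \<inter> B' = {}"
proof -
  have "\<exists>A' B'. split m T v A' B' \<and> Z \<subseteq> A'"
    using cycle_side[OF assms] assms(3) split_sym by blast
  then obtain A' B' where s: "split m T v A' B'" "Z \<subseteq> A'" by blast
  have "Z \<inter> B' = {}" using s(2) splitD(2)[OF s(1)] by blast
  with s show ?thesis by blast
qed

lemma cycle_weight:
  assumes "is_cycle G Z" "Z \<subseteq> T" "e \<in> Z"
  shows "m e = 1"
proof -
  obtain v where v: "v \<in> ends G e" using ends_nonempty[of e] cycleD(1)[OF assms(1)] assms(3) by blast
  have vZ: "v \<in> V Z" using assms(3) v by (rule in_vsetI)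
  have vT: "v \<in> V T" using vset_monoD[OF vZ assms(2)] .
  from vT show ?thesis
  proof (cases rule: tight_vertex)
    case simple
    then show ?thesis using v assms by blast
  next
    case (split A B)
    then obtain A' B' where "split m T v A' B'" "Z \<subseteq> A'" using cycle_split_sides[OF assms(1,2)] by blast
    then show ?thesis using split_saturated[OF assms(1) _ vZ] v assms(3) by blast
  qed
qed

text \<open>At a simple vertex \<open>Z\<close> is saturated, so no other edge of \<open>T\<close>
  is present; at a split vertex the side not containing \<open>Z\<close> supplies one.\<close>

lemma cycle_vertex_split_iff:
  assumes "is_cycle G Z" "Z \<subseteq> T" "v \<in> V Z"
  shows "v \<in> V (T - Z) \<longleftrightarrow> (\<exists>A B. split m T v A B)"
proof
  assume l: "v \<in> V (T - Z)"
  have "v \<in> V T" using vset_monoD[OF assms(3,2)] .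
  then show "\<exists>A B. split m T v A B"
  proof (cases rule: tight_vertex)
    case simple
    then show ?thesis using simple_saturated[OF assms] l by (auto simp: in_vset)
  qed blast
next
  assume "\<exists>A B. split m T v A B"
  then obtain A B where s: "split m T v A B" "Z \<subseteq> A" "Z \<inter> B = {}"
    using cycle_split_sides[OF assms(1,2)] by blast
  then have "B \<subseteq> T - Z" "v \<in> V B" using splitD(7,9)[OF s(1)] s(3) by blast+
  then show "v \<in> V (T - Z)" using vset_monoD by blast
qed

text \<open>Starting from a common edge, the common part spreads along \<open>Z\<close>: at each of
  its vertices both cycles lie on the same side of the cut, and there \<open>Y\<close> leaves no
  room for an edge of \<open>Z\<close> outside \<open>Y\<close>.\<close>

lemma cycles_eq:
  assumes Z: "is_cycle G Z" "Z \<subseteq> T" "is_cycle G Y" "Y \<subseteq> T" and e: "e \<in> Z" "e \<in> Y"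
  shows "Z = Y"
proof -
  have sub: "Z \<subseteq> Y" if Z: "is_cycle G Z" "Z \<subseteq> T" "is_cycle G Y" "Y \<subseteq> T" and e: "e \<in> Z" "e \<in> Y" for Z Y
  proof -
    have "Z \<inter> Y = Z"
    proof (rule connD_edges[OF cycleD(2)[OF Z(1)]])
      fix f f' v assume f: "f \<in> Z \<inter> Y" "f' \<in> Z" "v \<in> ends G f" "v \<in> ends G f'"
      have vY: "v \<in> V Y" using f in_vsetI by blast
      have vT: "v \<in> V T" using vset_monoD[OF vY Z(4)] .
      from vT have "f' \<in> Y"
      proof (cases rule: tight_vertex)
        case simple
        then show ?thesis using simple_saturated[OF Z(3,4) vY] f Z by blast
      next
        case (split A B)
        then obtain A' B' where s: "split m T v A' B'" "Z \<subseteq> A'" using cycle_split_sides[OF Z(1,2)] by blast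
        then have "Y \<subseteq> A'" using cycle_side[OF Z(3,4) s(1)] splitD(2)[OF s(1)] f(1) by blast
        then show ?thesis using split_saturated[OF Z(3) _ vY s(1)] f s(2) by blast
      qed
      then show "f' \<in> Z \<inter> Y" using f by simp
    qed (use e in auto)
    then show ?thesis by blast
  qed
  show ?thesis using sub[OF Z e] sub[OF Z(3,4,1,2) e(2,1)] by blast
qed

text \<open>Two different cycles through \<open>v\<close> cannot be on the same side, because
  \<open>Z\<close> alone saturates its side at \<open>v\<close>.\<close>

lemma cycles_meet:
  assumes Z: "is_cycle G Z" "Z \<subseteq> T" "is_cycle G Y" "Y \<subseteq> T" and "Z \<noteq> Y" and v: "v \<in> V Z" "v \<in> V Y"
  obtains A B where "split m T v A B" "Z \<subseteq> A" "Y \<subseteq> B"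
proof -
  have dj: "Z \<inter> Y = {}" using cycles_eq[OF Z] \<open>Z \<noteq> Y\<close> by blast
  have "Y \<subseteq> T - Z" using dj Z by blast
  then have "v \<in> V (T - Z)" using vset_monoD[OF v(2)] by blast
  then obtain A B where s: "split m T v A B" "Z \<subseteq> A"
    using cycle_vertex_split_iff[OF Z(1,2) v(1)] cycle_split_sides[OF Z(1,2)] by blast
  have "\<not> Y \<subseteq> A"
  proof
    assume Y: "Y \<subseteq> A"
    obtain e where "e \<in> Y" "v \<in> ends G e" using v(2) by (auto simp: in_vset)
    then show False using split_saturated[OF Z(1) s(2) v(1) s(1)] Y dj by blast
  qed
  then show ?thesis using that s cycle_side[OF Z(3,4) s(1)] by blast
qed

text \<open>In \<open>insert e A\<close> the vertex \<open>y\<close> sees only \<open>e\<close>, and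
  all other vertices see all their edges of \<open>T\<close>, so the handshake lemma makes
  \<open>m e\<close> even. Hence neither end of \<open>e\<close> is a simple vertex, both have
  weighted degree 4, and lying on one side of a split bounds \<open>m e\<close> by 2.\<close>

lemma bridge_split:
  assumes e: "e \<in> T" "x \<in> ends G e" and nc: "\<And>C. is_cycle G C \<Longrightarrow> C \<subseteq> T \<Longrightarrow> e \<notin> C"
  obtains y A B where "ends G e = {x, y}" "x \<noteq> y" "T = insert e (A \<union> B)" "e \<notin> A" "e \<notin> B" "A \<inter> B = {}"
    "V A \<inter> V B = {}" "y \<notin> V A" "x \<notin> V B" "m e = 2"
    "split m T x A (insert e B)" "split m T y B (insert e A)"
proof -
  obtain y A B where y: "ends G e = {x, y}" "x \<noteq> y" and AB: "T = insert e (A \<union> B)" "e \<notin> A" "e \<notin> B" "A \<inter> B = {}"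
    "V A \<inter> V B = {}" "y \<notin> V A" "x \<notin> V B"
    by (rule bridge[OF tightD(1) e nc])
  have G: "e \<in> edges G" "A \<subseteq> edges G" "B \<subseteq> edges G" "insert e A \<subseteq> edges G" "insert e B \<subseteq> edges G"
    using AB(1) tightD(1) by auto
  have h: "hdeg x e = 1" "hdeg y e = 1" using hdeg_pair[OF y(1)] y(2) by auto
  have dT: "wdeg m T w = m e * hdeg w e + wdeg m A w + wdeg m B w" for w
    using wdeg_insert[of e "A \<union> B" m w] wdeg_Un[OF G(2,3) AB(4), of m w] AB G by auto
  have "even (wdeg m (insert e A) y)"
  proof (rule even_wdeg[OF G(4)])
    fix w assume w: "w \<in> V (insert e A)" "w \<noteq> y"
    then have "w \<notin> V B" using AB y by auto
    then have "wdeg m T w = wdeg m (insert e A) w"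
      using dT wdeg_insert[OF G(1,2) AB(2)] wdeg_outside by simp
    then show "even (wdeg m (insert e A) w)" using even_wdeg_tight by metis
  qed
  then have ev: "even (m e)" using wdeg_insert[OF G(1,2) AB(2), of m y] wdeg_outside[OF AB(6)] h by simp
  have w4: "m e \<le> 2 \<and> wdeg m T w = 4" if w: "w \<in> ends G e" for w
  proof -
    have "w \<in> V T" using w e by (auto simp: in_vset)
    then show ?thesis
    proof (cases rule: tight_vertex)
      case simple
      then show ?thesis using ev w e(1) by fastforce
    next
      case (split C D)
      note s = splitD[OF split]
      have CD: "C \<subseteq> edges G" "D \<subseteq> edges G" using s tightD(1) by auto
      have "m e * hdeg w e \<le> 2"
        using wdeg_ge[OF CD(1), of e m w] wdeg_ge[OF CD(2), of e m w] s(1,4,5) e(1) by fastforce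
      moreover have "hdeg w e \<ge> 1" using hdeg_pos[OF w] .
      ultimately have "m e \<le> 2" by (metis dual_order.trans mult_le_mono2 mult.right_neutral)
      then show ?thesis using split_wdeg[OF split] by simp
    qed
  qed
  then have me: "m e = 2" using tightD(3)[OF e(1)] ev y(1)
    by (metis e(2) dvd_imp_le le_antisym)
  have d: "wdeg m A x = 2" "wdeg m B y = 2"
    using dT[of x] dT[of y] h me w4[of x] w4[of y] y(1) wdeg_outside[OF AB(6)] wdeg_outside[OF AB(7)] by auto
  have xA: "x \<in> V A" "y \<in> V B" using d wdeg_outside[of x A m] wdeg_outside[of y B m] by fastforce+
  show ?thesis
  proof (rule that[OF y AB me])
    show "split m T x A (insert e B)" unfolding split_def
      using AB y d xA wdeg_insert[OF G(1,3) AB(3), of m x] h me wdeg_outside[OF AB(7)] by auto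
    show "split m T y B (insert e A)" unfolding split_def
      using AB y d xA wdeg_insert[OF G(1,2) AB(2), of m y] h me wdeg_outside[OF AB(6)] by auto
  qed
qed

text \<open>The right-hand side does not mention \<open>m\<close>: a tight weight is unique.\<close>

lemma weight_cases:
  assumes "e \<in> T"
  shows "m e = (if \<exists>C. is_cycle G C \<and> C \<subseteq> T \<and> e \<in> C then 1 else 2)"
proof -
  obtain x where x: "x \<in> ends G e" using ends_nonempty[of e] tightD(1) assms by blast
  have "m e = 2" if "\<And>C. is_cycle G C \<Longrightarrow> C \<subseteq> T \<Longrightarrow> e \<notin> C"
    by (rule bridge_split[OF assms x that])
  then show ?thesis using cycle_weight by (cases "\<exists>C. is_cycle G C \<and> C \<subseteq> T \<and> e \<in> C") auto
qed

text \<open>Descent on the size of the side. An edge of \<open>A\<close> at \<open>x\<close> is a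
  bridge or lies on a cycle. Crossing the bridge, or leaving the cycle at a vertex other than
  \<open>x\<close>, leads to a split with a strictly smaller side inside \<open>A\<close>; if the
  cycle has no further exit, it is the required one.\<close>

lemma side_contains_end_block:
  "split m T x A B \<Longrightarrow> \<exists>C v. is_cycle G C \<and> C \<subseteq> A \<and> V C \<inter> V (T - C) = {v}"
proof (induction "card A" arbitrary: x A B rule: less_induct)
  case less
  note s = splitD[OF less.prems]
  have fA: "finite A" using finite_sub s(6) tightD(1) by (meson order_trans)
  \<comment> \<open>The nonempty set \<open>Z\<close> lies in \<open>A\<close> but misses
    \<open>A'\<close>; it makes the inclusion given by \<open>sides_nested\<close> strict.\<close>
  have smaller: ?case if y: "split m T y A' B'" "x \<in> V B'" "y \<in> V A" "x \<noteq> y" "Z \<subseteq> A" "Z \<noteq> {}" "Z \<inter> A' = {}" for y A' B' Z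
  proof -
    have "A' \<subseteq> A" using sides_nested[OF tightD(2) less.prems y(1-4)] .
    moreover have "A' \<noteq> A" using y by blast
    ultimately have "card A' < card A" using fA by (simp add: psubset_card_mono psubset_eq)
    from less.hyps[OF this y(1)] show ?thesis using \<open>A' \<subseteq> A\<close> by blast
  qed
  obtain e where e: "e \<in> A" "x \<in> ends G e" using s(8) by (auto simp: in_vset)
  show ?case
  proof (cases "\<exists>Z. is_cycle G Z \<and> Z \<subseteq> T \<and> e \<in> Z")
    case True
    then obtain Z where Z: "is_cycle G Z" "Z \<subseteq> T" "e \<in> Z" by blast
    have ZA: "Z \<subseteq> A" using cycle_side[OF Z(1,2) less.prems] e Z s(2) by blast
    have xZ: "x \<in> V Z" using e Z by (auto simp: in_vset)
    show ?thesis
    proof (cases "V Z \<inter> V (T - Z) \<subseteq> {x}")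
      case True
      moreover have "x \<in> V Z \<inter> V (T - Z)" using cycle_vertex_split_iff[OF Z(1,2) xZ] less.prems xZ by blast
      ultimately show ?thesis using Z(1) ZA by blast
    next
      case False
      then obtain y where y: "y \<in> V Z" "y \<in> V (T - Z)" "y \<noteq> x" by blast
      then obtain B' A' where "split m T y B' A'" "Z \<subseteq> B'" "Z \<inter> A' = {}"
        using cycle_vertex_split_iff[OF Z(1,2) y(1)] cycle_split_sides[OF Z(1,2)] by blast
      moreover have "x \<in> V B'" "y \<in> V A" using xZ y \<open>Z \<subseteq> B'\<close> ZA vset_monoD by blast+
      ultimately show ?thesis
        using smaller[of y A' B' Z] split_sym y(3) ZA Z(3) by blast
    qed
  next
    case False
    have "e \<in> T" using e s by blast
    have nc: "\<And>C. is_cycle G C \<Longrightarrow> C \<subseteq> T \<Longrightarrow> e \<notin> C" using False by blast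
    obtain y A' B' where b: "ends G e = {x, y}" "x \<noteq> y" "e \<notin> B'" "split m T y B' (insert e A')"
      by (rule bridge_split[OF \<open>e \<in> T\<close> e(2) nc])
    have "x \<in> V (insert e A')" "y \<in> V A" using b e by (auto simp: in_vset)
    then show ?thesis using smaller[OF b(4), of "{e}"] b e by auto
  qed
qed

text \<open>A missing edge would be a bridge with cycles on both sides. \<open>S\<close> contains
  these cycles but no connection between them. Used to show that nothing smaller can be an Eulerian
  cycle-tree.\<close>

lemma spanning_eq:
  assumes S: "S \<subseteq> T" "conn S" "\<And>C. is_cycle G C \<Longrightarrow> C \<subseteq> T \<Longrightarrow> C \<subseteq> S"
  shows "S = T"
proof (rule ccontr)
  assume "S \<noteq> T"
  then obtain e where e: "e \<in> T" "e \<notin> S" using S by blast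
  then have nc: "\<And>C. is_cycle G C \<Longrightarrow> C \<subseteq> T \<Longrightarrow> e \<notin> C" using S(3) by blast
  obtain x where x: "x \<in> ends G e" using ends_nonempty[of e] tightD(1) e by blast
  obtain y A B where b: "T = insert e (A \<union> B)" "A \<inter> B = {}" "V A \<inter> V B = {}"
    "split m T x A (insert e B)" "split m T y B (insert e A)"
    by (rule bridge_split[OF e(1) x nc])
  obtain C D where CD: "is_cycle G C" "C \<subseteq> A" "is_cycle G D" "D \<subseteq> B"
    using side_contains_end_block[OF b(4)] side_contains_end_block[OF b(5)] by blast
  have "C \<subseteq> T" "D \<subseteq> T" using CD(2,4) b(1) by auto
  then have "C \<subseteq> S" "D \<subseteq> S" using S(3)[OF CD(1)] S(3)[OF CD(3)] by simp_all
  then have ne: "S \<inter> A \<noteq> {}" "S \<inter> B \<noteq> {}"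
    using CD(2,4) cycleD(3)[OF CD(1)] cycleD(3)[OF CD(3)] by auto
  have "S - (S \<inter> A) \<subseteq> B" using S(1) b(1) e(2) by blast
  then have "V (S \<inter> A) \<inter> V (S - (S \<inter> A)) = {}" using b(3) vset_mono[of "S \<inter> A" A] vset_mono[of "S - (S \<inter> A)" B] by blast
  then have "S \<inter> A = S" using connD[OF S(2), of "S \<inter> A"] ne by blast
  then show False using ne b(2) by blast
qed

end

end

section \<open>Cycle-trees\<close>

context sgraph
begin

text \<open>The indicator as a natural number, without reference to a decomposition. Its value
  outside \<open>T\<close> is also 2, so membership in \<open>T\<close> has to be tested
  separately.\<close>

definition ind :: "'e set \<Rightarrow> 'e \<Rightarrow> nat" where
  "ind T e = (if \<exists>C. is_cycle G C \<and> C \<subseteq> T \<and> e \<in> C then 1 else 2)"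

lemma ind_cycle: "is_cycle G C \<Longrightarrow> C \<subseteq> T \<Longrightarrow> e \<in> C \<Longrightarrow> ind T e = 1"
  by (auto simp: ind_def)

lemma ind_pos: "ind T e > 0"
  by (simp add: ind_def)

lemma tight_cong:
  assumes "tight m T" "\<And>e. e \<in> T \<Longrightarrow> m' e = m e"
  shows "tight m' T"
proof -
  have w: "wdeg m' A v = wdeg m A v" if "A \<subseteq> T" for A v
    using assms(2) that by (intro wdeg_cong) auto
  have s: "split m' T v A B \<longleftrightarrow> split m T v A B" for v A B
    unfolding split_def using w[of A] w[of B] by auto
  have "(\<forall>e\<in>T. v \<in> ends G e \<longrightarrow> m' e = 1) \<longleftrightarrow> (\<forall>e\<in>T. v \<in> ends G e \<longrightarrow> m e = 1)" for v
    using assms(2) by auto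
  then show ?thesis using assms unfolding tight_def s by (simp add: w)
qed

lemma tight_weight: "tight m T \<Longrightarrow> e \<in> T \<Longrightarrow> m e = ind T e"
  unfolding ind_def by (rule weight_cases)

lemma wdeg_const: "(\<And>e. e \<in> A \<Longrightarrow> m e = c) \<Longrightarrow> wdeg m A v = c * deg A v"
  by (simp add: wdeg_def sum_distrib_left)

lemma wdeg_local:
  assumes "T \<subseteq> edges G" "X \<subseteq> T" "\<And>e. e \<in> T \<Longrightarrow> v \<in> ends G e \<Longrightarrow> e \<in> X"
  shows "wdeg m T v = wdeg m X v"
proof -
  have "v \<notin> V (T - X)" using assms(3) by (auto simp: in_vset)
  then show ?thesis using wdeg_split[OF assms(1,2)] wdeg_outside by simp
qed

lemma wdeg_le_4: "tight m T \<Longrightarrow> wdeg m T v \<le> 4"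
proof (cases "v \<in> V T")
  case True
  assume t: "tight m T"
  from t True show ?thesis
    by (cases rule: tight_vertex) (simp_all add: split_wdeg[OF t])
qed (simp add: wdeg_outside)

text \<open>Each side has an even weighted degree at \<open>v\<close> by the handshake lemma, and a
  positive one because \<open>v\<close> lies on it. As the total is 4, both are 2.\<close>

lemma split_from_cut:
  assumes T: "T \<subseteq> edges G" "\<And>x. even (wdeg m T x)" "\<And>e. e \<in> T \<Longrightarrow> m e > 0"
    and AB: "A \<union> B = T" "A \<inter> B = {}" "V A \<inter> V B = {v}" and 4: "wdeg m T v = 4"
  shows "split m T v A B"
proof -
  have side: "wdeg m A v \<ge> 2" if AB: "A \<union> B = T" "A \<inter> B = {}" "V A \<inter> V B = {v}" for A B
  proof -
    have AG: "A \<subseteq> edges G" "B \<subseteq> edges G" using AB(1) T(1) by auto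
    have "even (wdeg m A v)"
    proof (rule even_wdeg[OF AG(1)])
      fix x assume "x \<in> V A" "x \<noteq> v"
      then have "x \<notin> V B" using AB(3) by auto
      then have "wdeg m T x = wdeg m A x"
        using wdeg_Un[OF AG AB(2), of m x] AB(1) wdeg_outside by simp
      then show "even (wdeg m A x)" using T(2) by metis
    qed
    moreover have "v \<in> V A" using AB(3) by auto
    then obtain e where e: "e \<in> A" "v \<in> ends G e" by (auto simp: in_vset)
    have "m e > 0" using T(3) e(1) AB(1) by blast
    then have "m e * hdeg v e > 0" using hdeg_pos[OF e(2)] by simp
    then have "wdeg m A v > 0" using wdeg_ge[OF AG(1) e(1), of m v] by (rule less_le_trans)
    ultimately show ?thesis by (rule dvd_imp_le)
  qed
  have AG: "A \<subseteq> edges G" "B \<subseteq> edges G" using AB(1) T(1) by auto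
  have "wdeg m A v + wdeg m B v = 4" using wdeg_Un[OF AG AB(2), of m v] AB(1) 4 by simp
  moreover have "wdeg m A v \<ge> 2" "wdeg m B v \<ge> 2"
    using side[OF AB] side[of B A] AB by (simp_all add: Un_commute Int_commute)
  ultimately show ?thesis using AB by (simp add: split_def)
qed

section \<open>From a block decomposition to a tight weight\<close>

context
  fixes T Cs Ps assumes d: "cycle_tree_decomp G T Cs Ps"
begin

lemma decompD:
  shows "T \<subseteq> edges G" "connected_sub G T" "T = \<Union>Cs \<union> (\<Union>P\<in>Ps. path_edges P)"
    "\<forall>C\<in>Cs. \<forall>D\<in>Cs. C \<noteq> D \<longrightarrow> C \<inter> D = {}"
    "\<forall>C\<in>Cs. \<forall>P\<in>Ps. C \<inter> path_edges P = {}"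
    "\<forall>(u, p, v)\<in>Ps. simple_path G u p v"
    "\<forall>P\<in>Ps. \<forall>Q\<in>Ps. P \<noteq> Q \<longrightarrow> path_verts P \<inter> path_verts Q = {}"
    "Cs = {C. C \<subseteq> T \<and> is_cycle G C}"
    "\<forall>C\<in>Cs. \<forall>D\<in>Cs. C \<noteq> D \<longrightarrow>
        V C \<inter> V D = {} \<or> (\<exists>w. V C \<inter> V D = {w} \<and> (w, [], w) \<in> Ps)"
    "\<forall>P\<in>Ps. case P of (u, p, v) \<Rightarrow>
        \<exists>C D. C \<noteq> D \<and> {B\<in>Cs. V B \<inter> path_verts P \<noteq> {}} = {C, D} \<and>
          V C \<inter> path_verts P = {u} \<and> V D \<inter> path_verts P = {v}"
    "\<forall>w\<in>intersection_verts G Cs Ps. cut_point G T w"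
  using d unfolding cycle_tree_decomp_def by - (elim conjE, assumption)+

lemma block_cycle_iff: "C \<in> Cs \<longleftrightarrow> C \<subseteq> T \<and> is_cycle G C"
  by (subst decompD(8)) simp

lemma block_path_ends:
  assumes "(u, p, v) \<in> Ps"
  shows "\<exists>C D. C \<in> Cs \<and> D \<in> Cs \<and> C \<noteq> D \<and> u \<in> V C \<and> v \<in> V D \<and>
    (\<forall>B\<in>Cs. \<forall>x\<in>V B. x \<in> path_verts (u, p, v) \<longrightarrow> B = C \<and> x = u \<or> B = D \<and> x = v)"
proof -
  let ?P = "(u, p, v)"
  obtain C D where CD: "C \<noteq> D" "{B\<in>Cs. V B \<inter> path_verts ?P \<noteq> {}} = {C, D}"
    "V C \<inter> path_verts ?P = {u}" "V D \<inter> path_verts ?P = {v}"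
    using bspec[OF decompD(10) assms] by auto
  have "C \<in> Cs" "D \<in> Cs" using CD(2) by auto
  moreover have "u \<in> V C" "v \<in> V D" using CD(3,4) by auto
  moreover have "B = C \<and> x = u \<or> B = D \<and> x = v"
    if B: "B \<in> Cs" "x \<in> V B" "x \<in> path_verts ?P" for B x
  proof -
    have "B \<in> {C, D}" unfolding CD(2)[symmetric] using B by auto
    then show ?thesis using B CD(3,4) by auto
  qed
  ultimately show ?thesis using CD(1)
    by - (rule exI[of _ C], rule exI[of _ D], simp)
qed

lemma block_path_cycles:
  assumes P: "(u, p, v) \<in> Ps" and Cs: "C \<in> Cs" "D \<in> Cs" "E \<in> Cs" "C \<noteq> D"
    and x: "x \<in> V C" "x \<in> V D" "x \<in> V E" "x \<in> path_verts (u, p, v)"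
  shows "E = C \<or> E = D"
  using block_path_ends[OF P]
proof (elim exE conjE)
  fix C' D'
  assume *: "\<forall>B\<in>Cs. \<forall>x\<in>V B. x \<in> path_verts (u, p, v) \<longrightarrow> B = C' \<and> x = u \<or> B = D' \<and> x = v"
  have "B = C' \<or> B = D'" if "B \<in> Cs" "x \<in> V B" for B
    using bspec[OF bspec[OF * that(1)] that(2)] x(4) by blast
  from this[OF Cs(1) x(1)] this[OF Cs(2) x(2)] this[OF Cs(3) x(3)] show ?thesis using Cs(4) by blast
qed

lemma block_path_simple: "(u, p, v) \<in> Ps \<Longrightarrow> simple_path G u p v"
  using decompD(6) by blast

lemma path_verts_eq:
  assumes "(u, p, v) \<in> Ps"
  shows "path_verts (u, p, v) = insert u (V (walk_edges p))"
  using block_path_simple[OF assms] set_walk_verts by (auto simp: path_verts_def simple_path_def)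

lemma block_edge_cases:
  assumes "e \<in> T"
  obtains (cycle) C where "C \<in> Cs" "e \<in> C" | (path) u p v where "(u, p, v) \<in> Ps" "e \<in> walk_edges p"
  using assms decompD(3) by (auto simp: path_edges_def split: prod.splits)

lemma block_path_edge_sub: "(u, p, v) \<in> Ps \<Longrightarrow> walk_edges p \<subseteq> T"
  by (subst decompD(3)) (force simp: path_edges_def)

lemma block_path_no_cycle: "(u, p, v) \<in> Ps \<Longrightarrow> C \<in> Cs \<Longrightarrow> C \<inter> walk_edges p = {}"
  using decompD(5) by (fastforce simp: path_edges_def)

lemma block_paths_meet:
  "(u, p, v) \<in> Ps \<Longrightarrow> (u', p', v') \<in> Ps \<Longrightarrow> x \<in> path_verts (u, p, v) \<Longrightarrow> x \<in> path_verts (u', p', v') \<Longrightarrow>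
    (u', p', v') = (u, p, v)"
  using decompD(7) by blast

lemma block_cycles_meet:
  assumes "C \<in> Cs" "D \<in> Cs" "C \<noteq> D" "x \<in> V C" "x \<in> V D"
  shows "(x, [], x) \<in> Ps"
proof -
  obtain w where w: "V C \<inter> V D = {w}" "(w, [], w) \<in> Ps"
    using decompD(9) assms by blast
  have "x = w" using w(1) assms(4,5) by (metis IntI singletonD)
  then show ?thesis using w(2) by simp
qed

lemma path_verts_ends: "(u, p, v) \<in> Ps \<Longrightarrow> u \<in> path_verts (u, p, v) \<and> v \<in> path_verts (u, p, v)"
  using block_path_simple[of u p v] walk_verts_eq[of u p v]
  by (cases p) (auto simp: path_verts_def simple_path_def)

text \<open>Makes the intersection vertices of a block cycle independent of the chosen
  decomposition; the Eulerian condition and end-block cycles can then be expressed through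
  \<open>T\<close> alone.\<close>

lemma intersection_verts_cycle:
  assumes C: "C \<in> Cs"
  shows "V C \<inter> intersection_verts G Cs Ps = V C \<inter> V (T - C)"
proof
  have other: "x \<in> V (T - C)" if D: "D \<in> Cs" "D \<noteq> C" "x \<in> V D" for D x
  proof -
    have "D \<subseteq> T - C" using D C decompD(4) block_cycle_iff by blast
    then show ?thesis using vset_monoD[OF D(3)] by blast
  qed
  show "V C \<inter> intersection_verts G Cs Ps \<subseteq> V C \<inter> V (T - C)"
  proof
    fix x assume "x \<in> V C \<inter> intersection_verts G Cs Ps"
    then have x: "x \<in> V C" "x \<in> intersection_verts G Cs Ps" by auto
    then consider D D' where "D \<in> Cs" "D' \<in> Cs" "D \<noteq> D'" "x \<in> V D" "x \<in> V D'"
      | u p v where "(u, p, v) \<in> Ps" "x = u \<or> x = v"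
      unfolding intersection_verts_def by auto
    then have "x \<in> V (T - C)"
    proof cases
      case 1
      then show ?thesis using other by metis
    next
      case 2
      have w: "walk G u p v" using block_path_simple[OF 2(1)] by (simp add: simple_path_def)
      show ?thesis
      proof (cases "p = []")
        case False
        have "x \<in> V (walk_edges p)" using walk_start_in_vset[OF w False] 2(2) by auto
        moreover have "walk_edges p \<subseteq> T - C"
          using block_path_edge_sub[OF 2(1)] block_path_no_cycle[OF 2(1) C] by blast
        ultimately show ?thesis by (rule vset_monoD)
      next
        case True
        then have "u = v" using w by simp
        obtain D D' where "D \<in> Cs" "D' \<in> Cs" "D \<noteq> D'" "u \<in> V D" "v \<in> V D'"
          using block_path_ends[OF 2(1)] by blast
        then show ?thesis using other 2(2) \<open>u = v\<close> by metis
      qed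
    qed
    then show "x \<in> V C \<inter> V (T - C)" using x by simp
  qed
  show "V C \<inter> V (T - C) \<subseteq> V C \<inter> intersection_verts G Cs Ps"
  proof
    fix x assume "x \<in> V C \<inter> V (T - C)"
    then obtain e where x: "x \<in> V C" and e: "e \<in> T" "e \<notin> C" "x \<in> ends G e" by (auto simp: in_vset)
    from e(1) have "x \<in> intersection_verts G Cs Ps"
    proof (cases rule: block_edge_cases)
      case (cycle D)
      then have "x \<in> V D" "D \<noteq> C" using e in_vsetI by auto
      then show ?thesis unfolding intersection_verts_def using C cycle x by blast
    next
      case (path u p v)
      have "x \<in> path_verts (u, p, v)" using path_verts_eq[OF path(1)] in_vsetI[OF path(2) e(3)] by simp
      then have "x = u \<or> x = v" using block_path_ends[OF path(1)] C x by blast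
      then show ?thesis unfolding intersection_verts_def using path(1) by blast
    qed
    then show "x \<in> V C \<inter> intersection_verts G Cs Ps" using x by simp
  qed
qed

lemma wdeg_block_cycle: "C \<in> Cs \<Longrightarrow> x \<in> V C \<Longrightarrow> wdeg (ind T) C x = 2"
  using wdeg_const[of C "ind T" 1 x] ind_cycle[of C T] cycleD(4)[of C x] block_cycle_iff by auto

lemma ind_block_path: "(u, p, v) \<in> Ps \<Longrightarrow> e \<in> walk_edges p \<Longrightarrow> ind T e = 2"
  unfolding ind_def using block_path_no_cycle[of u p v] block_cycle_iff by auto

lemma wdeg_block_path: "(u, p, v) \<in> Ps \<Longrightarrow> wdeg (ind T) (walk_edges p) x = 2 * deg (walk_edges p) x"
  using wdeg_const[of "walk_edges p" "ind T" 2 x] ind_block_path by auto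

text \<open>A cycle contributes 2 at each of its vertices, the end of a block path 2 times 1, an
  interior vertex of a block path 2 times 2. The total 4 arises from two cycles, from a cycle and a
  path end, or inside a path; the last case is the one in which an edge on no cycle is named instead
  of an intersection vertex.\<close>

lemma block_vertex_cases:
  assumes x: "x \<in> V T"
  shows "wdeg (ind T) T x = 2 \<and> (\<forall>e\<in>T. x \<in> ends G e \<longrightarrow> ind T e = 1) \<or>
    wdeg (ind T) T x = 4 \<and> (x \<in> intersection_verts G Cs Ps \<or>
      (\<exists>e\<in>T. x \<in> ends G e \<and> (\<forall>C. is_cycle G C \<longrightarrow> C \<subseteq> T \<longrightarrow> e \<notin> C)))"
proof (cases "\<exists>C\<in>Cs. x \<in> V C")
  case True
  then obtain C where C: "C \<in> Cs" "x \<in> V C" by blast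
  have CT: "C \<subseteq> T" "is_cycle G C" using C block_cycle_iff by auto
  have CG: "C \<subseteq> edges G" using CT(1) decompD(1) by auto
  show ?thesis
  proof (cases "x \<in> V (T - C)")
    case False
    then have loc: "\<And>e. e \<in> T \<Longrightarrow> x \<in> ends G e \<Longrightarrow> e \<in> C" by (auto simp: in_vset)
    then show ?thesis
      using wdeg_local[OF decompD(1) CT(1) loc] wdeg_block_cycle[OF C] ind_cycle[OF CT(2,1)] by auto
  next
    case True
    then have int: "x \<in> intersection_verts G Cs Ps" using intersection_verts_cycle[OF C(1)] C(2) by auto
    have "wdeg (ind T) T x = 4"
    proof (cases "\<exists>D\<in>Cs. D \<noteq> C \<and> x \<in> V D")
      case True
      then obtain D where D: "D \<in> Cs" "D \<noteq> C" "x \<in> V D" by blast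
      have DT: "D \<subseteq> T" using D block_cycle_iff by auto
      have P: "(x, [], x) \<in> Ps" using block_cycles_meet[OF C(1) D(1)] D C by auto
      have "e \<in> C \<union> D" if e: "e \<in> T" "x \<in> ends G e" for e
        using e(1)
      proof (cases rule: block_edge_cases)
        case (cycle E)
        have xE: "x \<in> V E" using in_vsetI[OF cycle(2) e(2)] .
        have "E = C \<or> E = D"
          using block_path_cycles[OF P C(1) D(1) cycle(1) _ C(2) D(3) xE] D(2) path_verts_ends[OF P] by metis
        then show ?thesis using cycle(2) by auto
      next
        case (path u p v)
        have "x \<in> path_verts (u, p, v)" using path_verts_eq[OF path(1)] in_vsetI[OF path(2) e(2)] by simp
        then have "(u, p, v) = (x, [], x)" using block_paths_meet[OF P path(1)] path_verts_ends[OF P] by blast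
        then show ?thesis using path(2) by simp
      qed
      then have "wdeg (ind T) T x = wdeg (ind T) (C \<union> D) x"
        using wdeg_local[OF decompD(1), of "C \<union> D" x] CT(1) DT by auto
      also have "\<dots> = 2 + 2"
        using wdeg_Un[OF CG, of D "ind T" x] DT decompD(1) decompD(4) C D wdeg_block_cycle by auto
      finally show ?thesis by simp
    next
      case False
      obtain e where e: "e \<in> T" "e \<notin> C" "x \<in> ends G e" using True by (auto simp: in_vset)
      from e(1) show ?thesis
      proof (cases rule: block_edge_cases)
        case (cycle D)
        then have "x \<in> V D" "D \<noteq> C" using e in_vsetI by auto
        then show ?thesis using False cycle(1) by blast
      next
        case (path u p v)
        have xp: "x \<in> V (walk_edges p)" using in_vsetI[OF path(2) e(3)] .
        then have xP: "x \<in> path_verts (u, p, v)" using path_verts_eq[OF path(1)] by simp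
        have xuv: "x = u \<or> x = v" using block_path_ends[OF path(1)] C xP by blast
        have pne: "p \<noteq> []" using path(2) by auto
        have sp: "simple_path G u p v" using block_path_simple[OF path(1)] .
        then have "u \<noteq> v" using pne walk_verts_eq[of u p v] walk_start[of u p v]
          by (cases p) (auto simp: simple_path_def)
        then have d1: "deg (walk_edges p) x = 1" using simple_path_deg[OF sp pne, of x] xuv xp by auto
        have "e' \<in> C \<union> walk_edges p" if e': "e' \<in> T" "x \<in> ends G e'" for e'
          using e'(1)
        proof (cases rule: block_edge_cases)
          case (cycle E)
          then show ?thesis using False in_vsetI[OF cycle(2) e'(2)] by blast
        next
          case path': (path u' p' v')
          have "x \<in> path_verts (u', p', v')" using path_verts_eq[OF path'(1)] in_vsetI[OF path'(2) e'(2)] by simp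
          then have "(u', p', v') = (u, p, v)" using block_paths_meet[OF path(1) path'(1)] xP by blast
          then show ?thesis using path'(2) by simp
        qed
        then have "wdeg (ind T) T x = wdeg (ind T) (C \<union> walk_edges p) x"
          using wdeg_local[OF decompD(1), of "C \<union> walk_edges p" x] CT(1) block_path_edge_sub[OF path(1)] by auto
        also have "\<dots> = 2 + 2"
          using wdeg_Un[OF CG, of "walk_edges p" "ind T" x] block_path_edge_sub[OF path(1)] decompD(1)
            block_path_no_cycle[OF path(1) C(1)] wdeg_block_cycle[OF C] wdeg_block_path[OF path(1)] d1 by auto
        finally show ?thesis by simp
      qed
    qed
    then show ?thesis using int by blast
  qed
next
  case False
  obtain e where e: "e \<in> T" "x \<in> ends G e" using x by (auto simp: in_vset)
  have nc: "e \<notin> C" if "is_cycle G C" "C \<subseteq> T" for C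
    using False in_vsetI[OF _ e(2)] block_cycle_iff that by blast
  from e(1) show ?thesis
  proof (cases rule: block_edge_cases)
    case (cycle D)
    then show ?thesis using False in_vsetI[OF cycle(2) e(2)] by blast
  next
    case (path u p v)
    have xp: "x \<in> V (walk_edges p)" using in_vsetI[OF path(2) e(2)] .
    then have xP: "x \<in> path_verts (u, p, v)" using path_verts_eq[OF path(1)] by simp
    have pne: "p \<noteq> []" using path(2) by auto
    have sp: "simple_path G u p v" using block_path_simple[OF path(1)] .
    have "x \<noteq> u" "x \<noteq> v" using block_path_ends[OF path(1)] False by blast+
    then have d2: "deg (walk_edges p) x = 2" using simple_path_deg[OF sp pne, of x] xp by auto
    have "e' \<in> walk_edges p" if e': "e' \<in> T" "x \<in> ends G e'" for e'
      using e'(1)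
    proof (cases rule: block_edge_cases)
      case (cycle E)
      then show ?thesis using False in_vsetI[OF cycle(2) e'(2)] by blast
    next
      case path': (path u' p' v')
      have "x \<in> path_verts (u', p', v')" using path_verts_eq[OF path'(1)] in_vsetI[OF path'(2) e'(2)] by simp
      then have "(u', p', v') = (u, p, v)" using block_paths_meet[OF path(1) path'(1)] xP by blast
      then show ?thesis using path'(2) by simp
    qed
    then have "wdeg (ind T) T x = wdeg (ind T) (walk_edges p) x"
      using wdeg_local[OF decompD(1) block_path_edge_sub[OF path(1)]] by blast
    also have "\<dots> = 4" using wdeg_block_path[OF path(1)] d2 by simp
    finally show ?thesis using e nc by blast
  qed
qed

text \<open>At intersection vertices the cut is part of the definition of a cycle-tree. Inside a
  block path no cut is given, but every edge there is a bridge and supplies one.\<close>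

lemma decomp_tight: "tight (ind T) T"
  unfolding tight_def
proof (intro conjI ballI)
  show "T \<subseteq> edges G" by (rule decompD(1))
  show "conn T" using decompD(2) connected_sub_iff[OF decompD(1)] by simp
  show "ind T e > 0" for e by (rule ind_pos)
  have ev: "even (wdeg (ind T) T y)" for y
    using block_vertex_cases[of y] wdeg_outside[of y T] by (cases "y \<in> V T") auto
  have cut: "\<exists>A B. split (ind T) T x A B" if 4: "wdeg (ind T) T x = 4"
    and AB: "A \<union> B = T" "A \<inter> B = {}" "V A \<inter> V B = {x}" for x A B
    using split_from_cut[OF decompD(1) ev ind_pos AB 4] by blast
  fix x assume "x \<in> V T"
  from block_vertex_cases[OF this]
  show "(wdeg (ind T) T x = 2 \<and> (\<forall>e\<in>T. x \<in> ends G e \<longrightarrow> ind T e = 1)) \<or> (\<exists>A B. split (ind T) T x A B)"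
  proof (elim disjE conjE bexE)
    assume 4: "wdeg (ind T) T x = 4" and "x \<in> intersection_verts G Cs Ps"
    then have "cut_point G T x" using decompD(11) by (simp only:)
    then obtain A B where "A \<union> B = T" "A \<inter> B = {}" "V A \<inter> V B = {x}"
      unfolding cut_point_def by (elim exE conjE)
    from cut[OF 4 this] show ?thesis by blast
  next
    fix e assume 4: "wdeg (ind T) T x = 4" and e: "e \<in> T" "x \<in> ends G e"
      and "\<forall>C. is_cycle G C \<longrightarrow> C \<subseteq> T \<longrightarrow> e \<notin> C"
    then have nc: "\<And>C. is_cycle G C \<Longrightarrow> C \<subseteq> T \<Longrightarrow> e \<notin> C" by blast
    obtain y A B where b: "ends G e = {x, y}" "x \<noteq> y" "T = insert e (A \<union> B)" "e \<notin> A" "e \<notin> B" "A \<inter> B = {}"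
      "V A \<inter> V B = {}" "y \<notin> V A" "x \<notin> V B"
      by (rule bridge[OF decompD(1) e nc])
    have BG: "e \<in> edges G" "A \<subseteq> edges G" "B \<subseteq> edges G" "insert e B \<subseteq> edges G" using b(3) decompD(1) by auto
    have T': "A \<union> insert e B = T" "A \<inter> insert e B = {}" using b by auto
    have h: "hdeg x e = 1" using hdeg_pair[OF b(1)] b(2) by simp
    have ie: "ind T e = 2" using nc by (auto simp: ind_def)
    have "4 = wdeg (ind T) A x + (2 + wdeg (ind T) B x)"
      using wdeg_Un[OF BG(2,4) T'(2), of "ind T" x] wdeg_insert[OF BG(1,3) b(5), of "ind T" x] 4 T'(1) h ie by simp
    then have "wdeg (ind T) A x = 2" using wdeg_outside[OF b(9), of "ind T"] by simp
    then have "x \<in> V A" using wdeg_outside[of x A "ind T"] by fastforce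
    then have "V A \<inter> V (insert e B) = {x}" using b by auto
    from cut[OF 4 T' this] show ?thesis by blast
  qed blast
qed

end

end

section \<open>From a tight weight to block cycles and block paths\<close>

context sgraph
begin

lemma simple_path_reverse:
  assumes "simple_path G u p v"
  shows "simple_path G v (reverse p) u"
proof -
  have "walk G u p v \<Longrightarrow> walk_verts v (reverse p) = rev (walk_verts u p)" for u
  proof (induction p arbitrary: u)
    case (Cons s p)
    obtain a e b where s: "s = (a, e, b)" by (cases s)
    have w: "walk G b p v" "a = u" using Cons.prems s by auto
    show ?case
      using Cons.IH[OF w(1)] walk_verts_append[OF walk_reverse[OF w(1)], of "[(b, e, a)]"]
        walk_verts_eq[OF walk_reverse[OF w(1)]] s w(2) by simp
  qed simp
  moreover have w: "walk G u p v" using assms by (simp add: simple_path_def)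
  ultimately have "distinct (walk_verts v (reverse p))" using assms by (simp add: simple_path_def)
  then show ?thesis using walk_reverse[OF w] by (simp add: simple_path_def)
qed

lemma simple_path_prefix:
  assumes "simple_path G u p v" "y \<in> set (walk_verts u p)"
  shows "\<exists>q. simple_path G u q y \<and> walk_edges q \<subseteq> walk_edges p"
proof -
  have w: "walk G u p v" using assms by (simp add: simple_path_def)
  obtain p1 p2 where p: "p = p1 @ p2" "walk G u p1 y" "walk G y p2 v"
    by (rule walk_split_at[OF w assms(2)])
  then have "walk_verts u p = starts p1 @ starts p2 @ [v]" using walk_verts_eq[OF w] by simp
  moreover have "walk_verts u p1 = starts p1 @ [y]" using walk_verts_eq[OF p(2)] .
  moreover have "walk_verts y p2 = starts p2 @ [v]" using walk_verts_eq[OF p(3)] .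
  moreover have "y \<in> set (walk_verts y p2)" by (simp add: walk_verts_def)
  ultimately have "distinct (walk_verts u p1)" using assms(1) by (auto simp: simple_path_def)
  then show ?thesis using p by (auto simp: simple_path_def)
qed

lemma simple_path_ends_neq:
  assumes "simple_path G u p v" "p \<noteq> []"
  shows "u \<noteq> v"
proof -
  have w: "walk G u p v" "distinct (starts p @ [v])" using assms(1) walk_verts_eq by (auto simp: simple_path_def)
  have "u \<in> set (starts p)" using walk_start[OF w(1) assms(2)] assms(2) hd_in_set by fastforce
  then show ?thesis using w(2) by auto
qed

text \<open>Maximality is stated as closure: no other edge of weight 2 touches the path, so it is a
  whole component of the subgraph of weight-2 edges.\<close>

definition max_path :: "('e \<Rightarrow> nat) \<Rightarrow> 'e set \<Rightarrow> 'v \<Rightarrow> ('v, 'e) steps \<Rightarrow> 'v \<Rightarrow> bool" where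
  "max_path m T u p v \<longleftrightarrow> simple_path G u p v \<and> p \<noteq> [] \<and> walk_edges p \<subseteq> T \<and> (\<forall>e\<in>walk_edges p. m e = 2) \<and>
     (\<forall>e\<in>T. m e = 2 \<longrightarrow> ends G e \<inter> V (walk_edges p) \<noteq> {} \<longrightarrow> e \<in> walk_edges p)"

lemma max_path_reverse: "max_path m T u p v \<Longrightarrow> max_path m T v (reverse p) u"
  unfolding max_path_def reverse_simps(3) using simple_path_reverse[of u p v]
  by (simp add: reverse_def)

context
  fixes m T assumes t: "tight m T"
begin

lemma no_cycle_weight_2: "e \<in> T \<Longrightarrow> m e = 2 \<Longrightarrow> is_cycle G C \<Longrightarrow> C \<subseteq> T \<Longrightarrow> e \<notin> C"
  using cycle_weight[OF t, of C e] by auto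

lemma weight_2_ends:
  assumes "e \<in> T" "m e = 2" "a \<in> ends G e"
  obtains b where "ends G e = {a, b}" "a \<noteq> b"
proof -
  have e: "e \<in> edges G" using assms(1) tightD(1)[OF t] by blast
  obtain b where b: "ends G e = {a, b}" by (rule ends_other[OF e assms(3)])
  moreover have "a \<noteq> b" using loop_cycle[OF e, of a] no_cycle_weight_2[OF assms(1,2), of "{e}"] b assms(1) by auto
  ultimately show ?thesis by (rule that)
qed

text \<open>If the new vertex were already on the path, the segment up to it and \<open>e\<close>
  would form a cycle through an edge of weight 2.\<close>

lemma path_extension:
  assumes p: "simple_path G u p v" "walk_edges p \<subseteq> T"
    and e: "e \<in> T" "m e = 2" "e \<notin> walk_edges p" "u \<in> ends G e"
  shows "\<exists>y. simple_path G y ((y, e, u) # p) v"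
proof -
  have eG: "e \<in> edges G" using e(1) tightD(1)[OF t] by blast
  obtain y where y: "ends G e = {u, y}" "u \<noteq> y" by (rule weight_2_ends[OF e(1,2,4)])
  have "y \<notin> set (walk_verts u p)"
  proof
    assume "y \<in> set (walk_verts u p)"
    then obtain q where q: "simple_path G u q y" "walk_edges q \<subseteq> walk_edges p"
      using simple_path_prefix[OF p(1)] by blast
    have "is_cycle G (insert e (walk_edges q))"
      using path_cycle[OF q(1) eG y(1) _ y(2)] q(2) e(3) by blast
    then show False using no_cycle_weight_2[OF e(1,2), of "insert e (walk_edges q)"] q(2) p(2) e(1) by blast
  qed
  then show ?thesis using p(1) y(1) eG by (intro exI[of _ y]) (auto simp: simple_path_def insert_commute)
qed

text \<open>A longest simple path of weight-2 edges through \<open>e\<close>. The choice is possible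
  because such a path has at most \<open>card T\<close> edges.\<close>

lemma max_path_exists:
  assumes e: "e \<in> T" "m e = 2"
  shows "\<exists>u p v. max_path m T u p v \<and> e \<in> walk_edges p"
proof -
  define Q where "Q = (\<lambda>p. \<exists>u v. simple_path G u p v \<and> walk_edges p \<subseteq> {e \<in> T. m e = 2} \<and> e \<in> walk_edges p)"
  have eG: "e \<in> edges G" using e(1) tightD(1)[OF t] by blast
  have fT: "finite T" using finite_sub tightD(1)[OF t] by blast
  have bound: "length p < Suc (card T)" if Qp: "Q p" for p
  proof -
    obtain u v where p: "simple_path G u p v" "walk_edges p \<subseteq> T" using Qp by (auto simp: Q_def)
    have "length p = card (walk_edges p)"
      using distinct_card[OF simple_path_distinct_edges[OF p(1)]] by simp
    also have "\<dots> \<le> card T" by (rule card_mono[OF fT p(2)])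
    finally show ?thesis by simp
  qed
  obtain a where a: "a \<in> ends G e" using ends_nonempty[OF eG] by blast
  obtain b where b: "ends G e = {a, b}" "a \<noteq> b" by (rule weight_2_ends[OF e a])
  have "simple_path G a [(a, e, b)] b" using walk_step[OF eG b(1)] b(2) by (auto simp: simple_path_def)
  then have "Q [(a, e, b)]" using e by (auto simp: Q_def)
  then obtain p where p: "Q p" "\<And>q. Q q \<Longrightarrow> length q \<le> length p"
    using ex_has_greatest_nat[of Q _ length "Suc (card T)"] bound by blast
  obtain u v where uv: "simple_path G u p v" "walk_edges p \<subseteq> {e \<in> T. m e = 2}" "e \<in> walk_edges p"
    using p(1) by (auto simp: Q_def)
  have pne: "p \<noteq> []" using uv(3) by auto
  have pT: "walk_edges p \<subseteq> T" using uv(2) by auto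
  \<comment> \<open>The weighted degree is at most 4, so at most two half-edges of weight 2 meet at
    \<open>x\<close>. A further one is possible only at an end of the path, where it would extend
    it.\<close>
  have closed: "f \<in> walk_edges p" if f: "f \<in> T" "m f = 2" "x \<in> ends G f" "x \<in> V (walk_edges p)" for f x
  proof (rule ccontr)
    assume nf: "f \<notin> walk_edges p"
    have ins: "insert f (walk_edges p) \<subseteq> edges G" using f(1) pT tightD(1)[OF t] by blast
    have "wdeg m (insert f (walk_edges p)) x = 2 * deg (insert f (walk_edges p)) x"
      by (rule wdeg_const) (use f uv(2) in auto)
    moreover have "wdeg m (insert f (walk_edges p)) x \<le> 4"
      using wdeg_mono[of "insert f (walk_edges p)" T m x] f(1) pT tightD(1)[OF t] wdeg_le_4[OF t, of x] by simp
    moreover have "deg (insert f (walk_edges p)) x = hdeg x f + deg (walk_edges p) x"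
      using wdeg_insert[of f "walk_edges p" "\<lambda>_. 1" x] ins nf by simp
    ultimately have "deg (walk_edges p) x \<le> 1" using hdeg_pos[OF f(3)] by linarith
    then have "x = u \<or> x = v" using simple_path_deg[OF uv(1) pne, of x] f(4) by (cases "x = u"; cases "x = v") simp_all
    then have "\<exists>y z q. simple_path G y q z \<and> walk_edges q = insert f (walk_edges p) \<and> length q = Suc (length p)"
    proof
      assume "x = u"
      then show ?thesis using path_extension[OF uv(1) pT f(1,2) nf] f(3) by fastforce
    next
      assume x: "x = v"
      have "walk_edges (reverse p) \<subseteq> T" "f \<notin> walk_edges (reverse p)" using pT nf by auto
      from path_extension[OF simple_path_reverse[OF uv(1)] this(1) f(1,2) this(2)] show ?thesis
        using f(3) x by fastforce
    qed
    then obtain y z q where q: "simple_path G y q z" "walk_edges q = insert f (walk_edges p)" "length q = Suc (length p)"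
      by blast
    then have "Q q" using uv(2,3) f(1,2) by (auto simp: Q_def)
    from p(2)[OF this] show False using q(3) by simp
  qed
  have "max_path m T u p v" unfolding max_path_def using uv pne pT closed by blast
  then show ?thesis using uv(3) by blast
qed

lemma max_path_unique:
  assumes P: "max_path m T u p v" and Q: "max_path m T u' q v'"
    and x: "x \<in> V (walk_edges p)" "x \<in> V (walk_edges q)"
  shows "walk_edges p = walk_edges q"
proof -
  have sub: "walk_edges p \<subseteq> walk_edges q"
    if P: "max_path m T u p v" and Q: "max_path m T u' q v'"
      and x: "x \<in> V (walk_edges p)" "x \<in> V (walk_edges q)" for u p v u' q v'
  proof -
    have in_q: "f \<in> walk_edges q" if f: "f \<in> walk_edges p" "y \<in> ends G f" "y \<in> V (walk_edges q)" for f y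
      using P Q f unfolding max_path_def by blast
    have w: "walk G u p v" "p \<noteq> []" using P by (auto simp: max_path_def simple_path_def)
    obtain f where f: "f \<in> walk_edges p" "x \<in> ends G f" using x(1) by (auto simp: in_vset)
    have "walk_edges p \<inter> walk_edges q = walk_edges p"
    proof (rule connD_edges[OF conn_walk[OF w]])
      show "walk_edges p \<inter> walk_edges q \<noteq> {}" using in_q[OF f x(2)] f(1) by blast
      fix g g' y assume g: "g \<in> walk_edges p \<inter> walk_edges q" "g' \<in> walk_edges p" "y \<in> ends G g" "y \<in> ends G g'"
      have "y \<in> V (walk_edges q)" using g in_vsetI by blast
      then show "g' \<in> walk_edges p \<inter> walk_edges q" using in_q[OF g(2,4)] g(2) by blast
    qed simp
    then show ?thesis by blast
  qed
  show ?thesis using sub[OF P Q x] sub[OF Q P x(2,1)] by (rule subset_antisym)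
qed

text \<open>At an interior vertex the path contributes 4 and the cycle 2, exceeding the bound
  4.\<close>

lemma max_path_interior:
  assumes P: "max_path m T u p v" and C: "is_cycle G C" "C \<subseteq> T" and x: "x \<in> V C" "x \<in> V (walk_edges p)"
  shows "x = u \<or> x = v"
proof (rule ccontr)
  assume "\<not> ?thesis"
  then have "deg (walk_edges p) x = 2"
    using simple_path_deg[of u p v x] P x(2) by (simp add: max_path_def)
  moreover have p: "walk_edges p \<subseteq> T" "\<And>e. e \<in> walk_edges p \<Longrightarrow> m e = 2" using P by (auto simp: max_path_def)
  then have "wdeg m (walk_edges p) x = 2 * deg (walk_edges p) x" by (intro wdeg_const)
  moreover have "wdeg m C x = 1 * deg C x" using cycle_weight[OF t C] by (intro wdeg_const)
  moreover have "C \<inter> walk_edges p = {}" using no_cycle_weight_2[OF _ _ C] p by blast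
  then have "wdeg m (C \<union> walk_edges p) x = wdeg m C x + wdeg m (walk_edges p) x"
    using wdeg_Un C p tightD(1)[OF t] by (meson order_trans)
  moreover have "wdeg m (C \<union> walk_edges p) x \<le> 4"
    using wdeg_mono[of "C \<union> walk_edges p" T m x] C(2) p(1) tightD(1)[OF t] wdeg_le_4[OF t, of x] by simp
  ultimately show False using cycleD(4)[OF C(1) x(1)] by simp
qed

text \<open>The first edge \<open>e0\<close> of the path is a bridge. By maximality the other side
  at \<open>u\<close> has no edge of weight 2 at \<open>u\<close>, so an edge there lies on a cycle
  \<open>C\<close>; saturation makes \<open>C\<close> the only cycle at \<open>u\<close>. The rest
  of the path, and with it \<open>v\<close>, lies beyond \<open>e0\<close>.\<close>

lemma max_path_end:
  assumes P: "max_path m T u p v"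
  shows "\<exists>C A B. is_cycle G C \<and> C \<subseteq> T \<and> u \<in> V C \<and> v \<notin> V C \<and>
    (\<forall>D. is_cycle G D \<longrightarrow> D \<subseteq> T \<longrightarrow> u \<in> V D \<longrightarrow> D = C) \<and> split m T u A B"
proof -
  have p: "simple_path G u p v" "walk_edges p \<subseteq> T" "p \<noteq> []" "\<And>e. e \<in> walk_edges p \<Longrightarrow> m e = 2"
    and closed: "\<And>e x. e \<in> T \<Longrightarrow> m e = 2 \<Longrightarrow> x \<in> ends G e \<Longrightarrow> x \<in> V (walk_edges p) \<Longrightarrow> e \<in> walk_edges p"
    using P unfolding max_path_def by blast+
  obtain e0 y p' where pc: "p = (u, e0, y) # p'"
    using p(1,3) by (cases p) (auto simp: simple_path_def split: prod.splits)
  have u: "u \<in> ends G e0" "u \<notin> V (walk_edges p')"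
    using simple_path_Cons[of u u e0 y p' v] simple_path_start_edge(1)[of u u e0 y p' v] p(1) pc by auto
  have e0: "e0 \<in> T" "m e0 = 2" using p pc by auto
  obtain y' A B where b: "ends G e0 = {u, y'}" "u \<noteq> y'" "T = insert e0 (A \<union> B)" "e0 \<notin> A" "e0 \<notin> B" "A \<inter> B = {}"
    "V A \<inter> V B = {}" "y' \<notin> V A" "u \<notin> V B" "m e0 = 2"
    "split m T u A (insert e0 B)" "split m T y' B (insert e0 A)"
    by (rule bridge_split[OF t e0(1) u(1) no_cycle_weight_2[OF e0]])
  note s = splitD[OF b(11)]
  have only_e0: "f = e0" if f: "f \<in> walk_edges p" "u \<in> ends G f" for f
    using f pc u(2) in_vsetI[of f "walk_edges p'" u] by auto
  obtain e1 where e1: "e1 \<in> A" "u \<in> ends G e1" using s(8) by (auto simp: in_vset)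
  have uVp: "u \<in> V (walk_edges p)" using u(1) pc by simp
  have "m e1 \<noteq> 2"
  proof
    assume "m e1 = 2"
    then have "e1 \<in> walk_edges p" using closed[OF _ _ e1(2) uVp] e1(1) s(6) by blast
    then show False using only_e0 e1 b(4) by blast
  qed
  then obtain C where C: "is_cycle G C" "C \<subseteq> T" "e1 \<in> C"
    using weight_cases[OF t, of e1] e1(1) s(6) by (metis subsetD)
  have CA: "C \<subseteq> A" using cycle_side[OF t C(1,2) b(11)] C(3) e1(1) s(2) by blast
  have uC: "u \<in> V C" using in_vsetI[OF C(3) e1(2)] .
  have uniq: "D = C" if D: "is_cycle G D" "D \<subseteq> T" "u \<in> V D" for D
  proof -
    obtain f where f: "f \<in> D" "u \<in> ends G f" using D(3) by (auto simp: in_vset)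
    have "f \<noteq> e0" using no_cycle_weight_2[OF e0 D(1,2)] f(1) by blast
    moreover have "f \<notin> B" using b(9) f(2) in_vsetI by blast
    ultimately have "f \<in> A" using f(1) D(2) b(3) by blast
    then have "f \<in> C" using split_saturated[OF t C(1) CA uC b(11)] f(2) by blast
    then show ?thesis using cycles_eq[OF t D(1,2) C(1,2) f(1)] by blast
  qed
  have "walk_edges p \<inter> A = {}"
  proof (rule ccontr)
    assume ne: "walk_edges p \<inter> A \<noteq> {}"
    let ?X = "walk_edges p \<inter> A"
    have w: "walk G u p v" using p(1) by (simp add: simple_path_def)
    have "V ?X \<inter> V (walk_edges p - ?X) = {}"
    proof (rule ccontr)
      assume "V ?X \<inter> V (walk_edges p - ?X) \<noteq> {}"
      then obtain x where x: "x \<in> V ?X" "x \<in> V (walk_edges p - ?X)" by blast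
      have "x \<in> V A" "x \<in> V (insert e0 B)"
        using vset_monoD[OF x(1)] vset_monoD[OF x(2), of "insert e0 B"] p(2) b(3) by auto
      then have "x = u" using s(3) by (metis IntI singletonD)
      then obtain f where "f \<in> ?X" "u \<in> ends G f" using x(1) by (auto simp: in_vset)
      then show False using only_e0 b(4) by blast
    qed
    then have "?X = walk_edges p" using connD[OF conn_walk[OF w p(3)], of ?X] ne by blast
    then show False using b(4) pc by auto
  qed
  then have "walk_edges p \<subseteq> insert e0 B" using p(2) b(3) by blast
  moreover have "v \<in> V (walk_edges p)" using walk_start_in_vset[of u p v] p by (simp add: simple_path_def)
  ultimately have "v \<in> V (insert e0 B)" using vset_monoD by blast
  moreover have "v \<noteq> u" using simple_path_ends_neq[OF p(1,3)] by simp
  ultimately have "v \<notin> V A" using s(3) by (metis IntI singletonD)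
  then have "v \<notin> V C" using vset_monoD[OF _ CA] by blast
  then show ?thesis using C uC uniq b(11) by blast
qed

text \<open>A maximal path and its reversal have the same vertices, but block paths must be pairwise
  disjoint. So one representative is chosen for every edge set.\<close>

lemma max_path_choice:
  "\<exists>Qs. (\<forall>u p v. (u, p, v) \<in> Qs \<longrightarrow> max_path m T u p v) \<and>
    (\<forall>e. e \<in> T \<longrightarrow> m e = 2 \<longrightarrow> (\<exists>(u, p, v)\<in>Qs. e \<in> walk_edges p)) \<and>
    (\<forall>u p v u' p' v'. (u, p, v) \<in> Qs \<longrightarrow> (u', p', v') \<in> Qs \<longrightarrow> walk_edges p = walk_edges p' \<longrightarrow>
       (u, p, v) = (u', p', v'))"
proof -
  define M where "M = {(u, p, v). max_path m T u p v}"
  define ch where "ch = (\<lambda>X. SOME P. P \<in> M \<and> path_edges P = X)"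
  have ch: "ch X \<in> M \<and> path_edges (ch X) = X" if "X \<in> path_edges ` M" for X
    unfolding ch_def by (rule someI_ex) (use that in blast)
  have ch': "(u, p, v) \<in> M \<and> walk_edges p = X" if "(u, p, v) = ch X" "X \<in> path_edges ` M" for u p v X
    using ch[OF that(2)] by (simp flip: that(1) add: path_edges_def)
  have a: "max_path m T u p v" if "(u, p, v) \<in> ch ` path_edges ` M" for u p v
      using that ch' M_def by blast
  have b: "(u, p, v) = (u', p', v')"
      if P: "(u, p, v) \<in> ch ` path_edges ` M" "(u', p', v') \<in> ch ` path_edges ` M" "walk_edges p = walk_edges p'"
      for u p v u' p' v'
    proof -
      obtain X where X: "(u, p, v) = ch X" "X \<in> path_edges ` M" using P(1) by (rule imageE)
      obtain X' where X': "(u', p', v') = ch X'" "X' \<in> path_edges ` M" using P(2) by (rule imageE)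
      have "X = X'" using ch'[OF X] ch'[OF X'] P(3) by simp
      then show ?thesis using X X' by simp
    qed
  have c: "\<exists>(u, p, v)\<in>ch ` path_edges ` M. e \<in> walk_edges p" if e: "e \<in> T" "m e = 2" for e
  proof -
    obtain u p v where "max_path m T u p v" "e \<in> walk_edges p" using max_path_exists[OF e] by blast
    then have X: "walk_edges p \<in> path_edges ` M" "e \<in> walk_edges p"
      by (auto simp: M_def path_edges_def image_iff)
    obtain u' p' v' where P: "(u', p', v') = ch (walk_edges p)" by (metis prod_cases3)
    then have "e \<in> walk_edges p'" using ch'[OF P X(1)] X(2) by simp
    moreover have "(u', p', v') \<in> ch ` path_edges ` M" using P X(1) by simp
    ultimately show ?thesis by blast
  qed
  show ?thesis
    by (rule exI[of _ "ch ` path_edges ` M"], intro conjI allI impI)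
      (rule a, assumption, rule c, assumption+, rule b, assumption+)
qed

lemma tight_cycle_tree: "cycle_tree G T"
proof -
  obtain Qs where "\<forall>u p v. (u, p, v) \<in> Qs \<longrightarrow> max_path m T u p v"
    "\<forall>e. e \<in> T \<longrightarrow> m e = 2 \<longrightarrow> (\<exists>(u, p, v)\<in>Qs. e \<in> walk_edges p)"
    "\<forall>u p v u' p' v'. (u, p, v) \<in> Qs \<longrightarrow> (u', p', v') \<in> Qs \<longrightarrow> walk_edges p = walk_edges p' \<longrightarrow>
       (u, p, v) = (u', p', v')"
    using max_path_choice by (elim exE conjE) (rule that)
  note Q = this[rule_format]
  define Cs where "Cs = {C. C \<subseteq> T \<and> is_cycle G C}"
  \<comment> \<open>Block paths come in two kinds: \<open>Zs\<close> are those of length zero,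
    \<open>Qs\<close> those of positive length.\<close>
  define Zs where "Zs = {(w, p, w') |w p w'. w = w' \<and> p = ([] :: ('v, 'e) steps) \<and> (\<exists>C\<in>Cs. \<exists>D\<in>Cs. C \<noteq> D \<and> w \<in> V C \<and> w \<in> V D)}"
  define Ps where "Ps = Zs \<union> Qs"
  have CsD: "C \<subseteq> T" "is_cycle G C" if "C \<in> Cs" for C using that by (simp_all add: Cs_def)
  have ZsD: "w' = w \<and> p = [] \<and> (\<exists>C\<in>Cs. \<exists>D\<in>Cs. C \<noteq> D \<and> w \<in> V C \<and> w \<in> V D)" if "(w, p, w') \<in> Zs" for w p w'
    using that by (auto simp: Zs_def)
  have Zv: "path_verts (w, [] :: ('v, 'e) steps, w) = {w}" for w
    by (simp add: path_verts_def)
  have qp: "simple_path G u p v" "p \<noteq> []" "walk_edges p \<subseteq> T" "\<And>e. e \<in> walk_edges p \<Longrightarrow> m e = 2" if "(u, p, v) \<in> Qs" for u p v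
    using Q(1)[OF that] by (simp_all add: max_path_def)
  have Qv: "path_verts (u, p, v) = V (walk_edges p)" "u \<in> V (walk_edges p)" "v \<in> V (walk_edges p)" if "(u, p, v) \<in> Qs" for u p v
  proof -
    have "walk G u p v" using qp(1)[OF that] by (simp add: simple_path_def)
    then show "path_verts (u, p, v) = V (walk_edges p)" "u \<in> V (walk_edges p)" "v \<in> V (walk_edges p)"
      using set_walk_verts[of u p v] walk_start_in_vset[of u p v] qp(2)[OF that] by (auto simp: path_verts_def)
  qed
  have meet: "\<exists>A B. split m T w A B \<and> C \<subseteq> A \<and> D \<subseteq> B" if "C \<in> Cs" "D \<in> Cs" "C \<noteq> D" "w \<in> V C" "w \<in> V D" for C D w
    by (rule cycles_meet[OF t CsD(2,1)[OF that(1)] CsD(2,1)[OF that(2)] that(3-5)]) blast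
  \<comment> \<open>\<open>E\<close> lies on the side of \<open>C\<close> or on that of
    \<open>D\<close>; that cycle saturates its side at \<open>w\<close>, so \<open>E\<close> shares
    an edge with it.\<close>
  have third: "E = C \<or> E = D" if CD: "C \<in> Cs" "D \<in> Cs" "E \<in> Cs" "C \<noteq> D" "w \<in> V C" "w \<in> V D" "w \<in> V E" for C D E w
  proof -
    obtain A B where AB: "split m T w A B" "C \<subseteq> A" "D \<subseteq> B" using meet[OF CD(1,2,4-6)] by blast
    have eq: "E = C" if AB: "split m T w A B" "C \<subseteq> A" and "E \<subseteq> A" "C \<in> Cs" "w \<in> V C" for C A B
    proof -
      obtain e where e: "e \<in> E" "w \<in> ends G e" using CD(7) by (auto simp: in_vset)
      then have "e \<in> C" using split_saturated[OF t CsD(2)[OF that(4)] AB(2) that(5) AB(1)] that(3) by blast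
      then show ?thesis using cycles_eq[OF t CsD(2,1)[OF CD(3)] CsD(2,1)[OF that(4)] e(1)] by blast
    qed
    have "E \<subseteq> A \<or> E \<subseteq> B" using cycle_side[OF t CsD(2,1)[OF CD(3)] AB(1)] .
    then show ?thesis using eq[OF AB(1,2) _ CD(1,5)] eq[OF _ AB(3) _ CD(2,6)] AB(1) split_sym by blast
  qed
  \<comment> \<open>The two cycles saturate both sides at \<open>w\<close>, so every edge at
    \<open>w\<close> has weight 1.\<close>
  have no_path: "w \<notin> V (walk_edges p)" if CD: "C \<in> Cs" "D \<in> Cs" "C \<noteq> D" "w \<in> V C" "w \<in> V D" and P: "(u, p, v) \<in> Qs" for C D w u p v
  proof
    assume "w \<in> V (walk_edges p)"
    then obtain e where e: "e \<in> walk_edges p" "w \<in> ends G e" by (auto simp: in_vset)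
    obtain A B where AB: "split m T w A B" "C \<subseteq> A" "D \<subseteq> B" using meet[OF CD] by blast
    have BA: "split m T w B A" using AB(1) split_sym by blast
    have "e \<in> A \<or> e \<in> B" using qp(3)[OF P] e(1) splitD(1)[OF AB(1)] by blast
    then have "m e = 1"
      using split_saturated[OF t CsD(2)[OF CD(1)] AB(2) CD(4) AB(1) _ e(2)]
        split_saturated[OF t CsD(2)[OF CD(2)] AB(3) CD(5) BA _ e(2)] by blast
    then show False using qp(4)[OF P e(1)] by simp
  qed
  have no_cyc: "C \<inter> walk_edges p = {}" if "C \<in> Cs" "(u, p, v) \<in> Qs" for C u p v
    using no_cycle_weight_2[OF _ _ CsD(2,1)[OF that(1)]] qp(3,4)[OF that(2)] by blast
  have disj: "C \<inter> D = {}" if "C \<in> Cs" "D \<in> Cs" "C \<noteq> D" for C D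
    using cycles_eq[OF t CsD(2,1)[OF that(1)] CsD(2,1)[OF that(2)]] that(3) by blast
  have q_ends: "\<exists>C A B. C \<in> Cs \<and> u \<in> V C \<and> v \<notin> V C \<and> (\<forall>D\<in>Cs. u \<in> V D \<longrightarrow> D = C) \<and> split m T u A B"
    if P: "max_path m T u p v" for u p v
  proof -
    obtain C A B where C: "is_cycle G C" "C \<subseteq> T" "u \<in> V C" "v \<notin> V C"
      "\<forall>D. is_cycle G D \<longrightarrow> D \<subseteq> T \<longrightarrow> u \<in> V D \<longrightarrow> D = C" "split m T u A B"
      using max_path_end[OF P] by (elim exE conjE) (rule that)
    have "C \<in> Cs" using C(1,2) by (simp add: Cs_def)
    moreover have "\<forall>D\<in>Cs. u \<in> V D \<longrightarrow> D = C" using C(5) CsD by blast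
    ultimately show ?thesis using C(3,4,6) by (intro exI conjI)
  qed
  have q_int: "x = u \<or> x = v" if "C \<in> Cs" "x \<in> V C" "x \<in> V (walk_edges p)" "(u, p, v) \<in> Qs" for C x u p v
    using max_path_interior[OF Q(1)[OF that(4)] CsD(2,1)[OF that(1)] that(2,3)] .
  have cut: "cut_point G T w" if "split m T w A B" for w A B
  proof -
    have "A \<noteq> {}" "B \<noteq> {}" using splitD(8,9)[OF that] by auto
    then show ?thesis unfolding cut_point_def using splitD(1-3)[OF that] by blast
  qed
  have g1: "T \<subseteq> edges G" "connected_sub G T" using tightD[OF t] connected_sub_iff by auto
  have g3: "T = \<Union>Cs \<union> (\<Union>P\<in>Ps. path_edges P)"
  proof
    show "T \<subseteq> \<Union>Cs \<union> (\<Union>P\<in>Ps. path_edges P)"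
    proof
      fix e assume e: "e \<in> T"
      show "e \<in> \<Union>Cs \<union> (\<Union>P\<in>Ps. path_edges P)"
      proof (cases "\<exists>C. is_cycle G C \<and> C \<subseteq> T \<and> e \<in> C")
        case True
        then show ?thesis by (auto simp: Cs_def)
      next
        case False
        then have "m e = 2" using weight_cases[OF t e] by simp
        then obtain u p v where "(u, p, v) \<in> Qs" "e \<in> walk_edges p" using Q(2)[OF e] by auto
        then show ?thesis unfolding Ps_def path_edges_def by blast
      qed
    qed
    show "\<Union>Cs \<union> (\<Union>P\<in>Ps. path_edges P) \<subseteq> T"
      using CsD(1) qp(3) ZsD by (fastforce simp: Ps_def path_edges_def)
  qed
  have g4: "\<forall>C\<in>Cs. \<forall>D\<in>Cs. C \<noteq> D \<longrightarrow> C \<inter> D = {}" using disj by blast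
  have g5: "\<forall>C\<in>Cs. \<forall>P\<in>Ps. C \<inter> path_edges P = {}"
    using no_cyc ZsD by (fastforce simp: Ps_def path_edges_def)
  have g6: "\<forall>(u, p, v)\<in>Ps. simple_path G u p v"
  proof -
    have "simple_path G u p v" if P: "(u, p, v) \<in> Zs" for u p v
    proof -
      obtain C where C: "C \<in> Cs" "u \<in> V C" using ZsD[OF P] by blast
      then have "u \<in> verts G" using vset_subset_verts[OF cycleD(1)[OF CsD(2)[OF C(1)]]] by blast
      then show ?thesis using ZsD[OF P] by (simp add: simple_path_def)
    qed
    then show ?thesis using qp(1) by (auto simp: Ps_def)
  qed
  have g7: "\<forall>P\<in>Ps. \<forall>Q\<in>Ps. P \<noteq> Q \<longrightarrow> path_verts P \<inter> path_verts Q = {}"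
  proof (intro ballI impI)
    fix P P' assume P: "P \<in> Ps" "P' \<in> Ps" "P \<noteq> P'"
    obtain u p v u' p' v' where pq: "P = (u, p, v)" "P' = (u', p', v')" by (metis prod_cases3)
    have mixed: "path_verts (u, p, v) \<inter> path_verts (u', p', v') = {}"
      if Z: "(u, p, v) \<in> Zs" and Q': "(u', p', v') \<in> Qs" for u p v u' p' v'
    proof -
      have z: "v = u" "p = []" using ZsD[OF Z] by simp_all
      obtain C D where CD: "C \<in> Cs" "D \<in> Cs" "C \<noteq> D" "u \<in> V C" "u \<in> V D" using ZsD[OF Z] by blast
      have "u \<notin> V (walk_edges p')" by (rule no_path[OF CD Q'])
      then show ?thesis using Qv(1)[OF Q'] Zv(1)[of u] z by simp
    qed
    consider "P \<in> Zs" "P' \<in> Zs" | "P \<in> Zs" "P' \<in> Qs" | "P \<in> Qs" "P' \<in> Zs" | "P \<in> Qs" "P' \<in> Qs"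
      using P(1,2) by (auto simp: Ps_def)
    then show "path_verts P \<inter> path_verts P' = {}"
    proof cases
      case 1
      then have z: "(u, p, v) \<in> Zs" "(u', p', v') \<in> Zs" using pq by simp_all
      have e: "v = u" "p = []" "v' = u'" "p' = []" using ZsD[OF z(1)] ZsD[OF z(2)] by simp_all
      then have "u \<noteq> u'" using P(3) pq by auto
      then show ?thesis using Zv[of u] Zv[of u'] pq e by simp
    next
      case 2
      then show ?thesis using mixed pq by simp
    next
      case 3
      then show ?thesis using mixed pq by (simp add: Int_commute)
    next
      case 4
      then have q: "(u, p, v) \<in> Qs" "(u', p', v') \<in> Qs" using pq by simp_all
      have "V (walk_edges p) \<inter> V (walk_edges p') = {}"
        using max_path_unique[OF Q(1)[OF q(1)] Q(1)[OF q(2)]] Q(3)[OF q] P(3) pq by blast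
      then show ?thesis using Qv(1)[OF q(1)] Qv(1)[OF q(2)] pq by simp
    qed
  qed
  have g9: "\<forall>C\<in>Cs. \<forall>D\<in>Cs. C \<noteq> D \<longrightarrow> V C \<inter> V D = {} \<or> (\<exists>w. V C \<inter> V D = {w} \<and> (w, [], w) \<in> Ps)"
  proof (intro ballI impI)
    fix C D assume CD: "C \<in> Cs" "D \<in> Cs" "C \<noteq> D"
    show "V C \<inter> V D = {} \<or> (\<exists>w. V C \<inter> V D = {w} \<and> (w, [], w) \<in> Ps)"
    proof (cases "V C \<inter> V D = {}")
      case False
      then obtain w where w: "w \<in> V C" "w \<in> V D" by blast
      obtain A B where AB: "split m T w A B" "C \<subseteq> A" "D \<subseteq> B" using meet[OF CD w] by blast
      have "V C \<inter> V D \<subseteq> V A \<inter> V B" using vset_mono[OF AB(2)] vset_mono[OF AB(3)] by blast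
      then have "V C \<inter> V D = {w}" using splitD(3)[OF AB(1)] w by blast
      moreover have "(w, [], w) \<in> Ps" unfolding Ps_def Zs_def using CD w by blast
      ultimately show ?thesis by blast
    qed simp
  qed
  have g10: "\<forall>P\<in>Ps. case P of (u, p, v) \<Rightarrow> \<exists>C D. C \<noteq> D \<and> {B\<in>Cs. V B \<inter> path_verts P \<noteq> {}} = {C, D} \<and>
          V C \<inter> path_verts P = {u} \<and> V D \<inter> path_verts P = {v}"
  proof (intro ballI)
    fix P assume P: "P \<in> Ps"
    obtain u p v where pq: "P = (u, p, v)" by (metis prod_cases3)
    have "\<exists>C D. C \<noteq> D \<and> {B\<in>Cs. V B \<inter> path_verts P \<noteq> {}} = {C, D} \<and>
          V C \<inter> path_verts P = {u} \<and> V D \<inter> path_verts P = {v}"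
    proof (cases "P \<in> Zs")
      case True
      then have z: "(u, p, v) \<in> Zs" using pq by simp
      then have z': "v = u" "p = []" using ZsD by simp_all
      obtain C D where CD: "C \<in> Cs" "D \<in> Cs" "C \<noteq> D" "u \<in> V C" "u \<in> V D" using ZsD[OF z] by blast
      have pv: "path_verts P = {u}" using pq z' Zv by simp
      have "{B\<in>Cs. V B \<inter> path_verts P \<noteq> {}} = {C, D}"
        unfolding pv using CD third[OF CD(1,2) _ CD(3-5)] by auto
      then show ?thesis using CD pv z' by blast
    next
      case False
      then have q: "(u, p, v) \<in> Qs" using P pq by (simp add: Ps_def)
      have pv: "path_verts P = V (walk_edges p)" using Qv(1)[OF q] pq by simp
      obtain C where C: "C \<in> Cs" "u \<in> V C" "v \<notin> V C" "\<And>E. E \<in> Cs \<Longrightarrow> u \<in> V E \<Longrightarrow> E = C"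
        using q_ends[OF Q(1)[OF q]] by blast
      obtain D where D: "D \<in> Cs" "v \<in> V D" "u \<notin> V D" "\<And>E. E \<in> Cs \<Longrightarrow> v \<in> V E \<Longrightarrow> E = D"
        using q_ends[OF max_path_reverse[OF Q(1)[OF q]]] by blast
      have CD: "C \<noteq> D" using C D by blast
      have int: "x = u \<or> x = v" if "E \<in> Cs" "x \<in> V E" "x \<in> path_verts P" for E x
        using q_int[OF that(1,2) _ q] that(3) pv by blast
      have uv: "u \<in> path_verts P" "v \<in> path_verts P" using Qv(2,3)[OF q] pv by simp_all
      have "{B\<in>Cs. V B \<inter> path_verts P \<noteq> {}} = {C, D}"
      proof
        show "{B\<in>Cs. V B \<inter> path_verts P \<noteq> {}} \<subseteq> {C, D}"
        proof
          fix B assume "B \<in> {B\<in>Cs. V B \<inter> path_verts P \<noteq> {}}"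
          then obtain x where x: "B \<in> Cs" "x \<in> V B" "x \<in> path_verts P" by blast
          then show "B \<in> {C, D}" using int[OF x] C(4) D(4) by blast
        qed
        show "{C, D} \<subseteq> {B\<in>Cs. V B \<inter> path_verts P \<noteq> {}}" using C(1,2) D(1,2) uv by blast
      qed
      moreover have "V C \<inter> path_verts P = {u}" using C(1-3) int[OF C(1)] uv by blast
      moreover have "V D \<inter> path_verts P = {v}" using D(1-3) int[OF D(1)] uv by blast
      ultimately show ?thesis using CD by blast
    qed
    then show "case P of (u, p, v) \<Rightarrow> \<exists>C D. C \<noteq> D \<and> {B\<in>Cs. V B \<inter> path_verts P \<noteq> {}} = {C, D} \<and>
          V C \<inter> path_verts P = {u} \<and> V D \<inter> path_verts P = {v}" using pq by simp
  qed
  have g11: "\<forall>w\<in>intersection_verts G Cs Ps. cut_point G T w"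
  proof
    fix w assume "w \<in> intersection_verts G Cs Ps"
    then consider C D where "C \<in> Cs" "D \<in> Cs" "C \<noteq> D" "w \<in> V C" "w \<in> V D" | u p v where "(u, p, v) \<in> Ps" "w = u \<or> w = v"
      unfolding intersection_verts_def by auto
    then show "cut_point G T w"
    proof cases
      case 1
      then show ?thesis using meet[OF 1] cut by blast
    next
      case 2
      show ?thesis
      proof (cases "(u, p, v) \<in> Zs")
        case True
        then obtain C D where "C \<in> Cs" "D \<in> Cs" "C \<noteq> D" "w \<in> V C" "w \<in> V D" using ZsD[OF True] 2(2) by blast
        from meet[OF this] show ?thesis using cut by blast
      next
        case False
        then have q: "(u, p, v) \<in> Qs" using 2(1) by (simp add: Ps_def)
        have "\<exists>A B. split m T u A B" using q_ends[OF Q(1)[OF q]] by (elim exE conjE) (intro exI)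
        moreover have "\<exists>A B. split m T v A B"
          using q_ends[OF max_path_reverse[OF Q(1)[OF q]]] by (elim exE conjE) (intro exI)
        ultimately show ?thesis using 2(2) cut by metis
      qed
    qed
  qed
  have "cycle_tree_decomp G T Cs Ps"
    unfolding cycle_tree_decomp_def
    by (intro conjI g1 g3 g4 g5 g6 g7 Cs_def g9 g10 g11)
  then show ?thesis unfolding cycle_tree_def by blast
qed

end

section \<open>Cycle-tree notions without reference to a decomposition\<close>

lemma cycle_tree_iff: "cycle_tree G T \<longleftrightarrow> tight (ind T) T"
  using decomp_tight tight_cycle_tree unfolding cycle_tree_def by blast

text \<open>The intersection vertices on a block cycle \<open>C\<close> are the vertices where \<open>T\<close> leaves \<open>C\<close>.\<close>

lemma eulerian_cycle_tree_iff:
  "eulerian_cycle_tree G T \<longleftrightarrow> cycle_tree G T \<and>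
     (\<forall>C. is_cycle G C \<longrightarrow> C \<subseteq> T \<longrightarrow>
       (balanced G C \<longrightarrow> even (card (V C \<inter> V (T - C)))) \<and> (unbalanced G C \<longrightarrow> odd (card (V C \<inter> V (T - C)))))"
proof -
  have *: "(\<forall>C\<in>Cs. (balanced G C \<longrightarrow> even (card (V C \<inter> intersection_verts G Cs Ps))) \<and>
             (unbalanced G C \<longrightarrow> odd (card (V C \<inter> intersection_verts G Cs Ps)))) \<longleftrightarrow>
      (\<forall>C. is_cycle G C \<longrightarrow> C \<subseteq> T \<longrightarrow>
       (balanced G C \<longrightarrow> even (card (V C \<inter> V (T - C)))) \<and> (unbalanced G C \<longrightarrow> odd (card (V C \<inter> V (T - C)))))"
    if d: "cycle_tree_decomp G T Cs Ps" for Cs Ps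
    using intersection_verts_cycle[OF d] block_cycle_iff[OF d] by auto
  show ?thesis unfolding eulerian_cycle_tree_def cycle_tree_def by (simp add: * cong: conj_cong)
qed

lemma end_block_cycle_iff:
  "end_block_cycle G T C \<longleftrightarrow> cycle_tree G T \<and> is_cycle G C \<and> C \<subseteq> T \<and> card (V C \<inter> V (T - C)) = 1"
proof -
  have *: "C \<in> Cs \<and> card (V C \<inter> intersection_verts G Cs Ps) = 1 \<longleftrightarrow>
      is_cycle G C \<and> C \<subseteq> T \<and> card (V C \<inter> V (T - C)) = 1"
    if d: "cycle_tree_decomp G T Cs Ps" for Cs Ps
    using intersection_verts_cycle[OF d, of C] block_cycle_iff[OF d, of C] by auto
  show ?thesis unfolding end_block_cycle_def cycle_tree_def by (simp add: * cong: conj_cong)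
qed

lemma tree_indicator_eq:
  assumes "cycle_tree G T"
  shows "tree_indicator G T e = (if e \<in> T then int (ind T e) else 0)"
proof -
  obtain Cs Ps where d: "cycle_tree_decomp G T Cs Ps" using assms by (auto simp: cycle_tree_def)
  have c: "(\<exists>Cs Ps. cycle_tree_decomp G T Cs Ps \<and> (\<exists>C\<in>Cs. e \<in> C)) \<longleftrightarrow> (\<exists>C. is_cycle G C \<and> C \<subseteq> T \<and> e \<in> C)"
    using d block_cycle_iff by meson
  have p: "e \<in> T" if "cycle_tree_decomp G T Cs' Ps'" "P \<in> Ps'" "e \<in> path_edges P" for Cs' Ps' P
    using block_path_edge_sub[OF that(1)] that(2,3) by (cases P) (auto simp: path_edges_def)
  have p': "\<exists>P\<in>Ps. e \<in> path_edges P" if "e \<in> T" "\<not> (\<exists>C. is_cycle G C \<and> C \<subseteq> T \<and> e \<in> C)"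
    using that decompD(3)[OF d] block_cycle_iff[OF d] by blast
  show ?thesis
    unfolding tree_indicator_def c ind_def using p p' d by auto
qed

end

section \<open>Flows\<close>

context sgraph
begin

context
  fixes \<epsilon> :: "'v \<Rightarrow> 'e \<Rightarrow> int"
  assumes ori: "orientation G (edges G) \<epsilon>"
begin

abbreviation inc :: "'v \<Rightarrow> 'e \<Rightarrow> int" where
  "inc \<equiv> incidence G \<epsilon>"

lemma orientation_ends: "e \<in> edges G \<Longrightarrow> v \<in> ends G e \<Longrightarrow> \<epsilon> v e = 1 \<or> \<epsilon> v e = -1"
  and orientation_outside: "e \<in> edges G \<Longrightarrow> v \<notin> ends G e \<Longrightarrow> \<epsilon> v e = 0"
  using ori unfolding orientation_def by auto

lemma orientation_sign:
  assumes "e \<in> edges G" "ends G e = {a, b}" "a \<noteq> b"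
  shows "\<epsilon> a e * \<epsilon> b e = - sgn_of G e"
proof -
  have "\<not> is_loop G e" using assms by (simp add: is_loop_def)
  then show ?thesis using ori assms unfolding orientation_def by blast
qed

lemma incidence_outside: "e \<in> edges G \<Longrightarrow> v \<notin> ends G e \<Longrightarrow> inc v e = 0"
  using orientation_outside by (auto simp: incidence_def)

text \<open>Positive loops are the exception: their incidence is 0 although they have two
  half-edges. This is why they cannot be treated by coherent walks.\<close>

lemma incidence_eq:
  assumes "e \<in> edges G" "\<not> (is_loop G e \<and> sgn_of G e = 1)"
  shows "inc v e = \<epsilon> v e * int (hdeg v e)"
proof (cases "v \<in> ends G e")
  case True
  show ?thesis
  proof (cases "is_loop G e")
    case loop: True
    then obtain w where "ends G e = {w}" unfolding is_loop_def by (rule card_1_singletonE)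
    then have "ends G e = {v}" using True by auto
    then show ?thesis using loop assms sgn_cases[OF assms(1)] by (auto simp: incidence_def hdeg_def)
  qed (use True in \<open>simp add: incidence_def hdeg_def\<close>)
qed (use assms incidence_outside in \<open>simp add: hdeg_def\<close>)

lemma incidence_positive_loop: "is_loop G e \<Longrightarrow> sgn_of G e = 1 \<Longrightarrow> inc v e = 0"
  by (simp add: incidence_def)

text \<open>Modulo 2 orientations disappear: a loop has incidence 0 or twice a sign, a non-loop a
  sign. This transfers parity between flows and weighted degrees.\<close>

lemma even_incidence: "e \<in> edges G \<Longrightarrow> even (inc v e) \<longleftrightarrow> even (hdeg v e)"
  using incidence_eq[of e v] incidence_positive_loop[of e v] orientation_ends[of e v]
  by (cases "is_loop G e \<and> sgn_of G e = 1"; cases "v \<in> ends G e") (auto simp: hdeg_def)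

lemma abs_incidence_le:
  assumes "e \<in> edges G"
  shows "\<bar>inc v e\<bar> \<le> int (hdeg v e)"
proof (cases "is_loop G e \<and> sgn_of G e = 1")
  case False
  then show ?thesis using incidence_eq[OF assms, of v] orientation_ends[OF assms, of v]
    by (cases "v \<in> ends G e") (auto simp: hdeg_def)
qed (simp add: incidence_positive_loop)

text \<open>The column sums of the incidence matrix. The arrows at the two ends cancel for a
  positive edge and add up for a negative one.\<close>

lemma sum_incidence:
  assumes e: "e \<in> edges G"
  shows "(\<Sum>v\<in>verts G. inc v e) = 0 \<and> sgn_of G e = 1 \<or> \<bar>\<Sum>v\<in>verts G. inc v e\<bar> = 2 \<and> sgn_of G e = -1"
proof -
  obtain a b where ab: "ends G e = {a, b}" "a \<in> verts G" "b \<in> verts G" by (rule ends_pair[OF e])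
  have *: "(\<Sum>v\<in>verts G. inc v e) = (\<Sum>v\<in>{a, b}. inc v e)"
    using ab finite_verts incidence_outside[OF e] by (intro sum.mono_neutral_right) auto
  show ?thesis
  proof (cases "a = b")
    case True
    then have loop: "is_loop G e" using ab by (simp add: is_loop_def)
    show ?thesis
    proof (cases "sgn_of G e = 1")
      case True
      then show ?thesis unfolding * using incidence_positive_loop[OF loop] \<open>a = b\<close> by simp
    next
      case False
      then have "inc a e = 2 * \<epsilon> a e" "sgn_of G e = -1"
        using incidence_eq[OF e, of a] sgn_cases[OF e] ab loop by (auto simp: hdeg_def)
      then show ?thesis unfolding * using orientation_ends[OF e, of a] ab \<open>a = b\<close> by auto
    qed
  next
    case False
    then have "\<not> is_loop G e" using ab by (simp add: is_loop_def)
    then have "(\<Sum>v\<in>{a, b}. inc v e) = \<epsilon> a e + \<epsilon> b e" using False by (simp add: incidence_def)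
    moreover have "\<epsilon> a e = 1 \<or> \<epsilon> a e = -1" "\<epsilon> b e = 1 \<or> \<epsilon> b e = -1"
      using orientation_ends[OF e] ab by auto
    ultimately show ?thesis unfolding * using orientation_sign[OF e ab(1) False] by auto
  qed
qed

text \<open>As +1 marks an arrow away from \<open>v\<close>, this is the net outflow at
  \<open>v\<close> through the edges of \<open>A\<close>.\<close>

definition net :: "('e \<Rightarrow> int) \<Rightarrow> 'e set \<Rightarrow> 'v \<Rightarrow> int" where
  "net f A v = (\<Sum>e\<in>A. inc v e * f e)"

lemma net_outside:
  assumes "A \<subseteq> edges G" "v \<notin> V A"
  shows "net f A v = 0"
  unfolding net_def
proof (rule sum.neutral, rule ballI)
  fix e assume "e \<in> A"
  then have "e \<in> edges G" "v \<notin> ends G e" using assms in_vsetI by auto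
  then show "inc v e * f e = 0" by (simp add: incidence_outside)
qed

lemma net_split:
  assumes "T \<subseteq> edges G" "A \<subseteq> T"
  shows "net f T v = net f A v + net f (T - A) v"
  unfolding net_def using sum.subset_diff[OF assms(2) finite_sub[OF assms(1)], of "\<lambda>e. inc v e * f e"] by simp

lemma net_local:
  assumes "T \<subseteq> edges G" "X \<subseteq> T" "\<And>e. e \<in> T \<Longrightarrow> v \<in> ends G e \<Longrightarrow> e \<in> X"
  shows "net f T v = net f X v"
proof -
  have "v \<notin> V (T - X)" using assms(3) by (auto simp: in_vset)
  then have "net f (T - X) v = 0" using assms(1) by (intro net_outside) auto
  then show ?thesis using net_split[OF assms(1,2)] by simp
qed

lemma flow_net:
  assumes "integral_flow G \<epsilon> f" "T \<subseteq> edges G" "\<And>e. e \<notin> T \<Longrightarrow> f e = 0"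
  shows "net f T v = 0"
proof (cases "v \<in> verts G")
  case True
  have "(\<Sum>e\<in>edges G. inc v e * f e) = 0" using assms(1) True by (simp add: integral_flow_def)
  moreover have "(\<Sum>e\<in>edges G. inc v e * f e) = net f T v"
    unfolding net_def using assms(2,3) finite_edges by (intro sum.mono_neutral_right) auto
  ultimately show ?thesis by simp
next
  case False
  then show ?thesis using assms(2) vset_subset_verts[OF assms(2)] by (intro net_outside) auto
qed

lemma sum_net: "(\<Sum>v\<in>verts G. net f A v) = (\<Sum>e\<in>A. f e * (\<Sum>v\<in>verts G. inc v e))"
  unfolding net_def by (subst sum.swap) (simp add: sum_distrib_left mult.commute)

text \<open>Away from \<open>v\<close> the edges of \<open>A\<close> carry all or none of the flow
  at a vertex, so \<open>v\<close> is the only vertex with nonzero net flow in \<open>A\<close>. Its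
  net flow is then the sum over all vertices, a combination of even column sums.\<close>

lemma even_net:
  assumes f: "integral_flow G \<epsilon> f" "T \<subseteq> edges G" "\<And>e. e \<notin> T \<Longrightarrow> f e = 0"
    and A: "A \<subseteq> T" "V A \<inter> V (T - A) \<subseteq> {v}"
  shows "even (net f A v)"
proof (cases "v \<in> verts G")
  case True
  have AG: "A \<subseteq> edges G" "T - A \<subseteq> edges G" using A(1) f(2) by auto
  have z: "net f A x = 0" if "x \<noteq> v" for x
  proof (cases "x \<in> V A")
    case True
    then have "x \<notin> V (T - A)" using A(2) that by auto
    then have "net f (T - A) x = 0" by (rule net_outside[OF AG(2)])
    then show ?thesis using net_split[OF f(2) A(1), of f x] flow_net[OF f, of x] by simp
  qed (rule net_outside[OF AG(1)])
  have "even (\<Sum>e\<in>A. f e * (\<Sum>v\<in>verts G. inc v e))"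
  proof (rule dvd_sum)
    fix e assume "e \<in> A"
    then have e: "e \<in> edges G" using AG by blast
    have "even (\<Sum>v\<in>verts G. inc v e)" using sum_incidence[OF e] by (elim disjE conjE) presburger+
    then show "even (f e * (\<Sum>v\<in>verts G. inc v e))" by simp
  qed
  then have "even (\<Sum>x\<in>verts G. net f A x)" by (simp only: sum_net)
  moreover have "(\<Sum>x\<in>verts G. net f A x) = net f A v"
    using z finite_verts True by (subst sum.remove[of _ v]) auto
  ultimately show ?thesis by simp
next
  case False
  have AG: "A \<subseteq> edges G" using A(1) f(2) by auto
  then have "v \<notin> V A" using False vset_subset_verts by blast
  then show ?thesis using net_outside[OF AG] by simp
qed

lemma even_net_iff_wdeg:
  assumes "A \<subseteq> edges G"
  shows "even (net f A v) \<longleftrightarrow> even (wdeg (\<lambda>e. nat \<bar>f e\<bar>) A v)"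
proof -
  have "even (net f A v - int (wdeg (\<lambda>e. nat \<bar>f e\<bar>) A v))"
    unfolding net_def wdeg_def of_nat_sum sum_subtractf[symmetric]
  proof (rule dvd_sum)
    fix e assume "e \<in> A"
    then have "even (inc v e) \<longleftrightarrow> even (hdeg v e)" using even_incidence assms by blast
    then show "even (inc v e * f e - int (nat \<bar>f e\<bar> * hdeg v e))" by auto
  qed
  then show ?thesis by simp
qed

lemma abs_net_le:
  assumes "A \<subseteq> edges G"
  shows "\<bar>net f A v\<bar> \<le> int (wdeg (\<lambda>e. nat \<bar>f e\<bar>) A v)"
proof -
  have "\<bar>net f A v\<bar> \<le> (\<Sum>e\<in>A. \<bar>inc v e * f e\<bar>)" unfolding net_def by (rule sum_abs)
  also have "\<dots> \<le> (\<Sum>e\<in>A. int (nat \<bar>f e\<bar> * hdeg v e))"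
  proof (rule sum_mono)
    fix e assume "e \<in> A"
    then have "\<bar>inc v e\<bar> \<le> int (hdeg v e)" using abs_incidence_le assms by blast
    then have "\<bar>f e\<bar> * \<bar>inc v e\<bar> \<le> \<bar>f e\<bar> * int (hdeg v e)" by (rule mult_left_mono) simp
    then show "\<bar>inc v e * f e\<bar> \<le> int (nat \<bar>f e\<bar> * hdeg v e)" by (simp add: abs_mult mult.commute)
  qed
  finally show ?thesis by (simp add: wdeg_def)
qed

text \<open>Count \<open>\<Sum>v. net f A v\<close> modulo 4 by vertices and by edges.\<close>

lemma cycle_sign_net:
  assumes A: "A \<subseteq> edges G" "\<And>e. e \<in> A \<Longrightarrow> \<bar>f e\<bar> = 1" "\<And>v. net f A v = 0 \<or> \<bar>net f A v\<bar> = 2"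
  shows "cycle_sign G A = (-1) ^ card {v \<in> verts G. net f A v \<noteq> 0}"
proof -
  have fA: "finite A" by (rule finite_sub[OF A(1)])
  define S where "S = {v \<in> verts G. net f A v \<noteq> 0}"
  define N where "N = {e \<in> A. sgn_of G e = -1}"
  have "4 dvd (\<Sum>v\<in>verts G. net f A v - 2 * of_bool (net f A v \<noteq> 0))"
  proof (rule dvd_sum)
    fix v
    have "net f A v = 0 \<or> net f A v = 2 \<or> net f A v = -2" using A(3)[of v] by linarith
    then show "4 dvd net f A v - 2 * of_bool (net f A v \<noteq> 0)" by (elim disjE) simp_all
  qed
  moreover have "(\<Sum>v\<in>verts G. of_bool (net f A v \<noteq> 0)) = int (card S)"
    using finite_verts by (simp add: S_def Int_def)
  ultimately have v: "4 dvd (\<Sum>v\<in>verts G. net f A v) - 2 * int (card S)"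
    by (simp add: sum_subtractf flip: sum_distrib_left)
  have "4 dvd (\<Sum>e\<in>A. f e * (\<Sum>v\<in>verts G. inc v e) - 2 * of_bool (sgn_of G e = -1))"
  proof (rule dvd_sum)
    fix e assume e: "e \<in> A"
    have "f e = 1 \<or> f e = -1" using A(2)[OF e] by linarith
    moreover have "(\<Sum>v\<in>verts G. inc v e) = 0 \<and> sgn_of G e = 1 \<or> (\<Sum>v\<in>verts G. inc v e) = 2 \<and> sgn_of G e = -1
        \<or> (\<Sum>v\<in>verts G. inc v e) = -2 \<and> sgn_of G e = -1"
      using sum_incidence[of e] e A(1) by (auto simp: abs_if split: if_splits)
    ultimately show "4 dvd f e * (\<Sum>v\<in>verts G. inc v e) - 2 * of_bool (sgn_of G e = -1)" by auto
  qed
  moreover have "(\<Sum>e\<in>A. of_bool (sgn_of G e = -1)) = int (card N)"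
    using fA by (simp add: N_def Int_def)
  ultimately have "4 dvd (\<Sum>e\<in>A. f e * (\<Sum>v\<in>verts G. inc v e)) - 2 * int (card N)"
    by (simp add: sum_subtractf flip: sum_distrib_left)
  then have "even (card S) \<longleftrightarrow> even (card N)" using v unfolding sum_net by presburger
  moreover have "cycle_sign G A = (-1) ^ card N"
  proof -
    have "cycle_sign G A = (\<Prod>e\<in>A. (-1) ^ of_bool (sgn_of G e = -1))"
      unfolding cycle_sign_def using sgn_cases A(1) by (intro prod.cong) force+
    also have "\<dots> = (-1) ^ (\<Sum>e\<in>A. of_bool (sgn_of G e = -1))" by (rule power_sum[symmetric])
    also have "(\<Sum>e\<in>A. of_bool (sgn_of G e = -1)) = card N"
      using fA by (simp add: N_def Int_def)
    finally show ?thesis .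
  qed
  ultimately show ?thesis unfolding S_def[symmetric] by (simp add: minus_one_power_iff)
qed

section \<open>Flows whose magnitude is a tight weight\<close>

context
  fixes f :: "'e \<Rightarrow> int" and T
  assumes fl: "integral_flow G \<epsilon> f" and T: "T = supp f"
begin

abbreviation mag :: "'e \<Rightarrow> nat" where
  "mag \<equiv> \<lambda>e. nat \<bar>f e\<bar>"

text \<open>At every cut vertex the flow passes from one side of the cut to the other.\<close>

definition switching :: bool where
  "switching \<longleftrightarrow> tight mag T \<and> (\<forall>v. wdeg mag T v = 4 \<longrightarrow> (\<exists>A B. split mag T v A B \<and> net f A v \<noteq> 0))"

lemma supp_sub: "T \<subseteq> edges G" and outside_supp: "e \<notin> T \<Longrightarrow> f e = 0" and supp_nonzero: "e \<in> T \<Longrightarrow> f e \<noteq> 0"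
  using fl T by (auto simp: integral_flow_def supp_def)

lemma flow_net_supp: "net f T v = 0"
  using flow_net[OF fl supp_sub outside_supp] .

lemma net_sides:
  assumes "split mag T v A B"
  shows "net f A v + net f B v = 0"
proof -
  have "B = T - A" using splitD(1,2)[OF assms] by blast
  then show ?thesis using net_split[OF supp_sub splitD(6)[OF assms], of f v] flow_net_supp[of v] by simp
qed

lemma switching_cases:
  assumes s: switching and v: "v \<in> V T"
  obtains (simple) "wdeg mag T v = 2" | (split) A B where "split mag T v A B" "net f A v \<noteq> 0"
proof -
  have t: "tight mag T" using s by (simp add: switching_def)
  from t v show ?thesis
  proof (cases rule: tight_vertex)
    case simple
    then show ?thesis using that(1) by blast
  next
    case (split A B)
    then have "\<exists>A B. split mag T v A B \<and> net f A v \<noteq> 0" using split_wdeg[OF t split] s by (simp add: switching_def)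
    then show ?thesis using that(2) by blast
  qed
qed

text \<open>A conformal summand \<open>g\<close> agrees with \<open>f\<close> in sign and is bounded
  by it. It suffices that at each vertex \<open>g\<close> is either zero or equal to
  \<open>f\<close>; connectivity spreads one alternative over all of \<open>T\<close>.\<close>

lemma switching_indecomposable:
  assumes s: switching
  shows "indecomposable G \<epsilon> f"
proof -
  have t: "tight mag T" using s by (simp add: switching_def)
  have "T \<noteq> {}" using conn_nonempty[OF tightD(2)[OF t]] .
  then have nt: "nontrivial_flow G \<epsilon> f" using fl T by (simp add: nontrivial_flow_def)
  have False if g: "nontrivial_flow G \<epsilon> g" and h: "nontrivial_flow G \<epsilon> h"
    and gh: "\<And>e. f e = g e + h e" "\<And>e. g e * h e \<ge> 0" for g h
  proof -
    have gflow: "integral_flow G \<epsilon> g" using g by (simp add: nontrivial_flow_def)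
    have le: "\<bar>g e\<bar> \<le> \<bar>f e\<bar>" and eq: "\<bar>g e\<bar> = \<bar>f e\<bar> \<Longrightarrow> g e = f e" for e
      using gh(1)[of e] gh(2)[of e] by (auto simp: zero_le_mult_iff)
    have g0: "g e = 0" if "e \<notin> T" for e using le[of e] outside_supp[OF that] by simp
    \<comment> \<open>The weighted degree of \<open>g\<close> on the side is even and at most 2. The
      value 0 makes \<open>g\<close> vanish there, and the value 2 forces equality with
      \<open>f\<close> in every term.\<close>
    have side: "(\<forall>e\<in>A. v \<in> ends G e \<longrightarrow> g e = 0) \<or> (\<forall>e\<in>A. v \<in> ends G e \<longrightarrow> g e = f e)"
      if A: "A \<subseteq> T" "V A \<inter> V (T - A) \<subseteq> {v}" "wdeg mag A v = 2" for A v
    proof -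
      let ?g = "\<lambda>e. nat \<bar>g e\<bar>"
      have AG: "A \<subseteq> edges G" using A(1) supp_sub by auto
      have fA: "finite A" by (rule finite_sub[OF AG])
      have ev: "even (wdeg ?g A v)"
        using even_net[OF gflow supp_sub g0 A(1,2)] even_net_iff_wdeg[OF AG] by simp
      have ler: "?g e * hdeg v e \<le> mag e * hdeg v e" for e using le[of e] by (intro mult_right_mono) auto
      have "wdeg ?g A v \<le> 2" unfolding A(3)[symmetric] wdeg_def using ler by (intro sum_mono)
      then consider "wdeg ?g A v = 0" | "wdeg ?g A v = wdeg mag A v" using ev A(3) by (elim evenE) force
      then show ?thesis
      proof cases
        case 1
        then have "\<forall>e\<in>A. ?g e * hdeg v e = 0" unfolding wdeg_def using fA by simp
        then show ?thesis by auto
      next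
        case 2
        have "\<forall>e\<in>A. ?g e * hdeg v e = mag e * hdeg v e"
          using sum_mono_inv[OF 2[unfolded wdeg_def] ler _ fA] by blast
        then have "\<forall>e\<in>A. v \<in> ends G e \<longrightarrow> \<bar>g e\<bar> = \<bar>f e\<bar>" by auto
        then show ?thesis using eq by blast
      qed
    qed
    have vert: "(\<forall>e\<in>T. v \<in> ends G e \<longrightarrow> g e = 0) \<or> (\<forall>e\<in>T. v \<in> ends G e \<longrightarrow> g e = f e)" if v: "v \<in> V T" for v
      using s v
    proof (cases rule: switching_cases)
      case simple
      \<comment> \<open>A simple vertex is treated as a cut with all of \<open>T\<close> on one
        side.\<close>
      then show ?thesis using side[of T v] by simp
    next
      case (split A B)
      note sp = splitD[OF split(1)]
      have AB: "T - A = B" "T - B = A" using sp(1,2) by blast+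
      have AG: "A \<subseteq> edges G" "B \<subseteq> edges G" using sp supp_sub by auto
      have a: "(\<forall>e\<in>A. v \<in> ends G e \<longrightarrow> g e = 0) \<or> (\<forall>e\<in>A. v \<in> ends G e \<longrightarrow> g e = f e)"
        using side[OF sp(6) _ sp(4)] AB sp(3) by simp
      have b: "(\<forall>e\<in>B. v \<in> ends G e \<longrightarrow> g e = 0) \<or> (\<forall>e\<in>B. v \<in> ends G e \<longrightarrow> g e = f e)"
        using side[OF sp(7) _ sp(5)] AB sp(3) by (simp add: Int_commute)
      have zero: "net g X v = 0" if "X \<subseteq> edges G" "\<forall>e\<in>X. v \<in> ends G e \<longrightarrow> g e = 0" for X
        unfolding net_def
      proof (rule sum.neutral, rule ballI)
        fix e assume "e \<in> X"
        then show "inc v e * g e = 0" using that incidence_outside[of e v] by (cases "v \<in> ends G e") auto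
      qed
      have full: "net g X v = net f X v" if "X \<subseteq> edges G" "\<forall>e\<in>X. v \<in> ends G e \<longrightarrow> g e = f e" for X
        unfolding net_def
      proof (rule sum.cong)
        fix e assume "e \<in> X"
        then show "inc v e * g e = inc v e * f e" using that incidence_outside[of e v] by (cases "v \<in> ends G e") auto
      qed simp
      have sum0: "net g A v + net g B v = 0"
        using net_split[OF supp_sub sp(6), of g v] flow_net[OF gflow supp_sub g0, of v] AB by simp
      \<comment> \<open>With nonzero net flow of \<open>f\<close> on both sides, \<open>g\<close>
        cannot vanish on one and equal \<open>f\<close> on the other: its own net flow at
        \<open>v\<close> would not be 0.\<close>
      have nb: "net f B v \<noteq> 0" using net_sides[OF split(1)] split(2) by simp
      from a b show ?thesis
      proof (elim disjE)
        assume "\<forall>e\<in>A. v \<in> ends G e \<longrightarrow> g e = 0" "\<forall>e\<in>B. v \<in> ends G e \<longrightarrow> g e = f e"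
        then show ?thesis using zero[OF AG(1)] full[OF AG(2)] sum0 nb by simp
      next
        assume "\<forall>e\<in>A. v \<in> ends G e \<longrightarrow> g e = f e" "\<forall>e\<in>B. v \<in> ends G e \<longrightarrow> g e = 0"
        then show ?thesis using zero[OF AG(2)] full[OF AG(1)] sum0 split(2) by simp
      qed (use sp(1) in blast)+
    qed
    let ?X = "{e \<in> T. g e = 0}"
    have "?X = T" if "?X \<noteq> {}"
    proof (rule connD_edges[OF tightD(2)[OF t] _ that])
      fix e e' v assume e: "e \<in> ?X" "e' \<in> T" "v \<in> ends G e" "v \<in> ends G e'"
      have "v \<in> V T" using in_vsetI[OF e(2,4)] .
      then show "e' \<in> ?X" using vert[of v] e supp_nonzero[of e] by auto
    qed blast
    then consider "?X = T" | "?X = {}" by blast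
    then show False
    proof cases
      case 1
      then have "supp g = {}" using g0 by (auto simp: supp_def)
      then show False using g by (simp add: nontrivial_flow_def)
    next
      case 2
      have "g e = f e" for e
      proof (cases "e \<in> T")
        case True
        then obtain v where v: "v \<in> ends G e" using ends_nonempty supp_sub by blast
        then have "v \<in> V T" using True in_vsetI by blast
        then show ?thesis using vert[of v] v True 2 by blast
      qed (use g0 outside_supp in simp)
      then have "supp h = {}" using gh(1) by (auto simp: supp_def)
      then show False using h by (simp add: nontrivial_flow_def)
    qed
  qed
  then show ?thesis using nt unfolding indecomposable_def decomposable_def by blast
qed

text \<open>\<open>Z\<close> saturates its side, so both sums run over the same edges at
  \<open>v\<close>.\<close>

lemma net_cycle_split:
  assumes t: "tight mag T" and Z: "is_cycle G Z" "Z \<subseteq> T" "v \<in> V Z" and s: "split mag T v A B" "Z \<subseteq> A"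
  shows "net f Z v = net f A v"
proof -
  have "A \<subseteq> edges G" using splitD(6)[OF s(1)] supp_sub by auto
  from net_local[OF this s(2)] show ?thesis using split_saturated[OF t Z(1) s(2) Z(3) s(1)] by simp
qed

lemma net_cycle_simple:
  assumes t: "tight mag T" and Z: "is_cycle G Z" "Z \<subseteq> T" "v \<notin> V Z \<inter> V (T - Z)"
  shows "net f Z v = 0"
proof (cases "v \<in> V Z")
  case True
  then have "v \<notin> V (T - Z)" using Z(3) by simp
  then have "net f T v = net f Z v" using net_local[OF supp_sub Z(2)] by (auto simp: in_vset)
  then show ?thesis using flow_net_supp by simp
next
  case False
  then show ?thesis using net_outside[of Z v] Z supp_sub by (meson order_trans)
qed

lemma net_cycle_values:
  assumes t: "tight mag T" and Z: "is_cycle G Z" "Z \<subseteq> T"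
  shows "net f Z v = 0 \<or> \<bar>net f Z v\<bar> = 2"
proof (cases "v \<in> V Z")
  case True
  have ZG: "Z \<subseteq> edges G" by (rule cycleD(1)[OF Z(1)])
  have "wdeg mag Z v = 1 * deg Z v" using cycle_weight[OF t Z] by (intro wdeg_const)
  then have w: "wdeg mag Z v = 2" using cycleD(4)[OF Z(1) True] by simp
  then have "even (net f Z v)" using even_net_iff_wdeg[OF ZG] by simp
  moreover have "\<bar>net f Z v\<bar> \<le> 2" using abs_net_le[OF ZG, of f v] w by simp
  ultimately show ?thesis by presburger
next
  case False
  then show ?thesis using net_outside[OF cycleD(1)[OF Z(1)]] by simp
qed

text \<open>The vertices counted are the sources and sinks of \<open>Z\<close> with respect to the
  orientation reversed where \<open>f\<close> is negative; elsewhere the two contributions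
  cancel.\<close>

lemma cycle_sign_switches:
  assumes t: "tight mag T" and Z: "is_cycle G Z" "Z \<subseteq> T"
  shows "cycle_sign G Z = (-1) ^ card {v \<in> verts G. net f Z v \<noteq> 0}"
proof (rule cycle_sign_net[OF cycleD(1)[OF Z(1)] _ net_cycle_values[OF t Z]])
  fix e assume "e \<in> Z"
  then have "nat \<bar>f e\<bar> = 1" by (rule cycle_weight[OF t Z])
  then show "\<bar>f e\<bar> = 1" by simp
qed

lemma sign_iff_parity:
  assumes "s = (-1 :: int) ^ n"
  shows "(s = 1 \<longleftrightarrow> even n) \<and> (s = -1 \<longleftrightarrow> odd n)"
  using assms by (cases "even n") auto

text \<open>When the flow switches sides at every cut vertex, the sources and sinks of a block cycle
  are exactly its intersection vertices, so the sign of the cycle is given by the parity of their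
  number.\<close>

lemma switching_eulerian:
  assumes s: switching
  shows "eulerian_cycle_tree G T"
proof -
  have t: "tight mag T" using s by (simp add: switching_def)
  have "(balanced G Z \<longrightarrow> even (card (V Z \<inter> V (T - Z)))) \<and> (unbalanced G Z \<longrightarrow> odd (card (V Z \<inter> V (T - Z))))"
    if Z: "is_cycle G Z" "Z \<subseteq> T" for Z
  proof -
    have "{v \<in> verts G. net f Z v \<noteq> 0} = V Z \<inter> V (T - Z)"
    proof (intro equalityI subsetI)
      fix v assume "v \<in> {v \<in> verts G. net f Z v \<noteq> 0}"
      then show "v \<in> V Z \<inter> V (T - Z)" using net_cycle_simple[OF t Z, of v] by blast
    next
      fix v assume v: "v \<in> V Z \<inter> V (T - Z)"
      then have vT: "v \<in> V T" using vset_monoD[OF _ Z(2)] by blast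
      have vG: "v \<in> verts G" using vT vset_subset_verts[OF supp_sub] by blast
      obtain A0 B0 where "split mag T v A0 B0" using v cycle_vertex_split_iff[OF t Z, of v] by blast
      then have "wdeg mag T v = 4" using split_wdeg[OF t] by blast
      then obtain A B where AB: "split mag T v A B" "net f A v \<noteq> 0" using s unfolding switching_def by blast
      have "Z \<subseteq> A \<or> Z \<subseteq> B" by (rule cycle_side[OF t Z AB(1)])
      then have "net f Z v = net f A v \<or> net f Z v = net f B v"
        using net_cycle_split[OF t Z _ AB(1)] net_cycle_split[OF t Z, of v B A] AB(1) split_sym v by blast
      then have "net f Z v \<noteq> 0" using AB(2) net_sides[OF AB(1)] by linarith
      then show "v \<in> {v \<in> verts G. net f Z v \<noteq> 0}" using vG by simp
    qed
    then have "cycle_sign G Z = (-1) ^ card (V Z \<inter> V (T - Z))" using cycle_sign_switches[OF t Z] by simp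
    from sign_iff_parity[OF this] show ?thesis by (simp add: balanced_def unbalanced_def)
  qed
  moreover have "cycle_tree G T" by (rule tight_cycle_tree[OF t])
  ultimately show ?thesis unfolding eulerian_cycle_tree_iff by blast
qed

text \<open>By parity, every block cycle carries an even number of cut vertices without net flow from one
  side to the other, so beyond such a vertex there is always another one.\<close>

lemma eulerian_side_net:
  assumes t: "tight mag T" and eul: "eulerian_cycle_tree G T"
  shows "split mag T v A B \<Longrightarrow> net f A v \<noteq> 0"
proof (induction "card A" arbitrary: v A B rule: less_induct)
  case less
  show ?case
  proof
    assume 0: "net f A v = 0"
    note sp = splitD[OF less.prems]
    have AG: "A \<subseteq> edges G" using sp(6) supp_sub by blast
    have fA: "finite A" by (rule finite_sub[OF AG])
    obtain e where e: "e \<in> A" "v \<in> ends G e" using sp(8) by (auto simp: in_vset)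
    have eT: "e \<in> T" using e sp by blast
    show False
    proof (cases "\<exists>Z. is_cycle G Z \<and> Z \<subseteq> T \<and> e \<in> Z")
      case False
      \<comment> \<open>A bridge of weight 2 fills the side by itself, so the net flow there is the
        single term \<open>inc v e * f e\<close>, which is nonzero.\<close>
      then have me: "mag e = 2" using weight_cases[OF t eT] by simp
      have eG: "e \<in> edges G" using eT supp_sub by blast
      have "wdeg mag A v = mag e * hdeg v e + wdeg mag (A - {e}) v"
        using wdeg_insert[OF eG, of "A - {e}" mag v] AG e(1) by (auto simp: insert_absorb)
      then have h: "hdeg v e = 1" "wdeg mag (A - {e}) v = 0" using sp(4) me hdeg_pos[OF e(2)] by auto
      have "\<bar>net f (A - {e}) v\<bar> \<le> 0" using abs_net_le[of "A - {e}" f v] h(2) AG by auto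
      then have "net f A v = inc v e * f e"
        using net_split[OF AG, of "{e}" f v] e(1) by (simp add: net_def)
      moreover have "inc v e \<noteq> 0" using even_incidence[OF eG, of v] h(1) by auto
      ultimately show False using 0 supp_nonzero[OF eT] by simp
    next
      case True
      then obtain Z where Z: "is_cycle G Z" "Z \<subseteq> T" "e \<in> Z" by blast
      have ZA: "Z \<subseteq> A" using cycle_side[OF t Z(1,2) less.prems] e(1) Z(3) sp(2) by blast
      have vZ: "v \<in> V Z" using in_vsetI[OF Z(3) e(2)] .
      \<comment> \<open>\<open>S\<close> consists of the sources and sinks of \<open>Z\<close>,
        \<open>W\<close> of its intersection vertices. Both cardinalities have the parity given by
        the sign of \<open>Z\<close>, so \<open>W - S\<close> has even size and contains a vertex
        besides \<open>v\<close>.\<close>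
      define S where "S = {v \<in> verts G. net f Z v \<noteq> 0}"
      define W where "W = V Z \<inter> V (T - Z)"
      have fW: "finite W" using finite_vset[OF cycleD(1)[OF Z(1)]] by (simp add: W_def)
      have SW: "S \<subseteq> W" unfolding S_def W_def using net_cycle_simple[OF t Z(1,2)] by blast
      have "net f Z v = 0" using net_cycle_split[OF t Z(1,2) vZ less.prems ZA] 0 by simp
      then have vW: "v \<in> W - S" unfolding W_def S_def using cycle_vertex_split_iff[OF t Z(1,2) vZ] less.prems vZ by blast
      have "cycle_sign G Z = (-1) ^ card S" unfolding S_def by (rule cycle_sign_switches[OF t Z(1,2)])
      note par = sign_iff_parity[OF this]
      have "(balanced G Z \<longrightarrow> even (card W)) \<and> (unbalanced G Z \<longrightarrow> odd (card W))"
        using eul Z(1,2) unfolding eulerian_cycle_tree_iff W_def by blast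
      then have "even (card W) \<longleftrightarrow> even (card S)" using par by (auto simp: balanced_def unbalanced_def)
      then have "even (card (W - S))" using card_Diff_subset[OF finite_subset[OF SW fW] SW] card_mono[OF fW SW] by simp
      moreover have "card (W - S) \<noteq> 1 \<or> W - S = {v}" using vW by (metis card_1_singletonE singletonD)
      ultimately have "W - S \<noteq> {v}" by auto
      then obtain w where w: "w \<in> W - S" "w \<noteq> v" using vW by blast
      have wZ: "w \<in> V Z" "w \<in> V (T - Z)" using w by (auto simp: W_def)
      have wG: "w \<in> verts G" using vset_subset_verts[OF cycleD(1)[OF Z(1)]] wZ by blast
      obtain B' A' where s': "split mag T w B' A'" "Z \<subseteq> B'" "Z \<inter> A' = {}"
        using cycle_vertex_split_iff[OF t Z(1,2) wZ(1)] cycle_split_sides[OF t Z(1,2)] wZ(2) by blast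
      have "net f Z w = 0" using w wG by (simp add: S_def)
      then have "net f B' w = 0" using net_cycle_split[OF t Z(1,2) wZ(1) s'(1,2)] by simp
      then have n0: "net f A' w = 0" using net_sides[OF s'(1)] by simp
      have s'': "split mag T w A' B'" using s'(1) split_sym by blast
      have "A' \<subseteq> A"
        using sides_nested[OF tightD(2)[OF t] less.prems s'' vset_monoD[OF vZ s'(2)] vset_monoD[OF wZ(1) ZA]] w(2) by blast
      moreover have "A' \<noteq> A" using s'(3) ZA Z(3) by blast
      ultimately have "card A' < card A" using fA by (simp add: psubset_card_mono psubset_eq)
      from less.hyps[OF this s''] show False using n0 by simp
    qed
  qed
qed

lemma eulerian_switching:
  assumes t: "tight mag T" and eul: "eulerian_cycle_tree G T"
  shows switching
  unfolding switching_def
proof (intro conjI allI impI)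
  fix v assume 4: "wdeg mag T v = 4"
  then have v: "v \<in> V T" using wdeg_outside[of v T mag] by fastforce
  from t v show "\<exists>A B. split mag T v A B \<and> net f A v \<noteq> 0"
  proof (cases rule: tight_vertex)
    case simple
    then show ?thesis using 4 by simp
  next
    case (split A B)
    then show ?thesis using eulerian_side_net[OF t eul] by blast
  qed
qed (rule t)

end

end

end

section \<open>Indecomposable flows are coherent closed walks\<close>

context sgraph
begin

lemma walk_end_unique: "walk G u p v \<Longrightarrow> walk G u p w \<Longrightarrow> v = w"
  using walk_verts_eq[of u p v] walk_verts_eq[of u p w] by simp

lemma starts_split:
  assumes "v \<in> set (starts p)"
  obtains p1 st p2 where "p = p1 @ st # p2" "fst st = v"
proof -
  have "starts p = map fst p" by (auto simp: starts_def)
  then obtain st where "st \<in> set p" "fst st = v" using assms by auto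
  then show ?thesis using that split_list by metis
qed

section \<open>Coherent walks\<close>

context
  fixes T :: "'e set" and g :: "'v \<Rightarrow> 'e \<Rightarrow> int"
  assumes TG: "T \<subseteq> edges G" and sg: "\<forall>e\<in>T. \<forall>v\<in>ends G e. g v e = 1 \<or> g v e = -1"
begin

text \<open>A state \<open>(v, s)\<close> is a vertex together with a direction of passage; consecutive steps of a
  coherent walk carry one arrow into and one arrow out of their common vertex.\<close>

fun coherent :: "'v \<Rightarrow> int \<Rightarrow> ('v, 'e) steps \<Rightarrow> 'v \<Rightarrow> int \<Rightarrow> bool" where
  "coherent u s [] v t \<longleftrightarrow> u \<in> verts G \<and> u = v \<and> s = t"
| "coherent u s ((a, e, b) # p) v t \<longleftrightarrow>
     a = u \<and> e \<in> T \<and> ends G e = {a, b} \<and> s = g a e \<and> coherent b (- g b e) p v t"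

lemma coherent_walk: "coherent u s p v t \<Longrightarrow> walk G u p v \<and> walk_edges p \<subseteq> T"
proof (induction p arbitrary: u s)
  case (Cons st p)
  then show ?case using TG by (cases st) auto
qed auto

lemma coherent_append: "coherent u s (p @ q) v t \<longleftrightarrow> (\<exists>w r. coherent u s p w r \<and> coherent w r q v t)"
proof (induction p arbitrary: u s)
  case Nil
  have "u \<in> verts G" if "coherent u s q v t" using coherent_walk[OF that] walk_verts_in by blast
  then show ?case by auto
next
  case (Cons st p)
  then show ?case by (cases st) auto
qed

lemma coherent_sign:
  assumes "coherent u s p v t" "p \<noteq> []"
  shows "(s = 1 \<or> s = -1) \<and> (t = 1 \<or> t = -1)"
  using assms
proof (induction p arbitrary: u s)
  case (Cons st p)
  obtain a e b where st: "st = (a, e, b)" by (cases st)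
  have e: "e \<in> T" "ends G e = {a, b}" "s = g a e" "coherent b (- g b e) p v t" using Cons.prems st by auto
  have "g a e = 1 \<or> g a e = -1" "g b e = 1 \<or> g b e = -1" using sg e(1,2) by auto
  then show ?case using Cons.IH[OF e(4)] e by (cases "p = []") auto
qed simp

text \<open>The final value \<open>t\<close> is the one with which a further step would have to
  leave \<open>v\<close>. Reversal exchanges arrivals and departures, hence both signs
  change.\<close>

lemma coherent_reverse: "coherent u s p v t \<Longrightarrow> coherent v (- t) (reverse p) u (- s)"
proof (induction p arbitrary: u s)
  case (Cons st p)
  obtain a e b where st: "st = (a, e, b)" by (cases st)
  have e: "a = u" "e \<in> T" "ends G e = {a, b}" "s = g a e" "coherent b (- g b e) p v t" using Cons.prems st by auto
  have "a \<in> verts G" using e TG ends_subset[of e] by auto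
  then have "coherent b (g b e) [(b, e, a)] a (- g a e)" using e by (auto simp: insert_commute)
  then show ?case using Cons.IH[OF e(5)] e st by (auto simp: coherent_append simp del: coherent.simps)
qed simp

text \<open>The states in which the steps depart. A repeated state cuts out a shorter coherent
  closed walk.\<close>

definition states :: "('v, 'e) steps \<Rightarrow> ('v \<times> int) list" where
  "states p = map (\<lambda>(a, e, b). (a, g a e)) p"

lemma coherent_start: "coherent u s (st # p) v t \<Longrightarrow> (case st of (a, e, b) \<Rightarrow> (a, g a e)) = (u, s)"
  by (cases st) auto

text \<open>Telescoping: at an inner passage the arriving and the departing half-edge have opposite
  values, so only the two ends contribute.\<close>

lemma coherent_net:
  "coherent u s p v t \<Longrightarrow>
    (\<Sum>e\<in>T. g x e * int (hdeg x e) * int (cnt p e)) = s * of_bool (x = u) - t * of_bool (x = v)"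
proof (induction p arbitrary: u s)
  case (Cons st p)
  obtain a e b where st: "st = (a, e, b)" by (cases st)
  have e: "a = u" "e \<in> T" "ends G e = {a, b}" "s = g a e" "coherent b (- g b e) p v t" using Cons.prems st by auto
  have fT: "finite T" by (rule finite_sub[OF TG])
  have "(\<Sum>f\<in>T. g x f * int (hdeg x f) * int (cnt (st # p) f)) =
      (\<Sum>f\<in>T. (if f = e then g x e * int (hdeg x e) else 0) + g x f * int (hdeg x f) * int (cnt p f))"
    using st by (intro sum.cong) (auto simp: algebra_simps)
  also have "\<dots> = g x e * int (hdeg x e) + (\<Sum>f\<in>T. g x f * int (hdeg x f) * int (cnt p f))"
    using fT e(2) by (simp add: sum.distrib)
  also have "g x e * int (hdeg x e) = g a e * of_bool (x = a) + g b e * of_bool (x = b)"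
    using hdeg_pair[OF e(3), of x] by (auto simp: algebra_simps)
  finally show ?case using Cons.IH[OF e(5)] e by simp
qed simp

lemma coherent_extend:
  assumes p: "coherent u s p v t" "p \<noteq> []" "(v, t) \<noteq> (u, s)"
    and c: "\<And>x. (\<Sum>e\<in>T. g x e * int (hdeg x e) * int (m e)) = 0"
    and le: "\<And>e. e \<in> T \<Longrightarrow> cnt p e \<le> m e"
  obtains e b where "e \<in> T" "coherent u s (p @ [(v, e, b)]) b (- g b e)" "cnt p e < m e"
proof -
  have st: "s = 1 \<or> s = -1" "t = 1 \<or> t = -1" using coherent_sign[OF p(1,2)] by auto
  have "(\<Sum>e\<in>T. t * (g v e * int (hdeg v e) * (int (m e) - int (cnt p e)))) = t * (0 - (s * of_bool (v = u) - t))"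
    unfolding sum_distrib_left[symmetric] c[of v, symmetric]
    using coherent_net[OF p(1), of v] by (simp add: right_diff_distrib sum_subtractf)
  also have "\<dots> > 0" using st p(3) by auto
  finally have "\<exists>e\<in>T. t * (g v e * int (hdeg v e) * (int (m e) - int (cnt p e))) > 0"
    using sum_nonpos[of T "\<lambda>e. t * (g v e * int (hdeg v e) * (int (m e) - int (cnt p e)))"] not_less by blast
  then obtain e where e: "e \<in> T" "t * (g v e * int (hdeg v e) * (int (m e) - int (cnt p e))) > 0" by blast
  have eG: "e \<in> edges G" using e TG by blast
  show ?thesis
  proof (cases "v \<in> ends G e")
    case True
    obtain b where b: "ends G e = {v, b}" by (rule ends_other[OF eG True])
    have gv: "g v e = 1 \<or> g v e = -1" using sg e(1) True by blast
    have h: "int (hdeg v e) > 0" using hdeg_pos[OF True] by simp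
    define k where "k = int (m e) - int (cnt p e)"
    have tk: "0 < (t * g v e) * (int (hdeg v e) * k)" using e(2) by (simp add: k_def mult.assoc)
    have "k \<ge> 0" using le[OF e(1)] by (simp add: k_def)
    then have "k > 0" using tk by (cases "k = 0") auto
    then have "int (hdeg v e) * k > 0" using h by simp
    then have "t * g v e > 0" using tk by (metis zero_less_mult_pos2)
    then have gt: "g v e = t \<and> cnt p e < m e" using gv st(2) \<open>k > 0\<close> by (auto simp: k_def)
    have "b \<in> verts G" using ends_subset[OF eG] b by auto
    then have "coherent v t [(v, e, b)] b (- g b e)" using b e(1) gt by simp
    then have "coherent u s (p @ [(v, e, b)]) b (- g b e)" unfolding coherent_append using p(1) by blast
    then show ?thesis using that e(1) gt by blast
  next
    case False
    then have "hdeg v e = 0" by simp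
    show ?thesis using e(2) unfolding \<open>hdeg v e = 0\<close> by simp
  qed
qed

lemma coherent_close:
  assumes c: "\<And>x. (\<Sum>e\<in>T. g x e * int (hdeg x e) * int (m e)) = 0"
  shows "coherent u s p v t \<Longrightarrow> p \<noteq> [] \<Longrightarrow> (\<And>e. e \<in> T \<Longrightarrow> cnt p e \<le> m e) \<Longrightarrow>
    \<exists>q. coherent u s (p @ q) u s \<and> (\<forall>e\<in>T. cnt (p @ q) e \<le> m e)"
proof (induction "sum m T - length p" arbitrary: p v t rule: less_induct)
  case less
  show ?case
  proof (cases "(v, t) = (u, s)")
    case True
    then show ?thesis using less.prems by (intro exI[of _ "[]"]) simp
  next
    case False
    obtain e b where e: "e \<in> T" "coherent u s (p @ [(v, e, b)]) b (- g b e)" "cnt p e < m e"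
      by (rule coherent_extend[OF less.prems(1,2) False c less.prems(3)])
    let ?p = "p @ [(v, e, b)]"
    have c': "cnt ?p e' \<le> m e'" if "e' \<in> T" for e' using less.prems(3)[OF that] e(3) by auto
    have sub: "walk_edges ?p \<subseteq> T" using coherent_walk[OF e(2)] by blast
    have "length ?p \<le> sum m T"
      using sum_mono[of T "cnt ?p" m] c' length_eq_sum_cnt[OF sub finite_sub[OF TG]] by simp
    then have "sum m T - length ?p < sum m T - length p" by simp
    from less.hyps[OF this e(2) _ c'] obtain q where
      "coherent u s (?p @ q) u s" "\<forall>e\<in>T. cnt (?p @ q) e \<le> m e" by blast
    then show ?thesis by (intro exI[of _ "(v, e, b) # q"]) simp
  qed
qed

end

section \<open>Closed coherent walks inside an indecomposable flow\<close>

context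
  fixes \<epsilon> g :: "'v \<Rightarrow> 'e \<Rightarrow> int" and f :: "'e \<Rightarrow> int" and T
  assumes ori: "orientation G (edges G) \<epsilon>" and fl: "integral_flow G \<epsilon> f" and T: "T = supp f"
    and g: "g = (\<lambda>v e. \<epsilon> v e * sgn (f e))"
    and ind: "indecomposable G \<epsilon> f" and npl: "\<And>e. e \<in> T \<Longrightarrow> \<not> (is_loop G e \<and> sgn_of G e = 1)"
begin

private abbreviation (input) "m \<equiv> \<lambda>e. nat \<bar>f e\<bar>"

private lemma TG: "T \<subseteq> edges G" and out: "e \<notin> T \<Longrightarrow> f e = 0" and nz: "e \<in> T \<Longrightarrow> f e \<noteq> 0"
  using supp_sub[OF ori fl T] outside_supp[OF ori fl T] supp_nonzero[OF ori fl T] by auto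

private lemma sg: "\<forall>e\<in>T. \<forall>v\<in>ends G e. g v e = 1 \<or> g v e = -1"
proof (intro ballI)
  fix e v assume "e \<in> T" "v \<in> ends G e"
  then show "g v e = 1 \<or> g v e = -1"
    using orientation_ends[OF ori, of e v] TG nz[of e] by (auto simp: g sgn_if)
qed

private lemma inc_g: "e \<in> T \<Longrightarrow> incidence G \<epsilon> x e * sgn (f e) = g x e * int (hdeg x e)"
  using incidence_eq[OF ori, of e x] TG npl[of e] by (auto simp: g)

private lemma balance: "(\<Sum>e\<in>T. g x e * int (hdeg x e) * int (m e)) = 0"
proof -
  have "(\<Sum>e\<in>T. g x e * int (hdeg x e) * int (m e)) = (\<Sum>e\<in>T. incidence G \<epsilon> x e * f e)"
  proof (rule sum.cong)
    fix e assume "e \<in> T"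
    then have "g x e * int (hdeg x e) * int (m e) = incidence G \<epsilon> x e * (sgn (f e) * \<bar>f e\<bar>)"
      using inc_g[of e x] by (simp add: mult.assoc)
    then show "g x e * int (hdeg x e) * int (m e) = incidence G \<epsilon> x e * f e" by (simp only: sgn_mult_abs)
  qed simp
  then show ?thesis using flow_net_supp[OF ori fl T, of x] by (simp add: net_def[OF ori])
qed

text \<open>The edge counts of such a walk, with the signs of \<open>f\<close>, form a flow
  \<open>f1\<close>. Since they do not exceed the magnitude of \<open>f\<close>, the remainder
  \<open>f2\<close> has no sign opposite to \<open>f1\<close>. Indecomposability makes
  \<open>f2\<close> vanish.\<close>

private lemma closed_full:
  assumes p: "coherent T g u s p u s" "p \<noteq> []" "\<And>e. e \<in> T \<Longrightarrow> cnt p e \<le> m e"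
  shows "\<And>e. e \<in> T \<Longrightarrow> cnt p e = m e"
proof -
  define f1 where "f1 = (\<lambda>e. sgn (f e) * int (cnt p e))"
  define f2 where "f2 = (\<lambda>e. f e - f1 e)"
  have sub: "walk_edges p \<subseteq> T" using coherent_walk[OF TG sg p(1)] by blast
  have i1: "integral_flow G \<epsilon> f1" unfolding integral_flow_def
  proof (intro conjI allI impI ballI)
    fix e assume "e \<notin> edges G"
    then have "f e = 0" using TG out by blast
    then show "f1 e = 0" by (simp add: f1_def)
  next
    fix v
    have "(\<Sum>e\<in>edges G. incidence G \<epsilon> v e * f1 e) = (\<Sum>e\<in>T. incidence G \<epsilon> v e * f1 e)"
      using TG finite_edges out by (intro sum.mono_neutral_right) (auto simp: f1_def)
    also have "\<dots> = (\<Sum>e\<in>T. g v e * int (hdeg v e) * int (cnt p e))"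
    proof (rule sum.cong)
      fix e assume "e \<in> T"
      from inc_g[OF this, of v] show "incidence G \<epsilon> v e * f1 e = g v e * int (hdeg v e) * int (cnt p e)"
        unfolding f1_def by (metis mult.assoc)
    qed simp
    also have "\<dots> = 0" using coherent_net[OF TG sg p(1), of v] by simp
    finally show "(\<Sum>e\<in>edges G. incidence G \<epsilon> v e * f1 e) = 0" .
  qed
  have i2: "integral_flow G \<epsilon> f2" unfolding integral_flow_def f2_def
    using fl i1 by (simp add: integral_flow_def right_diff_distrib sum_subtractf)
  obtain e0 where e0: "e0 \<in> walk_edges p" using p(2) walk_edges_eq_empty by blast
  then have "cnt p e0 \<noteq> 0" by (simp add: count_list_0_iff)
  moreover have "f e0 \<noteq> 0" using e0 sub nz by blast
  ultimately have "supp f1 \<noteq> {}" by (auto simp: supp_def f1_def sgn_eq_0_iff)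
  then have n1: "nontrivial_flow G \<epsilon> f1" using i1 by (simp add: nontrivial_flow_def)
  have pos: "f1 e * f2 e \<ge> 0" for e
  proof (cases "e \<in> T")
    case True
    then have "int (cnt p e) \<le> \<bar>f e\<bar>" using p(3)[OF True] by simp
    then have "0 \<le> int (cnt p e) * (\<bar>f e\<bar> - int (cnt p e))" by simp
    also have "\<dots> = f1 e * f2 e" using nz[OF True] by (cases "f e > 0"; cases "f e = 0") (auto simp: f1_def f2_def sgn_if abs_if algebra_simps)
    finally show ?thesis .
  qed (simp add: f1_def out)
  have "f e = f1 e + f2 e" for e by (simp add: f2_def)
  then have "\<not> nontrivial_flow G \<epsilon> f2"
    using ind n1 pos unfolding indecomposable_def decomposable_def by blast
  then have z: "f2 e = 0" for e using i2 by (auto simp: nontrivial_flow_def supp_def)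
  fix e assume e: "e \<in> T"
  have "f e = sgn (f e) * int (cnt p e)" using z[of e] by (simp add: f2_def f1_def)
  then have "\<bar>f e\<bar> = int (cnt p e)" using nz[OF e] by (metis abs_mult abs_of_nat abs_sgn_eq mult_1)
  then show "cnt p e = m e" by simp
qed

private lemma closed_length:
  assumes p: "coherent T g u s p u s" "p \<noteq> []" "\<And>e. e \<in> T \<Longrightarrow> cnt p e \<le> m e"
  shows "length p = sum m T"
proof -
  have "walk_edges p \<subseteq> T" using coherent_walk[OF TG sg p(1)] by blast
  from length_eq_sum_cnt[OF this finite_sub[OF TG]] show ?thesis using closed_full[OF p] by simp
qed

text \<open>The closed subwalk between two equal states would already have the full length
  \<open>sum m T\<close>, although it is a proper part of \<open>p\<close>.\<close>

private lemma closed_states: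
  assumes p: "coherent T g u s p u s" "p \<noteq> []" "\<And>e. e \<in> T \<Longrightarrow> cnt p e \<le> m e"
  shows "distinct (states g p)"
proof (rule ccontr)
  assume "\<not> ?thesis"
  then obtain xs ys zs y where "states g p = xs @ [y] @ ys @ [y] @ zs" using not_distinct_decomp by blast
  then obtain q1 q where 1: "p = q1 @ q" "map (\<lambda>(a, e, b). (a, g a e)) q = y # ys @ y # zs"
    unfolding states_def[OF TG sg] map_eq_append_conv by auto
  then obtain st1 q' where 2: "q = st1 # q'" "(case st1 of (a, e, b) \<Rightarrow> (a, g a e)) = y"
    "map (\<lambda>(a, e, b). (a, g a e)) q' = ys @ y # zs"
    unfolding map_eq_Cons_conv by blast
  then obtain q2 q'' where 3: "q' = q2 @ q''" "map (\<lambda>(a, e, b). (a, g a e)) q'' = y # zs"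
    unfolding map_eq_append_conv by auto
  then obtain st2 q3 where 4: "q'' = st2 # q3" "(case st2 of (a, e, b) \<Rightarrow> (a, g a e)) = y"
    unfolding map_eq_Cons_conv by blast
  have q: "p = q1 @ (st1 # q2) @ (st2 # q3)" using 1 2 3 4 by simp
  note y = 2(2) 4(2)
  obtain w r w' r' where c: "coherent T g u s q1 w r" "coherent T g w r (st1 # q2) w' r'" "coherent T g w' r' (st2 # q3) u s"
    using p(1) unfolding q coherent_append[OF TG sg] by blast
  have "(w', r') = (w, r)" using coherent_start[OF TG sg c(2)] coherent_start[OF TG sg c(3)] y by simp
  then have "coherent T g w r (st1 # q2) w r" using c(2) by simp
  moreover have "cnt (st1 # q2) e \<le> m e" if "e \<in> T" for e
  proof -
    have "cnt (st1 # q2) e \<le> cnt p e" unfolding q by simp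
    then show ?thesis using p(3)[OF that] by (rule le_trans)
  qed
  ultimately have "length (st1 # q2) = sum m T" by (intro closed_length) auto
  then show False using closed_length[OF p] q by simp
qed

private lemma rotate:
  assumes p: "coherent T g u s p u s" and v: "v \<in> set (starts p)"
  obtains \<sigma> st q where "coherent T g v \<sigma> (st # q) v \<sigma>" "\<forall>e. cnt (st # q) e = cnt p e"
    "\<forall>x. count_list (starts (st # q)) x = count_list (starts p) x" "walk_edges (st # q) = walk_edges p"
proof -
  obtain p1 st p2 where q: "p = p1 @ st # p2" "fst st = v" by (rule starts_split[OF v])
  obtain w \<sigma> where c: "coherent T g u s p1 w \<sigma>" "coherent T g w \<sigma> (st # p2) u s"
    using p unfolding q(1) coherent_append[OF TG sg] by blast
  have "w = v" using coherent_start[OF TG sg c(2)] q(2) by (cases st) auto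
  then have "coherent T g v \<sigma> ((st # p2) @ p1) v \<sigma>" unfolding coherent_append[OF TG sg] using c by blast
  then show ?thesis by (intro that[of \<sigma> st "p2 @ p1"]) (auto simp: q(1))
qed

lemma indecomposable_switching: "switching \<epsilon> f T"
proof -
  have "T \<noteq> {}" using ind T by (simp add: indecomposable_def nontrivial_flow_def)
  then obtain e0 where e0: "e0 \<in> T" by blast
  obtain a b where ab: "ends G e0 = {a, b}" "a \<in> verts G" "b \<in> verts G"
    by (rule ends_pair[OF subsetD[OF TG e0]])
  have c0: "coherent T g a (g a e0) [(a, e0, b)] b (- g b e0)" using e0 ab coherent.simps[OF TG sg] by simp
  have "cnt [(a, e0, b)] e \<le> m e" if "e \<in> T" for e
  proof -
    have "1 \<le> m e" using nz[OF that] by linarith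
    then show ?thesis by simp
  qed
  from coherent_close[OF TG sg balance c0 _ this] obtain q where
    p: "coherent T g a (g a e0) ((a, e0, b) # q) a (g a e0)" "\<And>e. e \<in> T \<Longrightarrow> cnt ((a, e0, b) # q) e \<le> m e"
    by auto
  define p where "p = (a, e0, b) # q"
  have p: "coherent T g a (g a e0) p a (g a e0)" "p \<noteq> []" "\<And>e. e \<in> T \<Longrightarrow> cnt p e \<le> m e"
    using p by (simp_all add: p_def)
  have full: "cnt p e = m e" if "e \<in> T" for e by (rule closed_full[OF p that])
  have wp: "walk G a p a" "walk_edges p \<subseteq> T" using coherent_walk[OF TG sg p(1)] by blast+
  have wT: "walk_edges p = T"
  proof (rule subset_antisym[OF wp(2)], rule subsetI)
    fix e assume "e \<in> T"
    then have "cnt p e \<noteq> 0" using full nz by simp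
    then show "e \<in> walk_edges p" by (simp add: count_list_0_iff)
  qed
  have wdT: "wdeg m T x = 2 * count_list (starts p) x" for x
  proof -
    have "wdeg m T x = wdeg (cnt p) T x" by (rule wdeg_cong) (simp add: full)
    then show ?thesis using wdeg_walk_closed[OF wp TG] by simp
  qed
  have cases: "(wdeg m T v = 2 \<and> (\<forall>e\<in>T. v \<in> ends G e \<longrightarrow> m e = 1)) \<or> (\<exists>A B. split m T v A B \<and> net \<epsilon> f A v \<noteq> 0)"
    if v: "v \<in> V T" for v
  proof -
    have vs: "v \<in> set (starts p)" using walk_verts_closed[OF wp(1) p(2)] wT v by simp
    obtain \<sigma> st q where "coherent T g v \<sigma> (st # q) v \<sigma>" "\<forall>e. cnt (st # q) e = cnt p e"
      "\<forall>x. count_list (starts (st # q)) x = count_list (starts p) x" "walk_edges (st # q) = walk_edges p"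
      by (rule rotate[OF p(1) vs])
    note r = this[rule_format]
    have le: "cnt (st # q) e \<le> m e" if "e \<in> T" for e using r(2) p(3)[OF that] by simp
    have dst: "distinct (states g (st # q))" using closed_states[OF r(1) _ le] by simp
    have fst_st: "fst st = v" using coherent_start[OF TG sg r(1)] by (cases st) auto
    show ?thesis
    proof (cases "v \<in> set (starts q)")
      case False
      then have "count_list (starts p) v = 1" using r(3)[of v] fst_st by (simp add: count_list_0_iff)
      then have w2: "wdeg m T v = 2" using wdT by simp
      \<comment> \<open>An edge of larger weight would take up the whole weighted degree 2 with a
        single half-edge, and the flow equation at \<open>v\<close> would consist of one nonzero
        term.\<close>
      have "m e = 1" if e: "e \<in> T" "v \<in> ends G e" for e
      proof (rule ccontr)
        assume "m e \<noteq> 1"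
        then have me: "m e \<ge> 2" using nz[OF e(1)] by linarith
        have eG: "e \<in> edges G" using e TG by blast
        have "wdeg m T v = m e * hdeg v e + wdeg m (T - {e}) v"
          using wdeg_insert[OF eG, of "T - {e}" m v] TG e(1) by (auto simp: insert_absorb)
        moreover have "m e * hdeg v e \<ge> 2 * hdeg v e" using me by simp
        moreover have "hdeg v e \<ge> 1" by (rule hdeg_pos[OF e(2)])
        ultimately have h: "hdeg v e = 1" "wdeg m (T - {e}) v = 0" using w2 by linarith+
        have "\<bar>net \<epsilon> f (T - {e}) v\<bar> \<le> 0" using abs_net_le[OF ori, of "T - {e}" f v] h(2) TG by auto
        then have "net \<epsilon> f T v = incidence G \<epsilon> v e * f e"
          using net_split[OF ori TG, of "{e}" f v] e(1) by (simp add: net_def[OF ori])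
        moreover have "incidence G \<epsilon> v e \<noteq> 0" using even_incidence[OF ori eG, of v] h(1) by auto
        ultimately show False using flow_net_supp[OF ori fl T, of v] nz[OF e(1)] by simp
      qed
      then show ?thesis using w2 by blast
    next
      case True
      obtain q1 st2 q2 where q: "q = q1 @ st2 # q2" "fst st2 = v" by (rule starts_split[OF True])
      define X where "X = st # q1"
      define Y where "Y = st2 # q2"
      have XY: "st # q = X @ Y" by (simp add: X_def Y_def q)
      obtain w \<tau> where c: "coherent T g v \<sigma> X w \<tau>" "coherent T g w \<tau> Y v \<sigma>"
        using r(1) unfolding XY coherent_append[OF TG sg] by blast
      have ne: "X \<noteq> []" "Y \<noteq> []" by (simp_all add: X_def Y_def)
      have wv: "w = v" using coherent_start[OF TG sg c(2)[unfolded Y_def]] q(2) by (cases st2) auto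
      have dXY: "distinct (states g X @ states g Y)" using dst unfolding XY by (simp add: states_def[OF TG sg])
      have stX: "(x, \<rho>) \<in> set (states g Z)" if Z: "coherent T g x \<rho> Z y \<rho>'" "Z \<noteq> []" for x \<rho> Z y \<rho>'
      proof -
        obtain z Z' where zZ: "Z = z # Z'" using Z(2) by (cases Z) auto
        have "(case z of (a, e, b) \<Rightarrow> (a, g a e)) = (x, \<rho>)" using coherent_start[OF TG sg Z(1)[unfolded zZ]] .
        then show ?thesis unfolding zZ states_def[OF TG sg] by simp
      qed
      have "(v, \<sigma>) \<in> set (states g X)" "(v, \<tau>) \<in> set (states g Y)" using stX c ne wv by blast+
      then have "\<sigma> \<noteq> \<tau>" using dXY by auto
      then have tau: "\<tau> = - \<sigma>" using coherent_sign[OF TG sg c(1) ne(1)] by auto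
      have cX: "coherent T g v \<sigma> X v (- \<sigma>)" and cY: "coherent T g v (- \<sigma>) Y v \<sigma>" using c wv tau by simp_all
      have wX: "walk G v X v" "walk_edges X \<subseteq> T" using coherent_walk[OF TG sg cX] by blast+
      have wY: "walk G v Y v" "walk_edges Y \<subseteq> T" using coherent_walk[OF TG sg cY] by blast+
      let ?A = "walk_edges X" and ?B = "walk_edges Y"
      have AB: "?A \<union> ?B = T" using r(4) wT unfolding XY by simp
      have vA: "v \<in> V ?A" and vB: "v \<in> V ?B" using walk_start_in_vset[OF wX(1) ne(1)] walk_start_in_vset[OF wY(1) ne(2)] by auto
      have meet: "x = v" if x: "x \<in> V ?A" "x \<in> V ?B" for x
      proof (rule ccontr)
        assume xv: "x \<noteq> v"
        have "x \<in> set (starts X)" using walk_verts_closed[OF wX(1) ne(1)] x(1) by simp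
        then obtain X1 s1 X2 where X12: "X = X1 @ s1 # X2" "fst s1 = x" by (rule starts_split)
        have "x \<in> set (starts Y)" using walk_verts_closed[OF wY(1) ne(2)] x(2) by simp
        then obtain Y1 s2 Y2 where Y12: "Y = Y1 @ s2 # Y2" "fst s2 = x" by (rule starts_split)
        obtain x1 \<omega> where cx: "coherent T g v \<sigma> X1 x1 \<omega>" "coherent T g x1 \<omega> (s1 # X2) v (- \<sigma>)"
          using cX unfolding X12(1) coherent_append[OF TG sg] by blast
        obtain x2 \<omega>' where cy: "coherent T g v (- \<sigma>) Y1 x2 \<omega>'" "coherent T g x2 \<omega>' (s2 # Y2) v \<sigma>"
          using cY unfolding Y12(1) coherent_append[OF TG sg] by blast
        have xx: "x1 = x" "x2 = x"
          using coherent_start[OF TG sg cx(2)] coherent_start[OF TG sg cy(2)] X12(2) Y12(2) by (cases s1; cases s2; auto)+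
        have "(x, \<omega>) \<in> set (states g (s1 # X2))" "(x, \<omega>') \<in> set (states g (s2 # Y2))"
          using stX[OF cx(2)] stX[OF cy(2)] xx by simp_all
        then have "(x, \<omega>) \<in> set (states g X)" "(x, \<omega>') \<in> set (states g Y)"
          unfolding X12(1) Y12(1) by (auto simp: states_def[OF TG sg])
        then have "\<omega> \<noteq> \<omega>'" using dXY by auto
        then have om: "\<omega>' = - \<omega>" using coherent_sign[OF TG sg cx(2)] coherent_sign[OF TG sg cy(2)] by auto
        \<comment> \<open>\<open>X1\<close> leads from the state \<open>(v, \<sigma>)\<close> to
          \<open>(x, \<omega>)\<close>. The part \<open>Y1\<close> leads from
          \<open>(v, - \<sigma>)\<close> to \<open>(x, - \<omega>)\<close>, so run backwards it
          leads from \<open>(x, \<omega>)\<close> to \<open>(v, \<sigma>)\<close>. The two together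
          close up and are shorter than the tour.\<close>
        have "coherent T g x \<omega> (reverse Y1) v \<sigma>" using coherent_reverse[OF TG sg cy(1)] om xx by simp
        then have "coherent T g v \<sigma> (X1 @ reverse Y1) v \<sigma>" unfolding coherent_append[OF TG sg] using cx(1) xx by blast
        moreover have "X1 \<noteq> []" using cx(1) xx xv coherent.simps(1)[OF TG sg] by auto
        moreover have "cnt (X1 @ reverse Y1) e \<le> m e" if "e \<in> T" for e
        proof -
          have "cnt (X1 @ reverse Y1) e \<le> cnt (st # q) e" unfolding XY X12(1) Y12(1) by simp
          then show ?thesis using le[OF that] by simp
        qed
        ultimately have "length (X1 @ reverse Y1) = sum m T" by (intro closed_length) auto
        moreover have "length (st # q) = sum m T" using closed_length[OF r(1) _ le] by simp
        then have "length (X @ Y) = sum m T" using XY by simp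
        ultimately show False unfolding X12(1) Y12(1) by simp
      qed
      \<comment> \<open>By \<open>meet\<close>, a common edge could only be a loop at
        \<open>v\<close>. Both parts would then depart along it in the same state.\<close>
      have disj: "?A \<inter> ?B = {}"
      proof (rule ccontr)
        assume "?A \<inter> ?B \<noteq> {}"
        then obtain e where e: "e \<in> ?A" "e \<in> ?B" by blast
        then have "\<And>x. x \<in> ends G e \<Longrightarrow> x = v" using meet in_vsetI by blast
        have st_e: "(v, g v e) \<in> set (states g Z)" if Z: "coherent T g v \<rho> Z v \<rho>'" "e \<in> walk_edges Z" for Z \<rho> \<rho>'
        proof -
          obtain a' b' where s: "(a', e, b') \<in> set Z" using Z(2) by (auto simp: walk_edges_def)
          then obtain Z1 Z2 where "Z = Z1 @ (a', e, b') # Z2" using split_list by metis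
          then have "ends G e = {a', b'}" using Z(1) by (auto simp: coherent_append[OF TG sg] coherent.simps[OF TG sg])
          then have "a' = v" using \<open>\<And>x. x \<in> ends G e \<Longrightarrow> x = v\<close> by auto
          then show ?thesis using s unfolding states_def[OF TG sg] by force
        qed
        show False using st_e[OF cX e(1)] st_e[OF cY e(2)] dXY by auto
      qed
      have cntX: "m e = cnt X e" if "e \<in> ?A" for e
      proof -
        have "cnt Y e = 0" using that disj by (auto simp: count_list_0_iff)
        then have "cnt X e = cnt (st # q) e" unfolding XY by simp
        then show ?thesis using r(2) full[of e] that AB by auto
      qed
      have cntY: "m e = cnt Y e" if "e \<in> ?B" for e
      proof -
        have "cnt X e = 0" using that disj by (auto simp: count_list_0_iff)
        then have "cnt Y e = cnt (st # q) e" unfolding XY by simp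
        then show ?thesis using r(2) full[of e] that AB by auto
      qed
      have AG: "?A \<subseteq> edges G" "?B \<subseteq> edges G" using wX(2) wY(2) TG by auto
      have wdA: "wdeg m ?A v = 2 * count_list (starts X) v"
        using wdeg_cong[of ?A v m "cnt X"] cntX wdeg_walk_closed[OF wX(1) order_refl AG(1), of v] by simp
      have wdB: "wdeg m ?B v = 2 * count_list (starts Y) v"
        using wdeg_cong[of ?B v m "cnt Y"] cntY wdeg_walk_closed[OF wY(1) order_refl AG(2), of v] by simp
      \<comment> \<open>Only two states exist at \<open>v\<close>, one departing in each part; any
        further visit would repeat one of them.\<close>
      have two: "count_list (starts Z) v = 1" if Z: "coherent T g v \<rho> Z v (- \<rho>)" "Z \<noteq> []" "distinct (states g Z)"
        "(v, - \<rho>) \<notin> set (states g Z)" for Z \<rho>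
      proof -
        obtain z Z' where zZ: "Z = z # Z'" using Z(2) by (cases Z) auto
        have "(case z of (a, e, b) \<Rightarrow> (a, g a e)) = (v, \<rho>)" using coherent_start[OF TG sg Z(1)[unfolded zZ]] .
        then have z: "fst z = v" "(v, \<rho>) \<notin> set (states g Z')"
          using Z(3) unfolding zZ states_def[OF TG sg] by (auto split: prod.splits)
        have rho: "\<rho> = 1 \<or> \<rho> = -1" using coherent_sign[OF TG sg Z(1,2)] by auto
        have "v \<notin> set (starts Z')"
        proof
          assume "v \<in> set (starts Z')"
          then obtain Z1 s' Z2 where s': "Z' = Z1 @ s' # Z2" "fst s' = v" by (rule starts_split)
          obtain a' e' b' where s'': "s' = (a', e', b')" by (cases s')
          have "Z = (z # Z1) @ s' # Z2" using zZ s'(1) by simp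
          then obtain w r where "coherent T g w r (s' # Z2) v (- \<rho>)"
            using Z(1) coherent_append[OF TG sg] by metis
          then have "e' \<in> T" "v \<in> ends G e'" using s'(2) s'' by (auto simp: coherent.simps[OF TG sg])
          then have "g v e' = \<rho> \<or> g v e' = - \<rho>" using sg rho by fastforce
          moreover have "(v, g v e') \<in> set (states g Z')" using s' s'' unfolding states_def[OF TG sg] by force
          moreover have "set (states g Z') \<subseteq> set (states g Z)" unfolding zZ states_def[OF TG sg]
            by (simp only: list.map list.set subset_insertI)
          ultimately show False using z(2) Z(4) by auto
        qed
        then show ?thesis using z(1) by (simp add: zZ count_list_0_iff)
      qed
      have "(v, - \<sigma>) \<in> set (states g Y)" "(v, \<sigma>) \<in> set (states g X)" using stX[OF cY ne(2)] stX[OF cX ne(1)] .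
      then have ns: "(v, - \<sigma>) \<notin> set (states g X)" "(v, \<sigma>) \<notin> set (states g Y)" using dXY by auto
      have cX1: "count_list (starts X) v = 1" using two[OF cX ne(1) _ ns(1)] dXY by simp
      have cY1: "count_list (starts Y) v = 1" using two[of "- \<sigma>" Y] cY ne(2) ns(2) dXY by simp
      have "V ?A \<inter> V ?B = {v}" using meet vA vB by blast
      then have "split m T v ?A ?B" unfolding split_def
        using AB disj wdA wdB cX1 cY1 by simp
      moreover have "net \<epsilon> f ?A v \<noteq> 0"
      proof -
        have "net \<epsilon> f ?A v = (\<Sum>e\<in>?A. g v e * int (hdeg v e) * int (cnt X e))"
          unfolding net_def[OF ori]
        proof (rule sum.cong)
          fix e assume e: "e \<in> ?A"
          then have eT: "e \<in> T" using wX(2) by blast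
          have "int (cnt X e) = \<bar>f e\<bar>" using cntX[OF e] by simp
          then have "g v e * int (hdeg v e) * int (cnt X e) = incidence G \<epsilon> v e * (sgn (f e) * \<bar>f e\<bar>)"
            using inc_g[OF eT, of v] by (metis mult.assoc)
          then show "incidence G \<epsilon> v e * f e = g v e * int (hdeg v e) * int (cnt X e)" by (simp only: sgn_mult_abs)
        qed simp
        also have "\<dots> = (\<Sum>e\<in>T. g v e * int (hdeg v e) * int (cnt X e))"
          using wX(2) finite_sub[OF TG] by (intro sum.mono_neutral_left) (auto simp: count_list_0_iff)
        \<comment> \<open>\<open>X\<close> departs from \<open>v\<close> with the value
          \<open>\<sigma>\<close> and ends with \<open>- \<sigma>\<close>, so its two contributions
          at \<open>v\<close> add up.\<close>
        also have "\<dots> = \<sigma> + \<sigma>" using coherent_net[OF TG sg cX, of v] by simp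
        finally show ?thesis using coherent_sign[OF TG sg cX ne(1)] by auto
      qed
      ultimately show ?thesis by blast
    qed
  qed
  have "tight m T" unfolding tight_def
  proof (intro conjI ballI)
    show "conn T" using conn_walk[OF wp(1) p(2)] wT by simp
    show "m e > 0" if "e \<in> T" for e using nz[OF that] by simp
    show "(wdeg m T v = 2 \<and> (\<forall>e\<in>T. v \<in> ends G e \<longrightarrow> m e = 1)) \<or> (\<exists>A B. split m T v A B)"
      if "v \<in> V T" for v using cases[OF that] by blast
  qed (rule TG)
  moreover have "\<exists>A B. split m T v A B \<and> net \<epsilon> f A v \<noteq> 0" if "wdeg m T v = 4" for v
  proof -
    have "v \<in> V T" using that wdeg_outside[of v T m] by fastforce
    then show ?thesis using cases[of v] that by simp
  qed
  ultimately show ?thesis by (simp add: switching_def[OF ori fl T])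
qed

end

text \<open>A positive loop in the support is a summand of the flow by itself.\<close>

lemma positive_loop_switching:
  assumes ori: "orientation G (edges G) \<epsilon>" and fl: "integral_flow G \<epsilon> f" and ind: "indecomposable G \<epsilon> f"
    and e: "e \<in> supp f" "is_loop G e" "sgn_of G e = 1"
  shows "switching \<epsilon> f (supp f)"
proof -
  have eG: "e \<in> edges G" using supp_sub[OF ori fl refl] e(1) by blast
  have fe: "f e \<noteq> 0" using e(1) by (simp add: supp_def)
  define h where "h = (\<lambda>x. if x = e then sgn (f e) else 0)"
  define k where "k = (\<lambda>x. f x - h x)"
  have ih: "integral_flow G \<epsilon> h" unfolding integral_flow_def
  proof (intro conjI allI impI ballI)
    show "h x = 0" if "x \<notin> edges G" for x using that eG by (auto simp: h_def)
    show "(\<Sum>x\<in>edges G. incidence G \<epsilon> v x * h x) = 0" for v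
      by (rule sum.neutral) (simp add: h_def incidence_positive_loop[OF ori e(2,3)])
  qed
  have ik: "integral_flow G \<epsilon> k"
    using fl ih unfolding integral_flow_def k_def by (simp add: right_diff_distrib sum_subtractf)
  have nh: "nontrivial_flow G \<epsilon> h" using ih fe by (auto simp: nontrivial_flow_def supp_def h_def sgn_eq_0_iff)
  have "h x * k x \<ge> 0" for x using fe by (auto simp: h_def k_def sgn_if)
  moreover have "f x = h x + k x" for x by (simp add: k_def)
  ultimately have "\<not> nontrivial_flow G \<epsilon> k"
    using ind nh unfolding indecomposable_def decomposable_def by blast
  then have fh: "f x = h x" for x using ik by (auto simp: nontrivial_flow_def supp_def k_def)
  have T: "supp f = {e}" unfolding supp_def fh using fe by (auto simp: h_def sgn_eq_0_iff)
  have "h e = 1 \<or> h e = -1" using fe by (simp add: h_def sgn_if)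
  then have "\<bar>f e\<bar> = 1" unfolding fh[symmetric] by auto
  moreover obtain v where v: "ends G e = {v}" using e(2) unfolding is_loop_def by (rule card_1_singletonE)
  ultimately have w: "wdeg (\<lambda>e. nat \<bar>f e\<bar>) {e} x = (if x = v then 2 else 0)" for x
    using e(2) by (simp add: wdeg_def hdeg_def)
  have "tight (\<lambda>e. nat \<bar>f e\<bar>) {e}"
    unfolding tight_def using eG w v \<open>\<bar>f e\<bar> = 1\<close> by (auto simp: conn_def subset_singleton_iff)
  moreover have "wdeg (\<lambda>e. nat \<bar>f e\<bar>) {e} x \<noteq> 4" for x using w[of x] by simp
  ultimately have "switching \<epsilon> f {e}" unfolding switching_def[OF ori fl T[symmetric]] by blast
  then show ?thesis by (simp only: T)
qed

lemma coupling_reorient: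
  assumes "orientation G (edges G) \<epsilon>" "e \<in> edges G"
  shows "coupling G (edges G) \<epsilon> (edges G) (reorient \<epsilon> f) e = (if f e < 0 then -1 else 1)"
proof -
  have "(SOME v. v \<in> ends G e) \<in> ends G e" using ends_nonempty[OF assms(2)] some_in_eq by blast
  then have "\<epsilon> (SOME v. v \<in> ends G e) e = 1 \<or> \<epsilon> (SOME v. v \<in> ends G e) e = -1"
    using orientation_ends[OF assms] by blast
  then show ?thesis using assms(2) by (auto simp: coupling_def reorient_def Let_def)
qed

text \<open>The coupling is the sign of \<open>f\<close>, with value 1 where \<open>f\<close> is 0.
  So the equation says that the absolute value of \<open>f\<close> is the indicator of
  \<open>T\<close>; in particular \<open>T\<close> is the support.\<close>

theorem indecomposable_iff:
  assumes ori: "orientation G (edges G) \<epsilon>" and fl: "integral_flow G \<epsilon> f"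
  shows "indecomposable G \<epsilon> f \<longleftrightarrow> (\<exists>T. eulerian_cycle_tree G T \<and>
           (\<forall>e. f e = coupling G (edges G) \<epsilon> (edges G) (reorient \<epsilon> f) e * tree_indicator G T e))"
proof
  assume ind: "indecomposable G \<epsilon> f"
  have sw: "switching \<epsilon> f (supp f)"
  proof (cases "\<exists>e\<in>supp f. is_loop G e \<and> sgn_of G e = 1")
    case True
    then show ?thesis using positive_loop_switching[OF ori fl ind] by blast
  next
    case False
    then show ?thesis using indecomposable_switching[OF ori fl refl refl ind] by blast
  qed
  then have t: "tight (\<lambda>e. nat \<bar>f e\<bar>) (supp f)" by (simp add: switching_def[OF ori fl refl])
  have "f e = coupling G (edges G) \<epsilon> (edges G) (reorient \<epsilon> f) e * tree_indicator G (supp f) e" for e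
  proof (cases "e \<in> supp f")
    case True
    then have "e \<in> edges G" using supp_sub[OF ori fl refl] by blast
    moreover have "int (ind (supp f) e) = \<bar>f e\<bar>" using tight_weight[OF t True] by simp
    ultimately show ?thesis
      using coupling_reorient[OF ori, of e f] tree_indicator_eq[OF tight_cycle_tree[OF t], of e] True by simp
  next
    case False
    then show ?thesis using tree_indicator_eq[OF tight_cycle_tree[OF t], of e] by (simp add: supp_def)
  qed
  then show "\<exists>T. eulerian_cycle_tree G T \<and>
      (\<forall>e. f e = coupling G (edges G) \<epsilon> (edges G) (reorient \<epsilon> f) e * tree_indicator G T e)"
    using switching_eulerian[OF ori fl refl sw] by blast
next
  assume "\<exists>T. eulerian_cycle_tree G T \<and>
      (\<forall>e. f e = coupling G (edges G) \<epsilon> (edges G) (reorient \<epsilon> f) e * tree_indicator G T e)"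
  then obtain T where eul: "eulerian_cycle_tree G T"
    and f: "\<And>e. f e = coupling G (edges G) \<epsilon> (edges G) (reorient \<epsilon> f) e * tree_indicator G T e" by blast
  have ct: "cycle_tree G T" using eul eulerian_cycle_tree_iff by blast
  have t: "tight (ind T) T" using ct cycle_tree_iff by blast
  have TG: "T \<subseteq> edges G" by (rule tightD(1)[OF t])
  have abs: "\<bar>f e\<bar> = (if e \<in> T then int (ind T e) else 0)" for e
  proof (cases "e \<in> edges G")
    case True
    have "\<bar>coupling G (edges G) \<epsilon> (edges G) (reorient \<epsilon> f) e\<bar> = 1"
      using coupling_reorient[OF ori True, of f] by simp
    then have "\<bar>f e\<bar> = \<bar>tree_indicator G T e\<bar>" using f[of e] by (metis abs_mult mult_1)
    then show ?thesis using tree_indicator_eq[OF ct, of e] by simp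
  next
    case False
    then show ?thesis using fl TG by (auto simp: integral_flow_def)
  qed
  have T: "T = supp f"
  proof (intro equalityI subsetI)
    fix e assume "e \<in> T"
    then have "\<bar>f e\<bar> > 0" using abs[of e] ind_pos[of T e] by simp
    then show "e \<in> supp f" by (simp add: supp_def)
  next
    fix e assume "e \<in> supp f"
    then have "\<bar>f e\<bar> \<noteq> 0" by (simp add: supp_def)
    then show "e \<in> T" using abs[of e] by (simp split: if_splits)
  qed
  have t': "tight (\<lambda>e. nat \<bar>f e\<bar>) T" by (rule tight_cong[OF t]) (simp add: abs)
  show "indecomposable G \<epsilon> f"
    by (rule switching_indecomposable[OF ori fl T eulerian_switching[OF ori fl T t' eul]])
qed

end

section \<open>Minimum covering closed walks\<close>

lemma two_visits:
  fixes n a b :: nat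
  assumes "n = 2 * (a + b)" "n \<le> 4" "a \<ge> 1" "b \<ge> 1"
  shows "a = 1" "b = 1" "n = 4"
  using assms by presburger+

context sgraph
begin

definition tour :: "('e \<Rightarrow> nat) \<Rightarrow> 'e set \<Rightarrow> 'v \<Rightarrow> ('v, 'e) steps \<Rightarrow> bool" where
  "tour m T u W \<longleftrightarrow> walk G u W u \<and> walk_edges W = T \<and> (\<forall>e\<in>T. cnt W e = m e)"

lemma tour_rotate:
  assumes "tour m T u (p @ q)"
  shows "\<exists>v. tour m T v (q @ p) \<and> walk G v q u \<and> walk G u p v"
proof -
  obtain v where v: "walk G u p v" "walk G v q u" using assms by (auto simp: tour_def walk_append)
  then have "walk G v (q @ p) v" by (auto simp: walk_append)
  then show ?thesis using assms v by (intro exI[of _ v]) (auto simp: tour_def add.commute)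
qed

lemma wdeg_tour:
  assumes "T \<subseteq> edges G" "tour m T u W"
  shows "wdeg m T x = 2 * count_list (starts W) x"
proof -
  have W: "walk G u W u" "walk_edges W \<subseteq> T" "\<And>e. e \<in> T \<Longrightarrow> cnt W e = m e" using assms(2) by (auto simp: tour_def)
  have "wdeg m T x = wdeg (cnt W) T x" by (rule wdeg_cong) (simp add: W(3))
  then show ?thesis using wdeg_walk_closed[OF W(1,2) assms(1)] by simp
qed

section \<open>Tours of a tight weight and end-block cycles\<close>

context
  fixes m T assumes t: "tight m T"
begin

text \<open>An edge on no cycle is a bridge. The handshake lemma on one side shows that a closed
  walk crosses it an even number of times, hence at least twice.\<close>

lemma cnt_covering_ge:
  assumes W: "walk G u W u" "walk_edges W = T" and e: "e \<in> T"
  shows "m e \<le> cnt W e"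
proof (cases "\<exists>C. is_cycle G C \<and> C \<subseteq> T \<and> e \<in> C")
  case True
  then have "m e = 1" using weight_cases[OF t e] by simp
  moreover have "cnt W e \<noteq> 0" using e W(2) by (simp add: count_list_0_iff)
  ultimately show ?thesis by simp
next
  case False
  then have nc: "\<And>C. is_cycle G C \<Longrightarrow> C \<subseteq> T \<Longrightarrow> e \<notin> C" by blast
  have TG: "T \<subseteq> edges G" by (rule tightD(1)[OF t])
  obtain x where x: "x \<in> ends G e" using ends_nonempty[of e] TG e by blast
  obtain y A B where b: "ends G e = {x, y}" "x \<noteq> y" "T = insert e (A \<union> B)" "e \<notin> A" "e \<notin> B" "A \<inter> B = {}"
    "V A \<inter> V B = {}" "y \<notin> V A" "x \<notin> V B" "m e = 2"
    by (rule bridge_split[OF t e x nc])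
  have G: "e \<in> edges G" "A \<subseteq> edges G" "insert e A \<subseteq> edges G" using b(3) TG by auto
  have "even (wdeg (cnt W) (insert e A) y)"
  proof (rule even_wdeg[OF G(3)])
    fix w assume w: "w \<in> V (insert e A)" "w \<noteq> y"
    then have "w \<notin> V B" using b by auto
    then have "wdeg (cnt W) T w = wdeg (cnt W) (insert e A) w"
      by (intro wdeg_local[OF TG]) (use b(3) in_vsetI in auto)
    then show "even (wdeg (cnt W) (insert e A) w)"
      using wdeg_walk_closed[OF W(1) _ TG, of w] W(2) by (metis dvd_triv_left order_refl)
  qed
  moreover have "hdeg y e = 1" using hdeg_pair[OF b(1)] b(2) by auto
  ultimately have "even (cnt W e)" using wdeg_insert[OF G(1,2) b(4), of "cnt W" y] wdeg_outside[OF b(8)] by simp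
  moreover have "cnt W e \<noteq> 0" using e W(2) by (simp add: count_list_0_iff)
  then have "cnt W e > 0" by simp
  ultimately have "2 \<le> cnt W e" by (rule dvd_imp_le)
  then show ?thesis using b(10) by simp
qed

text \<open>The Euler walk for the weight \<open>m\<close> has length \<open>sum m T\<close>. A
  minimum walk is no longer, but uses every edge at least \<open>m e\<close> times, so all these
  bounds are attained.\<close>

lemma min_covering_tour:
  assumes "min_covering_closed_walk G T W"
  shows "\<exists>u. tour m T u W"
proof -
  have TG: "T \<subseteq> edges G" by (rule tightD(1)[OF t])
  have fT: "finite T" by (rule finite_sub[OF TG])
  obtain u where u: "walk G u W u" and WT: "walk_edges W = T"
    and mn: "\<And>W'. covering_closed_walk G T W' \<Longrightarrow> length W \<le> length W'"
    using assms unfolding min_covering_closed_walk_def covering_closed_walk_def by blast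
  obtain v p where p: "walk G v p v" "walk_edges p = T" "\<And>e. e \<in> T \<Longrightarrow> cnt p e = m e"
    using eulerian_walk[OF TG tightD(2)[OF t] even_wdeg_tight[OF t] tightD(3)[OF t]] by metis
  have "covering_closed_walk G T p" using p(1,2) by (auto simp: covering_closed_walk_def)
  then have "length W \<le> length p" by (rule mn)
  also have "length p = sum m T" using length_eq_sum_cnt[of p T] p fT by simp
  finally have "sum (cnt W) T \<le> sum m T" using length_eq_sum_cnt[of W T] WT fT by simp
  moreover have "sum m T \<le> sum (cnt W) T" using cnt_covering_ge[OF u WT] by (rule sum_mono)
  ultimately have eq: "sum m T = sum (cnt W) T" by simp
  have "m e = cnt W e" if "e \<in> T" for e
    by (rule sum_mono_inv[OF eq cnt_covering_ge[OF u WT] that fT])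
  then show ?thesis using u WT by (auto simp: tour_def)
qed

text \<open>Both closed parts visit \<open>x\<close>, and the weighted degree is at most 4, so each
  visits it once and therefore stays on one side. As they cover \<open>T\<close> together, each is a
  whole side.\<close>

lemma closed_subwalk_side:
  assumes W: "tour m T x (p @ q)" "walk G x p x" "p \<noteq> []" "q \<noteq> []"
  shows "\<exists>A B. split m T x A B \<and> walk_edges p = A"
proof -
  have TG: "T \<subseteq> edges G" by (rule tightD(1)[OF t])
  have pq: "walk_edges p \<union> walk_edges q = T" using W(1) by (simp add: tour_def)
  obtain w where w: "walk G x p w" "walk G w q x" using W(1) by (auto simp: tour_def walk_append)
  have q: "walk G x q x" using w walk_end_unique[OF W(2) w(1)] by simp
  have pos: "count_list (starts r) x \<ge> 1" if "walk G x r x" "r \<noteq> []" for r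
    using walk_start[OF that] that(2) by (cases r) auto
  have w: "wdeg m T x = 2 * (count_list (starts p) x + count_list (starts q) x)"
    using wdeg_tour[OF TG W(1), of x] by simp
  note one = two_visits[OF w wdeg_le_4[OF t] pos[OF W(2,3)] pos[OF q W(4)]]
  have "x \<in> V T" using one(3) wdeg_outside[of x T m] by fastforce
  with t obtain A B where s: "split m T x A B"
    by (cases rule: tight_vertex) (use one(3) in auto)
  note sp = splitD[OF s]
  have side: "walk_edges r \<subseteq> A \<or> walk_edges r \<subseteq> B" if "walk G x r x" "r \<noteq> []" "count_list (starts r) x = 1" "walk_edges r \<subseteq> T" for r
    by (rule closed_walk_one_side[OF that(1,2)]) (use that sp in auto)
  have ne: "A \<noteq> {}" "B \<noteq> {}" using sp(8,9) by auto
  have "walk_edges p \<subseteq> A \<or> walk_edges p \<subseteq> B" "walk_edges q \<subseteq> A \<or> walk_edges q \<subseteq> B"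
    using side[OF W(2,3) one(1)] side[OF q W(4) one(2)] pq by auto
  then have "walk_edges p = A \<or> walk_edges p = B" using pq sp(1,2) ne by blast
  then show ?thesis using s split_sym by blast
qed

definition end_block :: "'e set \<Rightarrow> bool" where
  "end_block C \<longleftrightarrow> is_cycle G C \<and> C \<subseteq> T \<and> (\<exists>v. V C \<inter> V (T - C) = {v})"

lemma end_blockD:
  assumes "end_block C"
  shows "is_cycle G C" "C \<subseteq> T" "\<And>x y. x \<in> V C \<Longrightarrow> x \<in> V (T - C) \<Longrightarrow> y \<in> V C \<Longrightarrow> y \<in> V (T - C) \<Longrightarrow> x = y"
    "card (V C \<inter> V (T - C)) = 1"
proof -
  obtain v where v: "is_cycle G C" "C \<subseteq> T" "V C \<inter> V (T - C) = {v}" using assms by (auto simp: end_block_def)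
  then show "is_cycle G C" "C \<subseteq> T" "card (V C \<inter> V (T - C)) = 1" by simp_all
  show "x = y" if "x \<in> V C" "x \<in> V (T - C)" "y \<in> V C" "y \<in> V (T - C)" for x y
    using v(3) that by (metis IntI singletonD)
qed

lemma end_blocks_disjoint: "end_block C \<Longrightarrow> end_block D \<Longrightarrow> e \<in> C \<Longrightarrow> e \<in> D \<Longrightarrow> C = D"
  using cycles_eq[OF t] end_blockD(1,2) by metis

lemma two_end_blocks:
  assumes "split m T x A B"
  obtains C D where "end_block C" "end_block D" "C \<noteq> D"
proof -
  note sp = splitD[OF assms]
  obtain C where C: "is_cycle G C" "C \<subseteq> A" "\<exists>v. V C \<inter> V (T - C) = {v}"
    using side_contains_end_block[OF t assms] by blast
  obtain D where D: "is_cycle G D" "D \<subseteq> B" "\<exists>v. V D \<inter> V (T - D) = {v}"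
    using side_contains_end_block[OF t split_sym[THEN iffD1, OF assms]] by blast
  have "C \<noteq> D" using C(2) D(2) sp(2) cycleD(3)[OF C(1)] by blast
  then show ?thesis using that C D sp unfolding end_block_def by blast
qed

lemma no_split_cycle:
  assumes "\<And>x A B. \<not> split m T x A B"
  shows "is_cycle G T"
  unfolding is_cycle_iff
proof (intro conjI ballI)
  show "T \<subseteq> edges G" "conn T" using tightD[OF t] by auto
  fix x assume x: "x \<in> V T"
  from t x show "deg T x = 2"
  proof (cases rule: tight_vertex)
    case simple
    then show ?thesis using wdeg_cong[of T x m "\<lambda>_. 1"] by simp
  qed (use assms in blast)
qed

lemma tight_has_cycle: "\<exists>C. is_cycle G C \<and> C \<subseteq> T"
proof (cases "\<exists>x A B. split m T x A B")
  case True
  then obtain x A B where "split m T x A B" by blast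
  then show ?thesis by (rule two_end_blocks) (auto simp: end_block_def)
next
  case False
  then show ?thesis using no_split_cycle by blast
qed

text \<open>A tour that enters an end-block cycle traverses it completely, since it can only be left
  where it was entered and each of its edges is used once.\<close>

lemma tour_end_block:
  assumes W: "tour m T u (s # q)" and C: "end_block C" and s: "fst (snd s) \<in> C"
    and l: "fst (snd (last (s # q))) \<notin> C"
  shows "\<exists>c r. s # q = c @ r \<and> cycle_walk G u c \<and> walk_edges c = C \<and> r \<noteq> [] \<and> fst (snd (hd r)) \<notin> C"
proof -
  have TG: "T \<subseteq> edges G" by (rule tightD(1)[OF t])
  let ?P = "\<lambda>s. fst (snd s) \<in> C"
  define c where "c = takeWhile ?P (s # q)"
  define r where "r = dropWhile ?P (s # q)"
  have cr: "s # q = c @ r" by (simp only: c_def r_def takeWhile_dropWhile_id)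
  have cne: "c \<noteq> []" using s by (simp add: c_def)
  have cC: "walk_edges c \<subseteq> C"
    unfolding walk_edges_def c_def by (auto dest!: set_takeWhileD)
  have rne: "r \<noteq> []"
  proof
    assume "r = []"
    then have "\<forall>x\<in>set (s # q). ?P x" by (simp only: r_def dropWhile_eq_Nil_conv)
    then show False using l last_in_set[of "s # q"] by blast
  qed
  have hr: "fst (snd (hd r)) \<notin> C" using hd_dropWhile[of ?P "s # q"] rne by (simp add: r_def)
  obtain v where v: "walk G u c v" "walk G v r u" using W unfolding tour_def cr walk_append by blast
  have WT: "walk_edges c \<union> walk_edges r = T" using W unfolding tour_def cr by simp
  have uC: "u \<in> V C" "v \<in> V C" using walk_start_in_vset[OF v(1) cne] vset_monoD[OF _ cC] by blast+
  have vT: "v \<in> V (T - C)"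
  proof -
    obtain h r' where r: "r = h # r'" using rne by (cases r) auto
    obtain a e b where h: "h = (a, e, b)" by (cases h)
    have "v \<in> ends G e" "e \<in> T" "e \<notin> C" using v(2) r h hr WT by auto
    then show ?thesis using in_vsetI[of e "T - C" v] by blast
  qed
  have uT: "u \<in> V (T - C)"
  proof -
    obtain h r' where r: "r = r' @ [h]" using rne by (metis append_butlast_last_id)
    obtain a e b where h: "h = (a, e, b)" by (cases h)
    have "last (s # q) = h" unfolding cr r by simp
    then have "e \<notin> C" using l h by simp
    moreover have "u \<in> ends G e" "e \<in> T" using v(2) WT r h by (auto simp: walk_append)
    ultimately show ?thesis using in_vsetI[of e "T - C" u] by blast
  qed
  have "v = u" using end_blockD(3)[OF C uC(2) vT uC(1) uT] .
  then have wc: "walk G u c u" using v(1) by simp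
  have cG: "walk_edges c \<subseteq> edges G" by (rule walk_edges_sub[OF wc])
  have C1: "m e = 1" if "e \<in> C" for e using cycle_weight[OF t end_blockD(1,2)[OF C] that] .
  have cle: "cnt c e \<le> 1" if "e \<in> C" for e
  proof -
    have "cnt (s # q) e = m e" using W subsetD[OF end_blockD(2)[OF C] that] unfolding tour_def by blast
    then show ?thesis unfolding cr C1[OF that] by simp
  qed
  have c1: "cnt c e = 1" if "e \<in> walk_edges c" for e
  proof -
    have "cnt c e \<noteq> 0" using that by (simp add: count_list_0_iff)
    moreover have "cnt c e \<le> 1" using cle that cC by blast
    ultimately show ?thesis by linarith
  qed
  have dist_e: "distinct (elist c)" by (rule distinct_if_count_list) (simp add: c1)
  have degc: "deg (walk_edges c) x = 2 * count_list (starts c) x" for x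
    using wdeg_walk_closed[OF wc order_refl cG, of x] deg_distinct[OF dist_e] by simp
  have full: "deg (walk_edges c) x = 2 \<and> deg (C - walk_edges c) x = 0" if x: "x \<in> V (walk_edges c)" for x
  proof -
    have "x \<in> set (starts c)" using walk_verts_closed[OF wc cne] x by simp
    then have "count_list (starts c) x \<noteq> 0" by (simp add: count_list_0_iff)
    moreover have "deg C x = 2" using cycleD(4)[OF end_blockD(1)[OF C]] vset_monoD[OF x cC] by blast
    moreover have "deg C x = deg (walk_edges c) x + deg (C - walk_edges c) x"
      using wdeg_split[OF cycleD(1)[OF end_blockD(1)[OF C]] cC] .
    ultimately show ?thesis using degc[of x] by linarith
  qed
  have "walk_edges c = C"
  \<comment> \<open>The closed walk \<open>c\<close> has degree 2 at each of its vertices, which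
    leaves no degree there for another edge of \<open>C\<close>.\<close>
  proof (rule connD_edges[OF cycleD(2)[OF end_blockD(1)[OF C]] cC])
    fix e e' x assume e: "e \<in> walk_edges c" "e' \<in> C" "x \<in> ends G e" "x \<in> ends G e'"
    show "e' \<in> walk_edges c"
    proof (rule ccontr)
      assume "e' \<notin> walk_edges c"
      then have "1 * hdeg x e' \<le> deg (C - walk_edges c) x"
        using wdeg_ge[of "C - walk_edges c" e' "\<lambda>_. 1" x] e(2) end_blockD(2)[OF C] TG by blast
      then show False using full[OF in_vsetI[OF e(1,3)]] hdeg_pos[OF e(4)] by linarith
    qed
  qed (use cne in simp)
  moreover have "distinct (starts c)"
  proof (rule distinct_if_count_list)
    fix x assume "x \<in> set (starts c)"
    then have "x \<in> V (walk_edges c)" using walk_verts_closed[OF wc cne] by simp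
    then show "count_list (starts c) x = 1" using full degc[of x] by simp
  qed
  ultimately show ?thesis using cr wc cne dist_e rne hr
    by - (rule exI[of _ c], rule exI[of _ r], simp add: cycle_walk_iff)
qed

definition blocks :: "(('v, 'e) steps \<times> ('v, 'e) steps) list \<Rightarrow> bool" where
  "blocks bs \<longleftrightarrow> (\<forall>(c, p)\<in>set bs. end_block (walk_edges c) \<and> (\<exists>x. cycle_walk G x c) \<and>
     (\<forall>C. end_block C \<longrightarrow> walk_edges p \<inter> C = {}))"

abbreviation flat :: "(('v, 'e) steps \<times> ('v, 'e) steps) list \<Rightarrow> ('v, 'e) steps" where
  "flat bs \<equiv> concat (map (\<lambda>(c, p). c @ p) bs)"

text \<open>\<open>W\<close> starts inside \<open>C0\<close> and ends outside of it, so that no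
  traversal of an end-block cycle is cut by the ends of the list. The induction is over suffixes
  that begin where such a cycle is entered; \<open>pre\<close> is kept because
  \<open>tour_end_block\<close> needs a whole tour, rotated to start with the suffix.\<close>

lemma tour_blocks:
  assumes C0: "end_block C0" and h0: "fst (snd (hd W)) \<in> C0" and l0: "fst (snd (last W)) \<notin> C0"
    and W: "tour m T u W"
  shows "W = pre @ suf \<Longrightarrow> suf = [] \<or> (\<exists>C. end_block C \<and> fst (snd (hd suf)) \<in> C \<and> (pre \<noteq> [] \<longrightarrow> fst (snd (last pre)) \<notin> C)) \<Longrightarrow>
    \<exists>bs. suf = flat bs \<and> blocks bs"
proof (induction "length suf" arbitrary: pre suf rule: less_induct)
  case less
  show ?case
  proof (cases "suf = []")
    case True
    then show ?thesis by (intro exI[of _ "[]"]) (simp add: blocks_def)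
  next
    case False
    then obtain C where C: "end_block C" "fst (snd (hd suf)) \<in> C" "pre \<noteq> [] \<longrightarrow> fst (snd (last pre)) \<notin> C"
      using less.prems(2) by blast
    obtain s q where sq: "suf = s # q" using False by (cases suf) auto
    obtain v where rot: "tour m T v (suf @ pre)" using tour_rotate[of m T u pre suf] W less.prems(1) by blast
    have lst: "fst (snd (last (suf @ pre))) \<notin> C"
    proof (cases "pre = []")
      case True
      then have "C = C0" using end_blocks_disjoint[OF C(1) C0 C(2)] h0 less.prems(1) by simp
      then show ?thesis using l0 less.prems(1) True by simp
    qed (use C(3) in simp)
    have "\<exists>c r. s # (q @ pre) = c @ r \<and> cycle_walk G v c \<and> walk_edges c = C \<and> r \<noteq> [] \<and> fst (snd (hd r)) \<notin> C"
      by (rule tour_end_block[OF _ C(1)]) (use rot lst C(2) sq in auto)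
    then obtain c r where cr: "suf @ pre = c @ r" "cycle_walk G v c" "walk_edges c = C" "r \<noteq> []" "fst (snd (hd r)) \<notin> C"
      unfolding sq by auto
    have cne: "c \<noteq> []" using cr(2) by (simp add: cycle_walk_iff)
    have "\<exists>r'. suf = c @ r' \<and> (r' \<noteq> [] \<longrightarrow> fst (snd (hd r')) \<notin> C)"
    proof -
      from cr(1) obtain us where "suf = c @ us \<and> us @ pre = r \<or> suf @ us = c \<and> pre = us @ r"
        using append_eq_append_conv2[of suf pre c r] by blast
      then show ?thesis
      proof
        assume us: "suf = c @ us \<and> us @ pre = r"
        then show ?thesis using cr(5) by (intro exI[of _ us]) (auto simp: hd_append)
      next
        assume us: "suf @ us = c \<and> pre = us @ r"
        \<comment> \<open>Otherwise the traversal of \<open>C\<close> would run past the end of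
          \<open>W\<close> into its beginning; then \<open>C = C0\<close>, and the last step of
          \<open>W\<close> would lie in \<open>C0\<close>.\<close>
        have "us = []"
        proof (rule ccontr)
          assume usne: "us \<noteq> []"
          have ws: "walk_edges suf \<union> walk_edges us = C" using us cr(3) by auto
          have "hd W = hd us" using less.prems(1) us usne by simp
          moreover have "fst (snd (hd us)) \<in> walk_edges us" using usne by (cases us) auto
          ultimately have "C = C0" using end_blocks_disjoint[OF C(1) C0 _ h0] ws by auto
          moreover have "last W = last suf" using less.prems(1) False by simp
          moreover have "fst (snd (last suf)) \<in> walk_edges suf" using False
            by (metis append_butlast_last_id insertI1 walk_edges_simps(2,3) UnI2)
          ultimately show False using l0 ws by auto
        qed
        then show ?thesis using us by (intro exI[of _ "[]"]) auto
      qed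
    qed
    then obtain r' where r': "suf = c @ r'" "r' \<noteq> [] \<longrightarrow> fst (snd (hd r')) \<notin> C" by blast
    let ?N = "\<lambda>s. \<forall>C. end_block C \<longrightarrow> fst (snd s) \<notin> C"
    define p where "p = takeWhile ?N r'"
    define suf' where "suf' = dropWhile ?N r'"
    have ps: "r' = p @ suf'" by (simp only: p_def suf'_def takeWhile_dropWhile_id)
    have pN: "?N x" if "x \<in> set p" for x using that set_takeWhileD[of x ?N r'] unfolding p_def by blast
    have pE: "\<forall>C. end_block C \<longrightarrow> walk_edges p \<inter> C = {}"
      using pN by (fastforce simp: walk_edges_def)
    have "length suf' < length suf" using r'(1) ps cne by simp
    moreover have "W = (pre @ c @ p) @ suf'" using less.prems(1) r'(1) ps by simp
    moreover have "suf' = [] \<or> (\<exists>C. end_block C \<and> fst (snd (hd suf')) \<in> C \<and>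
        (pre @ c @ p \<noteq> [] \<longrightarrow> fst (snd (last (pre @ c @ p))) \<notin> C))"
    proof (cases "suf' = []")
      case False
      then have "\<not> ?N (hd suf')" unfolding suf'_def by (rule hd_dropWhile)
      then obtain D where D: "end_block D" "fst (snd (hd suf')) \<in> D" by blast
      have "fst (snd (last (pre @ c @ p))) \<notin> D"
      proof (cases "p = []")
        case True
        have "fst (snd (last c)) \<in> C" using cr(3) cne
          by (metis append_butlast_last_id insertI1 walk_edges_simps(2,3) UnI2)
        moreover have "D \<noteq> C" using D(2) r'(2) ps True False by auto
        ultimately show ?thesis using end_blocks_disjoint[OF C(1) D(1)] True cne by auto
      next
        case pne: False
        then have "last (pre @ c @ p) = last p" by simp
        then show ?thesis using pN[of "last p"] pne D(1) by simp
      qed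
      then show ?thesis using D by blast
    qed simp
    ultimately obtain bs where bs: "suf' = flat bs" "blocks bs" using less.hyps[of suf' "pre @ c @ p"] by blast
    have "suf = flat ((c, p) # bs)" using r'(1) ps bs(1) by simp
    moreover have "blocks ((c, p) # bs)" using bs(2) C(1) cr(2,3) pE unfolding blocks_def by auto
    ultimately show ?thesis by blast
  qed
qed

end

section \<open>Two disjoint cycles joined by a path, and criteria for circuits\<close>

lemma conn_Un:
  assumes A: "conn A" and B: "conn B" and AB: "V A \<inter> V B \<noteq> {}"
  shows "conn (A \<union> B)"
  unfolding conn_def
proof (intro conjI allI impI)
  show "A \<union> B \<noteq> {}" using conn_nonempty[OF A] by simp
  fix X assume X: "X \<subseteq> A \<union> B" "X \<noteq> {}" "V X \<inter> V (A \<union> B - X) = {}"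
  have in_X: "Y \<subseteq> X" if Y: "conn Y" "Y \<subseteq> A \<union> B" "X \<inter> Y \<noteq> {}" for Y
  proof -
    have "V (X \<inter> Y) \<inter> V (Y - X \<inter> Y) \<subseteq> V X \<inter> V (A \<union> B - X)"
      using vset_mono[of "X \<inter> Y" X] vset_mono[of "Y - X \<inter> Y" "A \<union> B - X"] Y(2) by blast
    then have "X \<inter> Y = Y" using connD[OF Y(1), of "X \<inter> Y"] Y(3) X(3) by blast
    then show ?thesis by blast
  qed
  have other: "X \<inter> Z \<noteq> {}" if Y: "Y \<subseteq> X" "Z \<subseteq> A \<union> B" "V Y \<inter> V Z \<noteq> {}" for Y Z
  proof
    assume "X \<inter> Z = {}"
    then have "Z \<subseteq> A \<union> B - X" using Y(2) by blast
    then show False using vset_mono[OF Y(1)] vset_mono[of Z "A \<union> B - X"] X(3) Y(3) by blast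
  qed
  have BA: "V B \<inter> V A \<noteq> {}" using AB by (simp add: Int_commute)
  have "X \<inter> A \<noteq> {} \<or> X \<inter> B \<noteq> {}" using X(1,2) by blast
  then have "A \<subseteq> X \<and> B \<subseteq> X"
  proof
    assume "X \<inter> A \<noteq> {}"
    then have "A \<subseteq> X" using in_X[OF A] by simp
    moreover from other[OF this _ AB] have "B \<subseteq> X" using in_X[OF B] by simp
    ultimately show ?thesis ..
  next
    assume "X \<inter> B \<noteq> {}"
    then have "B \<subseteq> X" using in_X[OF B] by simp
    moreover from other[OF this _ BA] have "A \<subseteq> X" using in_X[OF A] by simp
    ultimately show ?thesis by simp
  qed
  then show "X = A \<union> B" using X(1) by blast
qed

context
  fixes a b :: 'v and p C D
  assumes C: "is_cycle G C" and D: "is_cycle G D" and p: "simple_path G a p b" "p \<noteq> []"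
    and CD: "V C \<inter> V D = {}" and Ca: "V C \<inter> set (walk_verts a p) = {a}" and Db: "V D \<inter> set (walk_verts a p) = {b}"
begin

private abbreviation "P \<equiv> walk_edges p"
private abbreviation "X \<equiv> C \<union> P \<union> D"
private abbreviation (input) "w \<equiv> \<lambda>e. if e \<in> P then 2 else (1 :: nat)"

private lemma path_walk: "walk G a p b" and path_edges_sub: "P \<subseteq> edges G"
  and path_vset: "set (walk_verts a p) = V P" and a_P: "a \<in> V P" and b_P: "b \<in> V P" and a_b: "a \<noteq> b"
proof -
  show w: "walk G a p b" using p by (simp add: simple_path_def)
  show "P \<subseteq> edges G" by (rule walk_edges_sub[OF w])
  show "a \<in> V P" "b \<in> V P" using walk_start_in_vset[OF w p(2)] by auto
  then show "set (walk_verts a p) = V P" using set_walk_verts[OF w] by auto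
  show "a \<noteq> b" by (rule simple_path_ends_neq[OF p])
qed

private lemma cycle_path_disjoint:
  assumes "is_cycle G Z" "V Z \<inter> V P = {x}" "deg P x = 1"
  shows "Z \<inter> P = {}"
proof (rule ccontr)
  assume "Z \<inter> P \<noteq> {}"
  then obtain e where e: "e \<in> Z" "e \<in> P" by blast
  have eG: "e \<in> edges G" using e(2) path_edges_sub by blast
  have sub: "ends G e \<subseteq> {x}" unfolding assms(2)[symmetric] using e in_vsetI by blast
  then have "ends G e = {x, x}" using ends_nonempty[OF eG] by blast
  then have "hdeg x e = 2" using hdeg_pair[of e x x x] by simp
  moreover have "1 * hdeg x e \<le> deg P x" by (rule wdeg_ge[OF path_edges_sub e(2)])
  ultimately show False using assms(3) by simp
qed

private lemma disjoint_parts: "C \<inter> P = {}" "D \<inter> P = {}" "C \<inter> D = {}"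
proof -
  have "deg P a = 1" "deg P b = 1" using simple_path_deg[OF p, of a] simple_path_deg[OF p, of b] a_P b_P a_b by auto
  then show "C \<inter> P = {}" "D \<inter> P = {}"
    using cycle_path_disjoint[OF C] cycle_path_disjoint[OF D] Ca Db unfolding path_vset by blast+
  show "C \<inter> D = {}"
  proof (rule ccontr)
    assume "C \<inter> D \<noteq> {}"
    then obtain e where e: "e \<in> C" "e \<in> D" by blast
    obtain x where "x \<in> ends G e" using ends_nonempty[of e] cycleD(1)[OF C] e(1) by blast
    then show False using CD in_vsetI e by blast
  qed
qed

private lemma dumbbell_cycle_wdeg:
  assumes "is_cycle G Z" "Z \<inter> P = {}" "x \<in> V Z"
  shows "wdeg w Z x = 2"
proof -
  have "wdeg w Z x = 1 * deg Z x" by (rule wdeg_const) (use assms(2) in auto)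
  then show ?thesis using cycleD(4)[OF assms(1,3)] by simp
qed

text \<open>Cutting the path at \<open>z\<close> separates \<open>C\<close> with the first part from
  \<open>D\<close> with the second part. At an end of the path one part is empty, and the cycle
  there provides the weighted degree 2 instead.\<close>

private lemma dumbbell_path_split:
  assumes z: "z \<in> V P"
  shows "\<exists>A B. split w X z A B"
proof -
  obtain p1 p2 where p12: "p = p1 @ p2" "walk G a p1 z" "walk G z p2 b"
    using walk_split_at[OF path_walk, of z] z path_vset by metis
  have dv: "distinct (starts p1 @ starts p2 @ [b])"
    using p(1) walk_verts_eq[OF path_walk] p12(1) by (simp add: simple_path_def)
  have v1: "walk_verts a p1 = starts p1 @ [z]" and v2: "walk_verts z p2 = starts p2 @ [b]"
    using walk_verts_eq p12 by blast+
  have z2: "z \<in> set (starts p2 @ [b])" unfolding v2[symmetric] by (simp add: walk_verts_def)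
  have s1: "simple_path G a p1 z" unfolding simple_path_def v1 using p12(2) dv z2 by auto
  have s2: "simple_path G z p2 b" unfolding simple_path_def v2 using p12(3) dv by auto
  let ?P1 = "walk_edges p1" and ?P2 = "walk_edges p2"
  have P12: "P = ?P1 \<union> ?P2" using p12(1) by simp
  have PP: "?P1 \<inter> ?P2 = {}" using simple_path_distinct_edges[OF p(1)] p12(1) by simp
  have V1: "V ?P1 \<subseteq> set (starts p1) \<union> {z}" using set_walk_verts[OF p12(2)] v1 by auto
  have V2: "V ?P2 \<subseteq> set (starts p2) \<union> {b}" using set_walk_verts[OF p12(3)] v2 by auto
  have a1: "a \<in> set (starts p1)" if "p1 \<noteq> []" using walk_start[OF p12(2) that] that by (metis hd_in_set starts_simps(5))
  have za: "p1 = [] \<Longrightarrow> z = a" and zb: "p2 = [] \<Longrightarrow> z = b" using p12(2,3) by auto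
  have za': "z \<noteq> a" if "p1 \<noteq> []" using a1[OF that] z2 dv by auto
  have zb': "z \<noteq> b" if "p2 \<noteq> []" using walk_start[OF p12(3) that] that dv by (cases "starts p2") auto
  have CP: "V C \<inter> V P = {a}" and DP: "V D \<inter> V P = {b}" using Ca Db path_vset by simp_all
  have VP12: "V ?P1 \<subseteq> V P" "V ?P2 \<subseteq> V P" using P12 by (simp_all add: vset_mono)
  let ?A = "C \<union> ?P1" and ?B = "?P2 \<union> D"
  have meet: "x = z" if x: "x \<in> V ?A" "x \<in> V ?B" for x
  proof -
    have "x \<in> V C \<or> x \<in> V ?P1" "x \<in> V ?P2 \<or> x \<in> V D" using x by auto
    then consider "x \<in> V C" "x \<in> V D" | "x \<in> V C" "x \<in> V ?P2" | "x \<in> V ?P1" "x \<in> V D" | "x \<in> V ?P1" "x \<in> V ?P2"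
      by blast
    then show ?thesis
    proof cases
      case 1
      then show ?thesis using CD by blast
    next
      case 2
      then have xa: "x = a" using CP VP12 by blast
      then have "p1 = []" using a1 2(2) V2 dv by auto
      then show ?thesis using xa za by simp
    next
      case 3
      then have "x = b" using DP VP12 by blast
      then show ?thesis using 3(1) V1 dv by auto
    next
      case 4
      then show ?thesis using V1 V2 dv by auto
    qed
  qed
  have CG: "C \<subseteq> edges G" and DG: "D \<subseteq> edges G" using cycleD(1) C D by auto
  have PG: "?P1 \<subseteq> edges G" "?P2 \<subseteq> edges G" using P12 path_edges_sub by auto
  have w1: "wdeg w ?P1 z = 2 * deg ?P1 z" by (rule wdeg_const) (simp add: P12)
  have w2: "wdeg w ?P2 z = 2 * deg ?P2 z" by (rule wdeg_const) (simp add: P12)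
  have wA: "z \<in> V ?A \<and> wdeg w ?A z = 2"
  proof (cases "p1 = []")
    case True
    then show ?thesis using za Ca dumbbell_cycle_wdeg[OF C disjoint_parts(1), of z] by auto
  next
    case False
    have zP: "z \<in> V ?P1" using walk_start_in_vset[OF p12(2) False] by simp
    then have "z \<notin> V C" using CP VP12 za'[OF False] by blast
    then have "wdeg w C z = 0" by (rule wdeg_outside)
    moreover have "deg ?P1 z = 1" using simple_path_deg[OF s1 False, of z] zP za'[OF False] by simp
    moreover have "C \<inter> ?P1 = {}" using disjoint_parts(1) P12 by blast
    ultimately show ?thesis using zP w1 wdeg_Un[OF CG PG(1), of w z] by simp
  qed
  have wB: "z \<in> V ?B \<and> wdeg w ?B z = 2"
  proof (cases "p2 = []")
    case True
    then show ?thesis using zb Db dumbbell_cycle_wdeg[OF D disjoint_parts(2), of z] by auto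
  next
    case False
    have zP: "z \<in> V ?P2" using walk_start_in_vset[OF p12(3) False] by simp
    then have "z \<notin> V D" using DP VP12 zb'[OF False] by blast
    then have "wdeg w D z = 0" by (rule wdeg_outside)
    moreover have "deg ?P2 z = 1" using simple_path_deg[OF s2 False, of z] zP zb'[OF False] by simp
    moreover have "?P2 \<inter> D = {}" using disjoint_parts(2) P12 by blast
    ultimately show ?thesis using zP w2 wdeg_Un[OF PG(2) DG, of w z] by simp
  qed
  have "?A \<union> ?B = X" using P12 by auto
  moreover have "?A \<inter> ?B = {}" using PP P12 disjoint_parts by auto
  moreover have "V ?A \<inter> V ?B = {z}" using meet wA wB by blast
  ultimately show ?thesis unfolding split_def using wA wB by blast
qed

text \<open>With this weight the general theory yields that the union is a cycle-tree, that it has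
  no further cycles, and what its indicator is.\<close>

lemma dumbbell_tight: "tight w X"
  unfolding tight_def
proof (intro conjI ballI)
  show XG: "X \<subseteq> edges G" using cycleD(1)[OF C] cycleD(1)[OF D] path_edges_sub by auto
  have "V C \<inter> V P \<noteq> {}" using Ca path_vset by auto
  then have "conn (C \<union> P)" by (rule conn_Un[OF cycleD(2)[OF C] conn_walk[OF path_walk p(2)]])
  moreover have "V (C \<union> P) \<inter> V D \<noteq> {}" using Db path_vset by auto
  ultimately show "conn X" by (rule conn_Un[OF _ cycleD(2)[OF D]])
  show "w e > 0" for e by simp
  fix z assume z: "z \<in> V X"
  have cyc: "wdeg w X z = 2 \<and> (\<forall>e\<in>X. z \<in> ends G e \<longrightarrow> w e = 1)"
    if Z: "is_cycle G Z" "Z \<inter> P = {}" "Z \<subseteq> X" "z \<in> V Z" "z \<notin> V P" "z \<notin> V (X - P - Z)" for Z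
  proof -
    have loc: "e \<in> Z" if e: "e \<in> X" "z \<in> ends G e" for e
    proof (rule ccontr)
      assume "e \<notin> Z"
      moreover have "e \<notin> P" using Z(5) in_vsetI[OF _ e(2)] by blast
      ultimately have out: "e \<in> X - P - Z" using e(1) by simp
      show False using Z(6) in_vsetI[OF out e(2)] by (rule notE)
    qed
    then have "wdeg w X z = wdeg w Z z" by (intro wdeg_local[OF XG Z(3)])
    then show ?thesis using dumbbell_cycle_wdeg[OF Z(1,2,4)] loc Z(2) by auto
  qed
  show "(wdeg w X z = 2 \<and> (\<forall>e\<in>X. z \<in> ends G e \<longrightarrow> w e = 1)) \<or> (\<exists>A B. split w X z A B)"
  proof (cases "z \<in> V P")
    case True
    then show ?thesis using dumbbell_path_split by blast
  next
    case False
    then have "z \<in> V C \<or> z \<in> V D" using z by auto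
    then show ?thesis
    proof
      assume zC: "z \<in> V C"
      have "X - P - C \<subseteq> D" by blast
      then have "z \<notin> V (X - P - C)" using CD zC vset_monoD by blast
      then show ?thesis using cyc[OF C disjoint_parts(1) _ zC False] by blast
    next
      assume zD: "z \<in> V D"
      have "X - P - D \<subseteq> C" by blast
      then have "z \<notin> V (X - P - D)" using CD zD vset_monoD by blast
      then show ?thesis using cyc[OF D disjoint_parts(2) _ zD False] by blast
    qed
  qed
qed

text \<open>Edges of a cycle have weight 1, so they lie in \<open>C\<close> or \<open>D\<close>, and
  cycles with a common edge coincide.\<close>

lemma dumbbell_cycles:
  assumes "is_cycle G Z" "Z \<subseteq> X"
  shows "Z = C \<or> Z = D"
proof -
  obtain e where e: "e \<in> Z" using cycleD(3)[OF assms(1)] by blast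
  have "w e = 1" by (rule cycle_weight[OF dumbbell_tight assms e])
  then have "e \<in> C \<or> e \<in> D" using e assms(2) by (auto split: if_splits)
  then show ?thesis
    using cycles_eq[OF dumbbell_tight assms C _ e] cycles_eq[OF dumbbell_tight assms D _ e] by blast
qed

lemma dumbbell_indicator:
  "tree_indicator G X e = of_bool (e \<in> C) + of_bool (e \<in> D) + 2 * of_bool (e \<in> P)"
proof (cases "e \<in> X")
  case True
  then have "tree_indicator G X e = int (w e)"
    using tree_indicator_eq[OF tight_cycle_tree[OF dumbbell_tight], of e] tight_weight[OF dumbbell_tight True] by simp
  then show ?thesis using True disjoint_parts by auto
qed (use tree_indicator_eq[OF tight_cycle_tree[OF dumbbell_tight], of e] in auto)

lemma dumbbell_eulerian:
  assumes "unbalanced G C" "unbalanced G D"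
  shows "eulerian_cycle_tree G X"
proof -
  have CP: "V C \<inter> V P = {a}" and DP: "V D \<inter> V P = {b}" using Ca Db path_vset by simp_all
  have "X - C = P \<union> D" "X - D = C \<union> P" using disjoint_parts by auto
  then have "V C \<inter> V (X - C) = {a}" "V D \<inter> V (X - D) = {b}" using CP DP CD by auto
  then have "(balanced G Z \<longrightarrow> even (card (V Z \<inter> V (X - Z)))) \<and> (unbalanced G Z \<longrightarrow> odd (card (V Z \<inter> V (X - Z))))"
    if "is_cycle G Z" "Z \<subseteq> X" for Z
    using dumbbell_cycles[OF that] assms by (auto simp: balanced_def unbalanced_def)
  then show ?thesis unfolding eulerian_cycle_tree_iff using tight_cycle_tree[OF dumbbell_tight] by blast
qed

end

text \<open>An Eulerian cycle-tree \<open>S\<close> inside \<open>T\<close> contains a cycle. It is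
  unbalanced, so it has an odd number of intersection vertices and at least one. The split there
  gives two end-block cycles, which must be \<open>C\<close> and \<open>D\<close>; by
  \<open>spanning_eq\<close>, \<open>S\<close> is then all of \<open>T\<close>.\<close>

lemma two_unbalanced_cycles_circuit:
  assumes T: "eulerian_cycle_tree G T" and cyc: "\<And>Z. is_cycle G Z \<Longrightarrow> Z \<subseteq> T \<Longrightarrow> Z = C \<or> Z = D"
    and unb: "unbalanced G C" "unbalanced G D"
  shows "circuit G T"
  unfolding circuit_def
proof (intro conjI allI impI notI)
  fix S assume S: "S \<subset> T" "eulerian_cycle_tree G S"
  have tS: "tight (ind S) S" and tT: "tight (ind T) T"
    using S(2) T cycle_tree_iff eulerian_cycle_tree_iff by blast+
  have ST: "S \<subseteq> T" using S(1) by blast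
  obtain Z where Z: "is_cycle G Z" "Z \<subseteq> S" using tight_has_cycle[OF tS] by blast
  have "unbalanced G Z" using cyc[OF Z(1)] Z(2) ST unb by blast
  then have "odd (card (V Z \<inter> V (S - Z)))" using S(2) Z unfolding eulerian_cycle_tree_iff by blast
  then have "V Z \<inter> V (S - Z) \<noteq> {}" by auto
  then obtain v where v: "v \<in> V Z" "v \<in> V (S - Z)" by blast
  then obtain A B where "split (ind S) S v A B" using cycle_vertex_split_iff[OF tS Z v(1)] by blast
  then obtain C' D' where CD: "end_block S C'" "end_block S D'" "C' \<noteq> D'" by (rule two_end_blocks[OF tS])
  have c: "is_cycle G C'" "C' \<subseteq> S" "is_cycle G D'" "D' \<subseteq> S" using CD unfolding end_block_def[OF tS] by auto
  have c': "C' = C \<or> C' = D" "D' = C \<or> D' = D" using cyc[OF c(1)] cyc[OF c(3)] c(2,4) ST by blast+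
  have "Z' \<subseteq> S" if "is_cycle G Z'" "Z' \<subseteq> T" for Z'
    using cyc[OF that] c' CD(3) c(2,4) by blast
  then have "S = T" by (rule spanning_eq[OF tT ST tightD(2)[OF tS]])
  then show False using S(1) by simp
qed (rule T)

lemma cycle_circuit:
  assumes "is_cycle G T" "eulerian_cycle_tree G T"
  shows "circuit G T"
  unfolding circuit_def
proof (intro conjI allI impI notI)
  fix S assume S: "S \<subset> T" "eulerian_cycle_tree G S"
  have tS: "tight (ind S) S" and tT: "tight (ind T) T"
    using S(2) assms(2) cycle_tree_iff eulerian_cycle_tree_iff by blast+
  obtain Z where Z: "is_cycle G Z" "Z \<subseteq> S" using tight_has_cycle[OF tS] by blast
  obtain e where e: "e \<in> Z" using cycleD(3)[OF Z(1)] by blast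
  have "Z = T" using cycles_eq[OF tT Z(1) _ assms(1) order_refl e] Z(2) S(1) e by blast
  then show False using S(1) Z(2) by blast
qed (rule assms(2))

section \<open>Decomposing minimum covering walks of an Eulerian cycle-tree that is not a
  circuit\<close>

context
  fixes T assumes eul: "eulerian_cycle_tree G T" and not_circuit: "\<not> circuit G T"
begin

private lemma tT: "tight (ind T) T"
  using eul cycle_tree_iff eulerian_cycle_tree_iff by blast

private abbreviation "eb \<equiv> end_block T"

private lemmas eb_def = end_block_def[OF tT]
private lemmas ebD = end_blockD[OF tT]

text \<open>A single intersection vertex is an odd number, which excludes balance; the sign has
  square 1.\<close>

private lemma eb_unbalanced:
  assumes "eb C"
  shows "unbalanced G C"
proof -
  have "\<not> balanced G C" using eul ebD(1,2,4)[OF assms] unfolding eulerian_cycle_tree_iff by auto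
  moreover have "(cycle_sign G C)\<^sup>2 = 1" unfolding cycle_sign_def prod_power_distrib
  proof (rule prod.neutral, rule ballI)
    fix e assume "e \<in> C"
    then have "e \<in> edges G" using cycleD(1)[OF ebD(1)[OF assms]] by blast
    then show "(sgn_of G e)\<^sup>2 = 1" using sgn_cases[of e] by auto
  qed
  ultimately show ?thesis by (simp add: balanced_def unbalanced_def power2_eq_1_iff)
qed

text \<open>Two end-block cycles meeting at \<open>w\<close> use all edges at \<open>w\<close>, and
  \<open>w\<close> is the only exit of each. So they exhaust \<open>T\<close>, which would then be a
  circuit. This is what gives the connecting paths positive length.\<close>

private lemma eb_disjoint_verts:
  assumes C: "eb C" and D: "eb D" and "C \<noteq> D"
  shows "V C \<inter> V D = {}"
proof (rule ccontr)
  note CD = ebD(1,2)[OF C] ebD(1,2)[OF D]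
  assume "V C \<inter> V D \<noteq> {}"
  then obtain w where w: "w \<in> V C" "w \<in> V D" by blast
  obtain A B where AB: "split (ind T) T w A B" "C \<subseteq> A" "D \<subseteq> B" by (rule cycles_meet[OF tT CD \<open>C \<noteq> D\<close> w])
  have BA: "split (ind T) T w B A" using AB(1) split_sym by blast
  have wT: "w \<in> V (T - C)" "w \<in> V (T - D)"
    using cycle_vertex_split_iff[OF tT CD(1,2) w(1)] cycle_vertex_split_iff[OF tT CD(3,4) w(2)] AB(1) by blast+
  have at_w: "e \<in> C \<union> D" if "e \<in> T" "w \<in> ends G e" for e
    using split_saturated[OF tT CD(1) AB(2) w(1) AB(1) _ that(2)] split_saturated[OF tT CD(3) AB(3) w(2) BA _ that(2)]
      splitD(1)[OF AB(1)] that(1) by blast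
  have "V (C \<union> D) \<inter> V (T - (C \<union> D)) = {}"
  proof (rule ccontr)
    assume "V (C \<union> D) \<inter> V (T - (C \<union> D)) \<noteq> {}"
    then obtain z where z: "z \<in> V C \<or> z \<in> V D" "z \<in> V (T - (C \<union> D))" by auto
    have "z \<in> V (T - C)" "z \<in> V (T - D)" using vset_monoD[OF z(2)] by blast+
    then have "z = w" using z(1) ebD(3)[OF C w(1) wT(1)] ebD(3)[OF D w(2) wT(2)] by blast
    then show False using z(2) at_w by (auto simp: in_vset)
  qed
  then have T: "C \<union> D = T" using connD[OF tightD(2)[OF tT], of "C \<union> D"] CD(2,4) cycleD(3)[OF CD(1)] by blast
  have "Z = C \<or> Z = D" if Z: "is_cycle G Z" "Z \<subseteq> T" for Z
  proof -
    obtain e where e: "e \<in> Z" using cycleD(3)[OF Z(1)] by blast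
    then have "e \<in> C \<or> e \<in> D" using Z(2) T by blast
    then show ?thesis using cycles_eq[OF tT Z CD(1,2) e] cycles_eq[OF tT Z CD(3,4) e] by blast
  qed
  then show False using two_unbalanced_cycles_circuit[OF eul _ eb_unbalanced[OF C] eb_unbalanced[OF D]] not_circuit by blast
qed

text \<open>Stated for the beginning of a tour; rotation applies it to every pair of consecutive
  blocks, including the last and the first.\<close>

private lemma consecutive_blocks:
  assumes W: "tour (ind T) T u (c @ p @ d @ r)"
    and c: "eb (walk_edges c)" "cycle_walk G x c" and d: "eb (walk_edges d)" "cycle_walk G y d"
    and p: "\<And>C. eb C \<Longrightarrow> walk_edges p \<inter> C = {}"
  shows "type_III_circuit G c p d \<and> (\<forall>e. tree_indicator G (walk_edges (c @ p @ d)) e =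
    of_bool (e \<in> walk_edges c) + of_bool (e \<in> walk_edges d) + 2 * of_bool (e \<in> walk_edges p))"
proof -
  let ?C = "walk_edges c" and ?D = "walk_edges d" and ?P = "walk_edges p"
  have cne: "c \<noteq> []" and dne: "d \<noteq> []" using c(2) d(2) by (auto simp: cycle_walk_iff)
  have cy: "is_cycle G ?C" "is_cycle G ?D" using ebD(1) c(1) d(1) by blast+
  have WT: "walk_edges (c @ p @ d @ r) = T" "\<And>e. e \<in> T \<Longrightarrow> cnt (c @ p @ d @ r) e = ind T e"
    using W unfolding tour_def by blast+
  have "walk G u (c @ p @ d @ r) u" using W by (simp add: tour_def)
  then obtain a b b' where w: "walk G u c a" "walk G a p b" "walk G b d b'" "walk G b' r u"
    unfolding walk_append by blast
  have "x = u" using walk_start[OF w(1) cne] walk_start[of x c x] c(2) cne by (simp add: cycle_walk_iff)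
  then have xa: "x = u" "a = u" using walk_end_unique[OF w(1)] c(2) by (auto simp: cycle_walk_iff)
  have "y = b" using walk_start[OF w(3) dne] walk_start[of y d y] d(2) dne by (simp add: cycle_walk_iff)
  \<comment> \<open>If \<open>c\<close> and \<open>d\<close> traversed the same cycle, its edges
    would be used twice although their weight is 1.\<close>
  have CD: "?C \<noteq> ?D"
  proof
    assume eq: "?C = ?D"
    obtain e where e: "e \<in> ?C" using cycleD(3)[OF cy(1)] by blast
    then have "cnt c e \<noteq> 0" "cnt d e \<noteq> 0" using eq by (simp_all add: count_list_0_iff)
    then have "cnt (c @ p @ d @ r) e \<ge> 2" by simp
    moreover have "ind T e = 1" by (rule ind_cycle[OF cy(1) ebD(2)[OF c(1)] e])
    ultimately show False using WT(2)[of e] ebD(2)[OF c(1)] e by auto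
  qed
  have vCD: "V ?C \<inter> V ?D = {}" by (rule eb_disjoint_verts[OF c(1) d(1) CD])
  have uC: "u \<in> V ?C" using walk_start_in_vset[OF w(1) cne] by simp
  have bD: "b \<in> V ?D" using walk_start_in_vset[OF w(3) dne] by simp
  have pne: "p \<noteq> []"
  proof
    assume "p = []"
    then have "a = b" using w(2) by simp
    then show False using uC bD vCD xa by blast
  qed
  have "distinct (walk_verts a p)"
  proof (rule ccontr)
    assume nd: "\<not> distinct (walk_verts a p)"
    obtain p1 p2 p3 z where p123: "p = p1 @ p2 @ p3" "p2 \<noteq> []" "walk G a p1 z" "walk G z p2 z" "walk G z p3 b"
      by (rule walk_repeat[OF w(2) nd])
    have "tour (ind T) T u ((c @ p1) @ (p2 @ p3 @ d @ r))" using W p123(1) by simp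
    from tour_rotate[OF this] obtain z' where z': "tour (ind T) T z' ((p2 @ p3 @ d @ r) @ (c @ p1))" "walk G u (c @ p1) z'"
      by blast
    have "walk G u (c @ p1) z" using w(1) p123(3) by (auto simp: walk_append)
    then have "z' = z" using walk_end_unique z'(2) by blast
    \<comment> \<open>The tour is rotated to start with the repeated part \<open>p2\<close>, as
      \<open>closed_subwalk_side\<close> requires; the remainder is nonempty because it contains
      \<open>d\<close>.\<close>
    then have "tour (ind T) T z (p2 @ (p3 @ d @ r @ c @ p1))" using z'(1) by simp
    then obtain A B where AB: "split (ind T) T z A B" "walk_edges p2 = A"
      using closed_subwalk_side[OF tT _ p123(4,2)] dne by blast
    then obtain Z where "is_cycle G Z" "Z \<subseteq> A" "\<exists>v. V Z \<inter> V (T - Z) = {v}"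
      using side_contains_end_block[OF tT AB(1)] by blast
    then have "eb Z" "Z \<subseteq> ?P" "Z \<noteq> {}" using splitD(6)[OF AB(1)] AB(2) p123(1) cycleD(3)[of Z] by (auto simp: eb_def)
    then show False using p by blast
  qed
  then have sp: "simple_path G a p b" using w(2) by (simp add: simple_path_def)
  have PT: "?P \<subseteq> T" using WT(1) by auto
  \<comment> \<open>As \<open>p\<close> avoids the edges of \<open>Z\<close>, any common vertex is
    an exit of \<open>Z\<close>, and an end-block cycle has only one.\<close>
  have touch: "V Z \<inter> set (walk_verts a p) = {z}" if Z: "eb Z" "z \<in> V Z" "z \<in> V ?P" for Z z
  proof -
    have "?P \<subseteq> T - Z" using p[OF Z(1)] PT by blast
    then have out: "x \<in> V (T - Z)" if "x \<in> V ?P" for x using vset_monoD[OF that] by blast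
    have "set (walk_verts a p) = V ?P" using set_walk_verts[OF w(2)] walk_start_in_vset[OF w(2) pne] by auto
    then show ?thesis using ebD(3)[OF Z(1) _ _ Z(2) out[OF Z(3)]] out Z(2,3) by blast
  qed
  have aP: "a \<in> V ?P" "b \<in> V ?P" using walk_start_in_vset[OF w(2) pne] by auto
  have Ca: "V ?C \<inter> set (walk_verts a p) = {a}" using touch[OF c(1)] uC aP xa by blast
  have Db: "V ?D \<inter> set (walk_verts a p) = {b}" using touch[OF d(1) bD aP(2)] .
  note db = cy sp pne vCD Ca Db
  have X: "walk_edges (c @ p @ d) = ?C \<union> ?P \<union> ?D" by auto
  have unb: "unbalanced G ?C" "unbalanced G ?D" using eb_unbalanced c(1) d(1) by blast+
  have "circuit G (walk_edges (c @ p @ d))" unfolding X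
    by (rule two_unbalanced_cycles_circuit[OF dumbbell_eulerian[OF db unb] dumbbell_cycles[OF db] unb])
  then have "type_III_circuit G c p d" unfolding type_III_circuit_def
    using unb vCD sp pne Ca Db c(2) d(2) xa \<open>y = b\<close> by blast
  moreover have "tree_indicator G (walk_edges (c @ p @ d)) e =
    of_bool (e \<in> ?C) + of_bool (e \<in> ?D) + 2 * of_bool (e \<in> ?P)" for e
    unfolding X by (rule dumbbell_indicator[OF db])
  ultimately show ?thesis by blast
qed

lemma cnt_flat: "cnt (concat (map (\<lambda>(c, p). c @ p) bs)) e = (\<Sum>i<length bs. cnt (fst (bs ! i)) e + cnt (snd (bs ! i)) e)"
proof (induction bs)
  case (Cons b bs)
  then show ?case by (cases b) (simp add: sum.lessThan_Suc_shift del: sum.lessThan_Suc)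
qed simp

theorem end_block_decomposition_exists:
  assumes W: "min_covering_closed_walk G T W"
  shows "\<exists>k\<ge>1. \<exists>C P. end_block_decomposition G T W k C P \<and>
    (\<forall>e. real_of_int (tree_indicator G T e) = 1 / 2 * (\<Sum>i=0..k. real_of_int
       (tree_indicator G (walk_edges (C i @ P (i + 1) @ C (i + 1))) e)))"
proof -
  obtain u where u: "tour (ind T) T u W" using min_covering_tour[OF tT W] by blast
  have ct: "cycle_tree G T" using eul eulerian_cycle_tree_iff by blast
  have "\<exists>x A B. split (ind T) T x A B"
  proof (rule ccontr)
    assume "\<not> ?thesis"
    then have "is_cycle G T" using no_split_cycle[OF tT] by blast
    then show False using cycle_circuit eul not_circuit by blast
  qed
  then obtain x A B where "split (ind T) T x A B" by blast
  then obtain C1 C2 where C12: "eb C1" "eb C2" "C1 \<noteq> C2" by (rule two_end_blocks[OF tT])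
  have dj: "C1 \<inter> C2 = {}" using end_blocks_disjoint[OF tT C12(1,2)] C12(3) by blast
  have T12: "C1 \<subseteq> T" "C2 \<subseteq> T" "C1 \<noteq> {}" "C2 \<noteq> {}" using ebD(1,2) C12 cycleD(3) by blast+
  have edge_step: "\<exists>s\<in>set Y. fst (snd s) = e" if "e \<in> walk_edges Y" for Y :: "('v, 'e) steps" and e
    using that by (force simp: walk_edges_def)
  let ?in1 = "\<lambda>s. fst (snd s) \<in> C1"
  \<comment> \<open>The walk is first rotated to start with an edge of \<open>C2\<close> and then to
    its first edge in \<open>C1\<close>. The step before that edge lies outside \<open>C1\<close>,
    so the rotated walk \<open>W0\<close> starts in \<open>C1\<close> and ends outside of
    it.\<close>
  obtain e2 where e2: "e2 \<in> C2" using T12(4) by blast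
  then have "e2 \<in> walk_edges W" using T12(2) u by (auto simp: tour_def)
  then obtain s where s: "s \<in> set W" "fst (snd s) = e2" using edge_step by blast
  then obtain q1 q2 where q: "W = q1 @ s # q2" using split_list by metis
  obtain u' where u': "tour (ind T) T u' ((s # q2) @ q1)" using tour_rotate[of "ind T" T u q1 "s # q2"] u q by blast
  obtain e1 where e1: "e1 \<in> C1" using T12(3) by blast
  then have "e1 \<in> walk_edges ((s # q2) @ q1)" using T12(1) u' unfolding tour_def by blast
  then have "\<exists>s\<in>set ((s # q2) @ q1). ?in1 s" using edge_step e1 by metis
  then obtain ys h zs where y: "(s # q2) @ q1 = ys @ h # zs" "?in1 h" "\<forall>y\<in>set ys. \<not> ?in1 y"
    using split_list_first_prop[of "(s # q2) @ q1" ?in1] by blast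
  have "ys \<noteq> []" using y(1,2) s(2) e2 dj by (cases ys) auto
  define W0 where "W0 = (h # zs) @ ys"
  obtain u0 where u0: "tour (ind T) T u0 W0" using tour_rotate[of "ind T" T u' ys "h # zs"] u' y(1) unfolding W0_def by metis
  have hd0: "?in1 (hd W0)" using y(2) by (simp add: W0_def)
  have last0: "\<not> ?in1 (last W0)" using y(3) \<open>ys \<noteq> []\<close> by (simp add: W0_def)
  have "(s # q2) @ q1 = rotate (length q1) W" unfolding q by (simp add: rotate_append)
  moreover have "W0 = rotate (length ys) ((s # q2) @ q1)" unfolding y(1) W0_def by (simp only: rotate_append)
  ultimately have rot: "rotate (length ys + length q1) W = W0" by (simp add: rotate_rotate)
  have "\<exists>bs. W0 = flat bs \<and> blocks T bs"
    by (rule tour_blocks[OF tT C12(1) hd0 last0 u0, of "[]"]) (use C12(1) hd0 in auto)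
  then obtain bs where bs: "W0 = flat bs" "blocks T bs" by blast
  define n where "n = length bs"
  have blk: "eb (walk_edges (fst (bs ! i)))" "\<exists>x. cycle_walk G x (fst (bs ! i))"
    "\<And>C. eb C \<Longrightarrow> walk_edges (snd (bs ! i)) \<inter> C = {}" if "i < n" for i
  proof -
    obtain c p where cp: "bs ! i = (c, p)" by (cases "bs ! i")
    then have "(c, p) \<in> set bs" using nth_mem[of i bs] that by (simp add: n_def)
    then have "eb (walk_edges c) \<and> (\<exists>x. cycle_walk G x c) \<and> (\<forall>C. eb C \<longrightarrow> walk_edges p \<inter> C = {})"
      using bs(2) unfolding blocks_def[OF tT] by blast
    then show "eb (walk_edges (fst (bs ! i)))" "\<exists>x. cycle_walk G x (fst (bs ! i))"
      "\<And>C. eb C \<Longrightarrow> walk_edges (snd (bs ! i)) \<inter> C = {}" using cp by auto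
  qed
  have "W0 \<noteq> []" by (simp add: W0_def)
  then have n0: "n \<noteq> 0" using bs(1) by (auto simp: n_def)
  have n1: "n \<noteq> 1"
  proof
    assume 1: "n = 1"
    then obtain c p where cp: "bs = [(c, p)]" by (cases bs; cases "tl bs") (auto simp: n_def)
    have c: "eb (walk_edges c)" "\<And>C. eb C \<Longrightarrow> walk_edges p \<inter> C = {}" using blk(1,3)[of 0] 1 cp by auto
    have "T = walk_edges c \<union> walk_edges p" using u0 bs(1) cp by (simp add: tour_def)
    moreover have "walk_edges c \<inter> D = {}" if "eb D" "D \<noteq> walk_edges c" for D
      using end_blocks_disjoint[OF tT c(1) that(1)] that(2) by blast
    ultimately have "D = walk_edges c" if "eb D" for D using c(2)[OF that] ebD(1,2)[OF that] cycleD(3)[of D] that by blast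
    then show False using C12 by blast
  qed
  have n2: "n \<ge> 2" using n0 n1 by simp
  \<comment> \<open>Rotating the list of blocks by \<open>i\<close> brings block \<open>i\<close>
    and its cyclic successor to the front of a tour.\<close>
  have pair: "type_III_circuit G (fst (bs ! i)) (snd (bs ! i)) (fst (bs ! ((i + 1) mod n))) \<and>
     (\<forall>e. tree_indicator G (walk_edges (fst (bs ! i) @ snd (bs ! i) @ fst (bs ! ((i + 1) mod n)))) e =
       of_bool (e \<in> walk_edges (fst (bs ! i))) + of_bool (e \<in> walk_edges (fst (bs ! ((i + 1) mod n)))) +
       2 * of_bool (e \<in> walk_edges (snd (bs ! i))))" if i: "i < n" for i
  proof -
    have j: "(i + 1) mod n < n" using n2 by simp
    have "length (rotate i bs) = n" by (simp add: n_def)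
    then obtain b1 b2 zs' where r: "rotate i bs = b1 # b2 # zs'"
      using n2 by (cases "rotate i bs"; cases "tl (rotate i bs)") auto
    have "b1 = rotate i bs ! 0" "b2 = rotate i bs ! 1" using r by simp_all
    then have b: "b1 = bs ! i" "b2 = bs ! ((i + 1) mod n)"
      using nth_rotate[of 0 bs i] nth_rotate[of 1 bs i] n2 i unfolding n_def by force+
    have "flat bs = flat (take i bs) @ flat (drop i bs)"
      by (metis append_take_drop_id concat_append map_append)
    then obtain v where v: "tour (ind T) T v (flat (drop i bs) @ flat (take i bs))"
      using tour_rotate[of "ind T" T u0 "flat (take i bs)" "flat (drop i bs)"] u0 bs(1) by auto
    have "flat (drop i bs) @ flat (take i bs) = flat (rotate i bs)"
      using i by (simp add: rotate_drop_take n_def)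
    also have "\<dots> = fst (bs ! i) @ snd (bs ! i) @ fst (bs ! ((i + 1) mod n)) @ (snd b2 @ flat zs')"
      unfolding r b(1)[symmetric] b(2)[symmetric] by (simp add: case_prod_beta)
    finally have v': "tour (ind T) T v (fst (bs ! i) @ snd (bs ! i) @ fst (bs ! ((i + 1) mod n)) @ (snd b2 @ flat zs'))"
      using v by simp
    obtain x1 x2 where x: "cycle_walk G x1 (fst (bs ! i))" "cycle_walk G x2 (fst (bs ! ((i + 1) mod n)))"
      using blk(2)[OF i] blk(2)[OF j] by blast
    show ?thesis by (rule consecutive_blocks[OF v' blk(1)[OF i] x(1) blk(1)[OF j] x(2) blk(3)[OF i]])
  qed
  \<comment> \<open>Indices of cycles are read modulo \<open>n\<close>, so that
    \<open>C (k + 1)\<close> is \<open>C 0\<close>. The path after block \<open>i\<close> has the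
    index \<open>i + 1\<close>, hence the shift in \<open>P\<close>.\<close>
  define C where "C = (\<lambda>i. fst (bs ! (i mod n)))"
  define P where "P = (\<lambda>j. snd (bs ! (j - 1)))"
  define k where "k = n - 1"
  have k: "k + 1 = n" "k \<ge> 1" using n2 by (simp_all add: k_def)
  have Ci: "C i = fst (bs ! i)" "P (i + 1) = snd (bs ! i)" "C (i + 1) = fst (bs ! ((i + 1) mod n))" if "i < n" for i
    using that by (simp_all add: C_def P_def)
  have "concat (map (\<lambda>i. C i @ P (i + 1)) [0..<k + 1]) = flat bs"
  proof -
    have "map (\<lambda>i. C i @ P (i + 1)) [0..<k + 1] = map (\<lambda>(c, p). c @ p) bs"
      by (rule nth_equalityI) (simp_all add: k(1) n_def[symmetric] Ci case_prod_beta)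
    then show ?thesis by simp
  qed
  then have "end_block_decomposition G T W k C P"
    unfolding end_block_decomposition_def
  proof (intro conjI allI impI)
    show "\<exists>m. rotate m W = concat (map (\<lambda>i. C i @ P (i + 1)) [0..<k + 1])"
      using rot bs(1) \<open>concat (map (\<lambda>i. C i @ P (i + 1)) [0..<k + 1]) = flat bs\<close> by auto
    show "C (k + 1) = C 0" unfolding k(1) C_def by simp
    fix i assume "i \<le> k"
    then have i: "i < n" using k(1) by simp
    show "end_block_cycle G T (walk_edges (C i))"
      unfolding end_block_cycle_iff Ci(1)[OF i] using ct ebD(1,2,4)[OF blk(1)[OF i]] by blast
    show "type_III_circuit G (C i) (P (i + 1)) (C (i + 1))"
      unfolding Ci[OF i] using pair[OF i] by blast
  qed
  moreover have "real_of_int (tree_indicator G T e) = 1 / 2 * (\<Sum>i=0..k. real_of_int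
       (tree_indicator G (walk_edges (C i @ P (i + 1) @ C (i + 1))) e))" for e
  proof -
    let ?c = "\<lambda>i. of_bool (e \<in> walk_edges (fst (bs ! i))) :: int"
    let ?p = "\<lambda>i. of_bool (e \<in> walk_edges (snd (bs ! i))) :: int"
    have kn: "{0..k} = {..<n}" using k(1) by auto
    have shift: "(\<Sum>i<n. ?c ((i + 1) mod n)) = (\<Sum>i<n. ?c i)"
    proof (rule sum.reindex_bij_witness[of _ "\<lambda>i. (i + n - 1) mod n" "\<lambda>i. (i + 1) mod n"])
      fix i assume "i \<in> {..<n}"
      then have i: "i < n" by simp
      show "((i + 1) mod n + n - 1) mod n = i" using i n2 by (cases "i + 1 = n") auto
      show "((i + n - 1) mod n + 1) mod n = i" using i n2 by (cases i) (auto simp: mod_if)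
      show "(i + 1) mod n \<in> {..<n}" "(i + n - 1) mod n \<in> {..<n}" using n2 by simp_all
    qed simp
    \<comment> \<open>Every end-block cycle belongs to two consecutive circuits with weight 1, every
      connecting path to one circuit with weight 2. So the sum is twice the number of times
      \<open>W0\<close> uses \<open>e\<close>, which is twice the indicator.\<close>
    have "(\<Sum>i=0..k. tree_indicator G (walk_edges (C i @ P (i + 1) @ C (i + 1))) e) =
        (\<Sum>i<n. ?c i + ?c ((i + 1) mod n) + 2 * ?p i)"
      unfolding kn
    proof (rule sum.cong)
      fix i assume "i \<in> {..<n}"
      then have i: "i < n" by simp
      show "tree_indicator G (walk_edges (C i @ P (i + 1) @ C (i + 1))) e = ?c i + ?c ((i + 1) mod n) + 2 * ?p i"
        unfolding Ci[OF i] using pair[OF i] by blast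
    qed simp
    also have "\<dots> = 2 * (\<Sum>i<n. ?c i + ?p i)"
      using shift by (simp add: sum.distrib sum_distrib_left[symmetric])
    also have "(\<Sum>i<n. ?c i + ?p i) = int (cnt W0 e)"
      unfolding bs(1) cnt_flat n_def[symmetric] of_nat_sum
    proof (rule sum.cong)
      fix i assume "i \<in> {..<n}"
      then have i: "i < n" by simp
      obtain x where "cycle_walk G x (fst (bs ! i))" using blk(2)[OF i] by blast
      then have "cnt (fst (bs ! i)) e = of_bool (e \<in> walk_edges (fst (bs ! i)))"
        by (simp add: cycle_walk_iff count_list_distinct)
      moreover obtain a b where "simple_path G a (snd (bs ! i)) b"
        using pair[OF i] unfolding type_III_circuit_def by blast
      then have "cnt (snd (bs ! i)) e = of_bool (e \<in> walk_edges (snd (bs ! i)))"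
        using simple_path_distinct_edges by (simp add: count_list_distinct)
      ultimately show "?c i + ?p i = int (cnt (fst (bs ! i)) e + cnt (snd (bs ! i)) e)" by simp
    qed simp
    also have "int (cnt W0 e) = tree_indicator G T e"
    proof (cases "e \<in> T")
      case True
      then have "cnt W0 e = ind T e" using u0 by (simp add: tour_def)
      then show ?thesis using tree_indicator_eq[OF ct, of e] True by simp
    next
      case False
      then have "cnt W0 e = 0" using u0 by (auto simp: tour_def count_list_0_iff)
      then show ?thesis using tree_indicator_eq[OF ct, of e] False by simp
    qed
    finally have "(\<Sum>i=0..k. tree_indicator G (walk_edges (C i @ P (i + 1) @ C (i + 1))) e) = 2 * tree_indicator G T e" .
    then have "real_of_int (\<Sum>i=0..k. tree_indicator G (walk_edges (C i @ P (i + 1) @ C (i + 1))) e) =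
        real_of_int (2 * tree_indicator G T e)" by (rule arg_cong)
    then show ?thesis by simp
  qed
  ultimately show ?thesis using k(2) by blast
qed

end

end

theorem mainTheorem1:
  fixes G :: "('v, 'e) signed_graph"
    and \<epsilon> :: "'v \<Rightarrow> 'e \<Rightarrow> int"
    and f :: "'e \<Rightarrow> int"
  assumes "wf_signed_graph G"
    and "orientation G (edges G) \<epsilon>"
    and "integral_flow G \<epsilon> f"
  shows "(indecomposable G \<epsilon> f \<longleftrightarrow>
            (\<exists>T. eulerian_cycle_tree G T \<and>
               (\<forall>e. f e = coupling G (edges G) \<epsilon> (edges G) (reorient \<epsilon> f) e * tree_indicator G T e)))
       \<and> (\<forall>T. eulerian_cycle_tree G T \<and> \<not> circuit G T \<longrightarrow>
            (\<forall>W. min_covering_closed_walk G T W \<longrightarrow>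
               (\<exists>k\<ge>1. \<exists>C P. end_block_decomposition G T W k C P \<and>
                  (\<forall>e. real_of_int (tree_indicator G T e) =
                     1 / 2 * (\<Sum>i=0..k. real_of_int
                       (tree_indicator G (walk_edges (C i @ P (i + 1) @ C (i + 1))) e))))))"
proof -
  interpret sgraph G by (rule sgraph.intro[OF assms(1)])
  show ?thesis
  proof (intro conjI allI impI)
    fix T W
    assume "eulerian_cycle_tree G T \<and> \<not> circuit G T" "min_covering_closed_walk G T W"
    then show "\<exists>k\<ge>1. \<exists>C P. end_block_decomposition G T W k C P \<and>
        (\<forall>e. real_of_int (tree_indicator G T e) =
           1 / 2 * (\<Sum>i=0..k. real_of_int
             (tree_indicator G (walk_edges (C i @ P (i + 1) @ C (i + 1))) e)))"
      by (elim conjE) (rule end_block_decomposition_exists)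
  qed (rule indecomposable_iff[OF assms(2,3)])
qed

end
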